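(* Let $1\le p\le\infty$, $f\in X^p$, $x_0\in\mathbb{R}$, $0<\rho\le\infty$, and $0<\gamma<\infty$. The following statements are equivalent. (a) $f\in B_{p,\rho,\gamma}(x_0)$. (b) There exists $\delta>0$ such that $\{\|f-\sigma_{2^n}(f)\|_{p,\mathbb{B}(x_0,\delta)}\}_{n=0}^\infty\in\mathsf{b}_{\rho,\gamma}$. (c) There exists $\delta>0$ such that $\{\|\tau_n(f)\|_{p,\mathbb{B}(x_0,\delta)}\}_{n=0}^\infty\in\mathsf{b}_{\rho,\gamma}$.
   Context: Notation. $\mathbb{B}(x,r)=[x-r,x+r]$. All $L^p$ spaces are with respect to Lebesgue measure on $\mathbb{R}$; $\|\cdot\|_p$ is the $L^p(\mathbb{R})$ norm and $\|\cdot\|_{p,B}$ the $L^p(B)$ norm. $X^p=L^p(\mathbb{R})$ if $1\le p<\infty$, and $X^\infty$ is the set of continuous functions on $\mathbb{R}$ vanishing at infinity. Hermite functions: $\psi_j(x)=\frac{(-1)^j}{\pi^{1/4}2^{j/2}\sqrt{j!}}\exp(x^2/2)\left(\frac{d}{dx}\right)^j(\exp(-x^2))$, $j=0,1,\dots$; these are orthonormal in $L^2(\mathbb{R})$. For $t>0$, $\Pi_t=\mathrm{span}\{\psi_j:\sqrt{j}<t\}$, equivalently the set of functions $\exp(-x^2/2)P(x)$ with $P$ an algebraic polynomial of degree $<t^2$. For $f\in L^p$, $E_{t,p}(f)=\inf_{Q\in\Pi_t}\|f-Q\|_p$. Fix a low pass filter $h$: an even, infinitely differentiable function $h:\mathbb{R}\to[0,1]$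 with $h(u)=1$ for $|u|\le 1/2$, $h$ non-increasing on $[1/2,1]$, and $h(u)=0$ for $|u|\ge 1$. For $n>0$ let $\Phi_n(x,y)=\sum_{j=0}^\infty h(\sqrt{j}/n)\psi_j(x)\psi_j(y)$ and, for $f\in L^1+L^\infty$, $\sigma_n(f,x)=\int_{\mathbb{R}}\Phi_n(x,y)f(y)\,dy$. Let $\tau_0(f)=\sigma_1(f)$ and $\tau_n(f)=\sigma_{2^n}(f)-\sigma_{2^{n-1}}(f)$ for $n=1,2,\dots$. Sequence spaces: for $\mathbf{a}=\{a_n\}_{n=0}^\infty$, $[\![\mathbf{a}]\!]_{\rho,\gamma}=\left(\sum_{n=0}^\infty(2^{\gamma n}|a_n|)^\rho\right)^{1/\rho}$ if $0<\rho<\infty$, and $\sup_{n\ge0}2^{n\gamma}|a_n|$ if $\rho=\infty$; $\mathsf{b}_{\rho,\gamma}$ is the set of sequences with $[\![\mathbf{a}]\!]_{\rho,\gamma}<\infty$. Besov space: $B_{p,\rho,\gamma}$ is the set of all $f\in X^p$ with $\{E_{2^n,p}(f)\}_{n=0}^\infty\in\mathsf{b}_{\rho,\gamma}$. Local Besov space: $B_{p,\rho,\gamma}(x_0)$ is the set of all $f\in X^p$ for which there exists $\delta>0$ such that $\phi f\in B_{p,\rho,\gamma}$ for every infinitely differentiable function $\phi$ supported on $\mathbb{B}(x_0,\delta)$. *)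

theory Defs
  imports "HOL-Analysis.Analysis" "HOL-Probability.Essential_Supremum"
begin

text \<open>All functions are real-valued. The exponents \<open>p\<close> and \<open>\<rho>\<close> are extended nonnegative reals, and
  norms take values in \<^typ>\<open>ennreal\<close>, so that a divergent integral, supremum or series has the value
  \<open>\<infinity>\<close> and not a junk value.\<close>

definition ennpowr :: "ennreal \<Rightarrow> real \<Rightarrow> ennreal" where
  "ennpowr a r = (if a = \<infinity> then \<infinity> else ennreal (enn2real a powr r))"
  \<comment> \<open>only used for \<open>r > 0\<close>\<close>

definition smooth :: "(real \<Rightarrow> real) \<Rightarrow> bool" where
  "smooth g \<longleftrightarrow> (\<forall>k x. ((deriv ^^ k) g) differentiable (at x))"

definition Lp_norm :: "ennreal \<Rightarrow> real set \<Rightarrow> (real \<Rightarrow> real) \<Rightarrow> ennreal" where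
  "Lp_norm p B f =
     (if p = \<infinity> then esssup (lebesgue_on B) (\<lambda>x. ennreal \<bar>f x\<bar>)
      else ennpowr (\<integral>\<^sup>+x. ennreal (\<bar>f x\<bar> powr enn2real p) \<partial>lebesgue_on B) (1 / enn2real p))"

text \<open>The space $X^p$; for \<open>p < \<infinity>\<close> it consists of functions and not of classes of functions
  modulo equality almost everywhere.\<close>

definition Xspace :: "ennreal \<Rightarrow> (real \<Rightarrow> real) set" where
  "Xspace p =
     (if p = \<infinity> then {f. continuous_on UNIV f \<and> (f \<longlongrightarrow> 0) at_infinity}
      else {f. f \<in> borel_measurable lebesgue \<and> Lp_norm p UNIV f < \<infinity>})"

definition hermite_fun :: "nat \<Rightarrow> real \<Rightarrow> real" where
  "hermite_fun j x =
     (-1) ^ j / (pi powr (1/4) * 2 powr (real j / 2) * sqrt (fact j)) *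
     exp (x\<^sup>2 / 2) * (deriv ^^ j) (\<lambda>y. exp (- (y\<^sup>2))) x"

text \<open>The linear span of the Hermite functions \<open>hermite_fun j\<close> with \<open>sqrt j < t\<close>; there are only
  finitely many such \<open>j\<close>.\<close>

definition hermite_span :: "real \<Rightarrow> (real \<Rightarrow> real) set" where
  "hermite_span t = {Q. \<exists>c. Q = (\<lambda>x. \<Sum>j | sqrt (real j) < t. c j * hermite_fun j x)}"

definition best_approx :: "real \<Rightarrow> ennreal \<Rightarrow> (real \<Rightarrow> real) \<Rightarrow> ennreal" where
  "best_approx t p f = (INF Q\<in>hermite_span t. Lp_norm p UNIV (\<lambda>x. f x - Q x))"

definition low_pass_filter :: "(real \<Rightarrow> real) \<Rightarrow> bool" where
  "low_pass_filter h \<longleftrightarrow>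
     (\<forall>u. 0 \<le> h u \<and> h u \<le> 1) \<and>
     (\<forall>u. h (- u) = h u) \<and>
     smooth h \<and>
     (\<forall>u. \<bar>u\<bar> \<le> 1/2 \<longrightarrow> h u = 1) \<and>
     antimono_on {1/2..1} h \<and>
     (\<forall>u. 1 \<le> \<bar>u\<bar> \<longrightarrow> h u = 0)"

text \<open>For a low pass filter \<open>h\<close> and \<open>n > 0\<close> the series has only finitely many nonzero terms.\<close>

definition kernel :: "(real \<Rightarrow> real) \<Rightarrow> real \<Rightarrow> real \<Rightarrow> real \<Rightarrow> real" where
  "kernel h n x y = (\<Sum>j. h (sqrt (real j) / n) * hermite_fun j x * hermite_fun j y)"

definition sigma_op :: "(real \<Rightarrow> real) \<Rightarrow> real \<Rightarrow> (real \<Rightarrow> real) \<Rightarrow> real \<Rightarrow> real" where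
  "sigma_op h n f x = (LINT y|lebesgue. kernel h n x y * f y)"

fun tau_op :: "(real \<Rightarrow> real) \<Rightarrow> nat \<Rightarrow> (real \<Rightarrow> real) \<Rightarrow> real \<Rightarrow> real" where
  "tau_op h 0 f x = sigma_op h 1 f x"
| "tau_op h (Suc n) f x = sigma_op h (2 ^ Suc n) f x - sigma_op h (2 ^ n) f x"

definition seq_norm :: "ennreal \<Rightarrow> real \<Rightarrow> (nat \<Rightarrow> ennreal) \<Rightarrow> ennreal" where
  "seq_norm \<rho> \<gamma> a =
     (if \<rho> = \<infinity> then (SUP n. ennreal (2 powr (\<gamma> * real n)) * a n)
      else ennpowr (\<Sum>n. ennpowr (ennreal (2 powr (\<gamma> * real n)) * a n) (enn2real \<rho>))
             (1 / enn2real \<rho>))"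

definition seq_space :: "ennreal \<Rightarrow> real \<Rightarrow> (nat \<Rightarrow> ennreal) set" where
  "seq_space \<rho> \<gamma> = {a. seq_norm \<rho> \<gamma> a < \<infinity>}"

definition besov :: "ennreal \<Rightarrow> ennreal \<Rightarrow> real \<Rightarrow> (real \<Rightarrow> real) set" where
  "besov p \<rho> \<gamma> = {f \<in> Xspace p. (\<lambda>n. best_approx (2 ^ n) p f) \<in> seq_space \<rho> \<gamma>}"

definition local_besov :: "ennreal \<Rightarrow> ennreal \<Rightarrow> real \<Rightarrow> real \<Rightarrow> (real \<Rightarrow> real) set" where
  "local_besov p \<rho> \<gamma> x0 =
     {f \<in> Xspace p. \<exists>\<delta>>0. \<forall>\<phi>. smooth \<phi> \<and> closure {x. \<phi> x \<noteq> 0} \<subseteq> cball x0 \<delta> \<longrightarrow>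
        (\<lambda>x. \<phi> x * f x) \<in> besov p \<rho> \<gamma>}"

end

theory Submission
  imports Defs "HOL-Probability.Distributions" "HOL-Real_Asymp.Real_Asymp"
begin

text \<open>
  Multiplication by \<open>x\<close> shifts the index of a Hermite function by one, up and down. Hence a
  commutator of \<open>x\<close> with
  the operator with kernel \<open>\<Phi>\<^sub>n\<close> replaces the coefficients \<open>h (sqrt j / n)\<close> by their differences, of
  size \<open>n\<^sup>-\<^sup>2\<close>, at the cost of one creation or annihilation operator, of size \<open>n\<close>. Together with the
  bound \<open>sqrt (2 N)\<close> for the sum of the first \<open>N\<close> squared Hermite functions this gives
  \<open>\<bar>x - y\<bar>\<^sup>k \<bar>\<Phi>\<^sub>n x y\<bar> \<le> C n\<^sup>1\<^sup>-\<^sup>k\<close> for all \<open>k\<close>. So the operators \<open>\<sigma>\<^sub>n\<close> are bounded on \<open>L\<^sup>p\<close> uniformly in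
  \<open>n\<close>, and on a ball they see the values of \<open>f\<close> far from it only up to \<open>O(n\<^sup>-\<^sup>S)\<close>. As \<open>\<sigma>\<^sub>n\<close> reproduces the
  span of order \<open>n / 2\<close>, (a) implies (b).

  For the converse let \<open>\<phi>\<close> be a smooth cutoff function. Commuting \<open>\<phi>\<close> with the Hermite operator
  \<open>x\<^sup>2 - d\<^sup>2/dx\<^sup>2\<close> shows that the matrix elements of multiplication by \<open>\<phi>\<close> between indices below \<open>n\<^sup>2\<close> and
  above \<open>4 n\<^sup>2\<close> decay rapidly, so \<open>\<phi> \<sigma>\<^sub>n f\<close> has distance \<open>O(n\<^sup>-\<^sup>S)\<close> from the span of order \<open>4 n\<close>.

  Clearly (b) implies (c). Conversely, \<open>\<sigma>\<^sub>n f\<close> converges to \<open>f\<close> almost everywhere along a subsequence of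
  the powers of two, so by Fatou's lemma the error is at most a tail of the sum of the norms of the
  \<open>\<tau>\<^sub>m f\<close>, and Hardy's inequality applies.
\<close>

section \<open>Hermite functions\<close>

text \<open>The constant \<open>sqrt (2 N)\<close> arises because the derivative of the sum of
  squares telescopes to one product of neighbouring Hermite functions, whose \<open>L^1\<close> norm
  orthonormality controls; integrating from infinity gives the pointwise bound.

  The coefficients are samples, at spacing \<open>n^-2\<close>, of \<open>t -> h (sqrt t)\<close>.
  The root is singular at \<open>0\<close>, but \<open>h\<close> is constant there, so the
  composition is smooth and its differences of order \<open>r\<close> are of size
  \<open>n^(-2 r)\<close>.

  One argument serves all \<open>p\<close>. Every \<open>X^p\<close> lies in the space of functions
  integrable against \<open>1 / (1 + x^2)\<close>, and all remainders are measured by the norm of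
  \<open>f\<close> in that space. They are bounded pointwise, on a ball or by a multiple of
  \<open>1 / (1 + x^2)\<close>, and such bounds give \<open>L^p\<close> bounds with a constant free
  of \<open>p\<close>. The power \<open>S\<close> in a remainder only has to exceed
  \<open>\<gamma>\<close>.

  Convergence almost everywhere along a subsequence comes from convergence in \<open>L^1\<close> on
  bounded intervals. This is built up from indicators of half-lines, where pointwise convergence off
  one point is at hand, through Borel sets to all functions of the weighted space.\<close>

text \<open>\<open>he m\<close> is \<open>sqrt (m!)\<close> times the Hermite function of order \<open>m\<close>; this normalization keeps square
  roots out of the recurrences.\<close>

fun he :: "nat \<Rightarrow> real \<Rightarrow> real" where
  "he 0 x = exp (- (x\<^sup>2) / 2) / pi powr (1/4)"
| "he (Suc 0) x = sqrt 2 * x * he 0 x"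
| "he (Suc (Suc m)) x = sqrt 2 * x * he (Suc m) x - real (Suc m) * he m x"

text \<open>At \<open>m = 0\<close> the index \<open>m - 1\<close> is truncated to \<open>0\<close>,
  which does no harm because its coefficient \<open>real m\<close> is zero.\<close>

lemma he_recurrence: "sqrt 2 * x * he m x = he (Suc m) x + real m * he (m - 1) x"
  by (cases m) auto

text \<open>In this normalization the creation operator \<open>(x - d/dx) / sqrt 2\<close> maps
  \<open>he m\<close> to \<open>he (Suc m)\<close>. The induction differentiates the three-term
  recurrence.\<close>

lemma he_has_derivative:
  "(he m has_real_derivative x * he m x - sqrt 2 * he (Suc m) x) (at x)"
proof (induction m x rule: he.induct)
  case (1 x)
  have "((\<lambda>x. exp (- (x\<^sup>2) / 2) / pi powr (1/4)) has_real_derivative - x * he 0 x) (at x)"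
    by (auto intro!: derivative_eq_intros)
  moreover have "sqrt 2 * (sqrt 2 * a) = 2 * a" for a :: real
    by (simp flip: mult.assoc)
  then have "x * he 0 x - sqrt 2 * he (Suc 0) x = - x * he 0 x"
    by (simp only: he.simps mult.assoc) simp
  ultimately have "((\<lambda>x. exp (- (x\<^sup>2) / 2) / pi powr (1/4)) has_real_derivative
      x * he 0 x - sqrt 2 * he (Suc 0) x) (at x)"
    by (simp only:)
  then show ?case
    by (simp only: he.simps(1)[abs_def])
next
  case (2 x)
  have [simp]: "he (Suc 0) = (\<lambda>x. sqrt 2 * x * he 0 x)"
    by (simp add: fun_eq_iff)
  show ?case
    using 2 by (auto intro!: derivative_eq_intros simp del: he.simps(1) simp: algebra_simps)
next
  case (3 m x)
  have *: "he (Suc (Suc m)) = (\<lambda>x. sqrt 2 * x * he (Suc m) x - real (Suc m) * he m x)"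
    by (simp add: fun_eq_iff)
  have **: "he (Suc (Suc (Suc m))) x = sqrt 2 * x * he (Suc (Suc m)) x - real (Suc (Suc m)) * he (Suc m) x"
    by (rule he.simps)
  have ***: "he (Suc (Suc m)) x = sqrt 2 * x * he (Suc m) x - real (Suc m) * he m x"
    by (rule he.simps)
  have s: "sqrt 2 * (sqrt 2 * a) = 2 * a" for a :: real
    by (simp flip: mult.assoc)
  show ?case
    apply (subst *, subst **, subst ***)
    by (rule derivative_eq_intros 3 refl)+ (simp add: *** algebra_simps s del: he.simps)
qed

text \<open>The annihilation form of the same derivative, obtained by eliminating
  \<open>he (Suc m)\<close> with the recurrence. Having both forms lets terms with a factor
  \<open>x\<close> cancel in products.\<close>

lemma he_has_derivative':
  "(he m has_real_derivative real m * he (m - 1) x * sqrt 2 - x * he m x) (at x)"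
proof -
  have s: "sqrt 2 * (sqrt 2 * a) = 2 * a" for a :: real
    by (simp flip: mult.assoc)
  have "x * he m x - sqrt 2 * he (Suc m) x = real m * he (m - 1) x * sqrt 2 - x * he m x"
    using arg_cong[OF he_recurrence[of x m], of "\<lambda>t. sqrt 2 * t"]
    by (simp add: algebra_simps s del: he.simps)
  then show ?thesis
    by (rule DERIV_cong[OF he_has_derivative])
qed

lemma isCont_he [continuous_intros]: "isCont (he m) x"
  by (rule DERIV_isCont[OF he_has_derivative])

lemma continuous_on_he [continuous_intros]:
  assumes "continuous_on A g" shows "continuous_on A (\<lambda>x. he m (g x))"
  by (rule continuous_on_compose2[OF continuous_at_imp_continuous_on[of UNIV] assms])
     (simp_all add: isCont_he del: he.simps)

lemma borel_measurable_he [measurable]: "he m \<in> borel_measurable borel"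
  by (intro borel_measurable_continuous_onI continuous_intros)

text \<open>Differentiating \<open>exp (- x^2 / 2) * he j x\<close> amounts to one creation
  operator: the derivative of the Gaussian cancels \<open>x * he j x\<close>, and
  \<open>- sqrt 2 * he (Suc j) x\<close> survives.\<close>

lemma deriv_pow_gauss:
  "(deriv ^^ j) (\<lambda>y. exp (- (y\<^sup>2))) =
     (\<lambda>x. (-1) ^ j * pi powr (1/4) * 2 powr (real j / 2) * (exp (- (x\<^sup>2) / 2) * he j x))"
proof (induction j)
  case 0
  have "exp (- x\<^sup>2) = exp (- (x\<^sup>2) / 2) * exp (- (x\<^sup>2) / 2)" for x :: real
    by (simp flip: exp_add)
  then show ?case
    by (auto simp: fun_eq_iff)
next
  case (Suc j)
  have "deriv (\<lambda>x. (-1) ^ j * pi powr (1/4) * 2 powr (real j / 2) * (exp (- (x\<^sup>2) / 2) * he j x)) x =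
     (-1) ^ j * pi powr (1/4) * 2 powr (real j / 2) * (exp (- (x\<^sup>2) / 2) * (- sqrt 2 * he (Suc j) x))" for x
    by (rule DERIV_imp_deriv)
       (auto intro!: derivative_eq_intros he_has_derivative simp: algebra_simps simp del: he.simps)
  moreover have "2 powr (real (Suc j) / 2) = 2 powr (real j / 2) * sqrt 2"
    by (simp add: add_divide_distrib powr_add powr_half_sqrt)
  ultimately show ?case
    by (simp add: Suc fun_eq_iff)
qed

text \<open>Ties the Rodrigues formula of the definition to the recursion for \<open>he\<close>: the
  two signs \<open>(-1) ^ j\<close> and the two Gaussian factors cancel.\<close>

lemma hermite_fun_eq: "hermite_fun j x = he j x / sqrt (fact j)"
proof -
  have "exp (x\<^sup>2 / 2) * exp (- (x\<^sup>2) / 2) = 1" by (simp flip: exp_add)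
  moreover have "(-1) ^ j * (-1) ^ j = (1::real)"
    by (simp flip: power_mult_distrib)
  ultimately have "hermite_fun j x = ((-1) ^ j * (-1) ^ j) * (exp (x\<^sup>2 / 2) * exp (- (x\<^sup>2) / 2)) * he j x / sqrt (fact j)"
    unfolding hermite_fun_def deriv_pow_gauss by (simp add: field_simps del: he.simps)
  with \<open>exp (x\<^sup>2 / 2) * exp (- (x\<^sup>2) / 2) = 1\<close> \<open>(-1) ^ j * (-1) ^ j = (1::real)\<close> show ?thesis
    by simp
qed

lemma power_le_fact_exp:
  fixes x :: real assumes "0 \<le> x" shows "x ^ k \<le> fact k * exp x"
proof -
  have "(\<Sum>n\<in>{k}. inverse (fact n) * x ^ n) \<le> (\<Sum>n. inverse (fact n) * x ^ n)"
    using assms by (intro sum_le_suminf summable_exp) auto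
  then show ?thesis
    by (simp add: exp_def field_simps divideR_right scaleR_conv_of_real)
qed

text \<open>The power \<open>k\<close> is arbitrary in the induction because the recurrence trades
  an index for one more factor \<open>x\<close>. The base case is Gaussian decay through
  \<open>power_le_fact_exp\<close>.\<close>

lemma he_power_bounded: "\<exists>C. \<forall>x. \<bar>x ^ k * he m x\<bar> \<le> C"
proof (induction m arbitrary: k rule: less_induct)
  case (less m)
  consider "m = 0" | "m = 1" | m' where "m = Suc (Suc m')"
    by (metis One_nat_def not0_implies_Suc)
  then show ?case
  proof cases
    case 1
    have "\<bar>x ^ k * he 0 x\<bar> \<le> (1 + 2 ^ k * fact k) / pi powr (1/4)" for x
    proof -
      have "(x\<^sup>2 / 2) ^ k \<le> fact k * exp (x\<^sup>2 / 2)"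
        by (intro power_le_fact_exp) auto
      then have "(x\<^sup>2) ^ k * exp (- (x\<^sup>2) / 2) \<le> 2 ^ k * fact k"
        by (simp add: field_simps exp_minus power_divide)
      \<comment> \<open>The exponential series controls powers of \<open>x^2\<close> only, hence the
        passage to an even power.\<close>
      moreover have "\<bar>x\<bar> ^ k \<le> 1 + (x\<^sup>2) ^ k"
      proof (cases "\<bar>x\<bar> \<le> 1")
        case True
        then have "\<bar>x\<bar> ^ k \<le> 1" by (simp add: power_le_one)
        then show ?thesis by (smt (verit) zero_le_power zero_le_power2)
      next
        case False
        then have "\<bar>x\<bar> ^ k \<le> \<bar>x\<bar> ^ (2 * k)" by (intro power_increasing) auto
        then show ?thesis by (simp add: power_mult)
      qed
      then have "\<bar>x\<bar> ^ k * exp (- (x\<^sup>2) / 2) \<le> (1 + (x\<^sup>2) ^ k) * exp (- (x\<^sup>2) / 2)"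
        by (intro mult_right_mono) auto
      moreover have "exp (- (x\<^sup>2) / 2) \<le> 1" by simp
      moreover have "(1 + (x\<^sup>2) ^ k) * exp (- (x\<^sup>2) / 2) = exp (- (x\<^sup>2) / 2) + (x\<^sup>2) ^ k * exp (- (x\<^sup>2) / 2)"
        by (simp add: algebra_simps)
      ultimately have "\<bar>x\<bar> ^ k * exp (- (x\<^sup>2) / 2) \<le> 1 + 2 ^ k * fact k"
        by linarith
      then show ?thesis
        by (simp add: abs_mult power_abs divide_right_mono)
    qed
    then show ?thesis using 1 by blast
  next
    case 2
    obtain C where C: "\<And>x. \<bar>x ^ Suc k * he 0 x\<bar> \<le> C"
      using less[of 0 "Suc k"] 2 by auto
    have "\<bar>x ^ k * he (Suc 0) x\<bar> \<le> sqrt 2 * C" for x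
    proof -
      have "\<bar>x ^ k * he (Suc 0) x\<bar> = sqrt 2 * \<bar>x ^ Suc k * he 0 x\<bar>"
        by (simp add: abs_mult)
      also have "\<dots> \<le> sqrt 2 * C" using C by (intro mult_left_mono) auto
      finally show ?thesis .
    qed
    then show ?thesis using 2 by auto
  next
    case 3
    obtain C where C: "\<And>x. \<bar>x ^ Suc k * he (Suc m') x\<bar> \<le> C"
      using less[of "Suc m'" "Suc k"] 3 by auto
    obtain D where D: "\<And>x. \<bar>x ^ k * he m' x\<bar> \<le> D"
      using less[of m' "k"] 3 by auto
    have "\<bar>x ^ k * he m x\<bar> \<le> sqrt 2 * C + real (Suc m') * D" for x
    proof -
      have "x ^ k * he m x = sqrt 2 * (x ^ Suc k * he (Suc m') x) - real (Suc m') * (x ^ k * he m' x)"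
        by (simp add: 3 algebra_simps)
      then have "\<bar>x ^ k * he m x\<bar> \<le> \<bar>sqrt 2 * (x ^ Suc k * he (Suc m') x)\<bar> + \<bar>real (Suc m') * (x ^ k * he m' x)\<bar>"
        by (simp only: abs_triangle_ineq4)
      also have "\<dots> = sqrt 2 * \<bar>x ^ Suc k * he (Suc m') x\<bar> + real (Suc m') * \<bar>x ^ k * he m' x\<bar>"
        by (simp only: abs_mult) simp
      also have "\<dots> \<le> sqrt 2 * C + real (Suc m') * D"
        using C D by (intro add_mono mult_left_mono) auto
      finally show ?thesis .
    qed
    then show ?thesis by blast
  qed
qed

declare he.simps [simp del]

text \<open>The bounds for the exponents \<open>k\<close> and \<open>k + 2\<close> add up. The
  function \<open>1 / (1 + x^2)\<close> is the standard integrable majorant from here on.\<close>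

lemma he_power_decay: "\<exists>C\<ge>0. \<forall>x. \<bar>x ^ k * he m x\<bar> \<le> C / (1 + x\<^sup>2)"
proof -
  obtain C D where C: "\<And>x. \<bar>x ^ k * he m x\<bar> \<le> C" and D: "\<And>x. \<bar>x ^ (k + 2) * he m x\<bar> \<le> D"
    using he_power_bounded by metis
  have "\<bar>x ^ k * he m x\<bar> * (1 + x\<^sup>2) \<le> C + D" for x
  proof -
    have "\<bar>x ^ (k + 2) * he m x\<bar> = \<bar>x ^ k * he m x\<bar> * x\<^sup>2"
      by (simp add: abs_mult power_add flip: power2_eq_square)
    with C[of x] D[of x] show ?thesis
      by (simp add: algebra_simps)
  qed
  then have *: "\<bar>x ^ k * he m x\<bar> \<le> (C + D) / (1 + x\<^sup>2)" for x
    by (subst pos_le_divide_eq) (auto intro: add_pos_nonneg)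
  moreover have "C + D \<ge> 0"
    using order_trans[OF abs_ge_zero *[of 0]] by simp
  ultimately show ?thesis by blast
qed

lemma he_decay: "\<exists>C\<ge>0. \<forall>x. \<bar>he m x\<bar> \<le> C / (1 + x\<^sup>2)"
  using he_power_decay[of 0 m] by simp

lemma has_bochner_integral_cauchy_density:
  "has_bochner_integral lborel (\<lambda>x::real. 1 / (1 + x\<^sup>2)) pi"
proof -
  have 1: "DERIV arctan x :> 1 / (1 + x\<^sup>2)" for x
    using DERIV_arctan[of x] by (simp add: inverse_eq_divide)
  have 2: "isCont (\<lambda>x::real. 1 / (1 + x\<^sup>2)) x" for x
    by (intro continuous_intros) (simp add: add_nonneg_eq_0_iff)
  have 3: "((arctan \<circ> real_of_ereal) \<longlongrightarrow> - (pi/2)) (at_right (-\<infinity>))"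
    "((arctan \<circ> real_of_ereal) \<longlongrightarrow> pi/2) (at_left \<infinity>)"
    using tendsto_arctan_at_bot tendsto_arctan_at_top
    by (simp_all add: ereal_tendsto_simps)
  have "set_integrable lborel (einterval (-\<infinity>) \<infinity>) (\<lambda>x::real. 1 / (1 + x\<^sup>2))"
    by (rule interval_integral_FTC_nonneg(1)[of _ _ arctan, OF _ _ _ _ 3]) (use 1 2 in auto)
  moreover have "(LBINT x=-\<infinity>..\<infinity>. 1 / (1 + x\<^sup>2)) = pi/2 - (- (pi/2))"
    by (rule interval_integral_FTC_nonneg(2)[of _ _ arctan, OF _ _ _ _ 3]) (use 1 2 in auto)
  ultimately show ?thesis
    by (simp add: has_bochner_integral_iff set_integrable_def
        interval_lebesgue_integral_def set_lebesgue_integral_def)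
qed

lemma integrable_cauchy_density: "integrable lborel (\<lambda>x::real. c / (1 + x\<^sup>2))"
  using has_bochner_integral_mult_right[OF has_bochner_integral_cauchy_density, of c]
  by (simp add: has_bochner_integral_iff)

lemma integral_cauchy_density: "(\<integral>x. c / (1 + x\<^sup>2) \<partial>lborel) = c * pi" for c :: real
  using has_bochner_integral_mult_right[OF has_bochner_integral_cauchy_density, of c]
  by (simp add: has_bochner_integral_iff)

lemma one_plus_square_pos [simp]: "0 < 1 + (x::real)\<^sup>2"
  by (simp add: add_pos_nonneg)

lemma integrable_decay:
  fixes f :: "real \<Rightarrow> real"
  assumes "f \<in> borel_measurable borel" "\<And>x. \<bar>f x\<bar> \<le> C / (1 + x\<^sup>2)"
  shows "integrable lborel f"
  by (rule Bochner_Integration.integrable_bound[OF integrable_cauchy_density[of C]])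
     (use assms order_trans[OF assms(2) abs_ge_self] in auto)

lemma he_bounded: "\<exists>C\<ge>0. \<forall>x. \<bar>he m x\<bar> \<le> C"
proof -
  obtain C where "\<And>x. \<bar>he m x\<bar> \<le> C" using he_power_bounded[of 0 m] by auto
  then show ?thesis by (metis abs_ge_zero order_trans)
qed

lemma power_he_mult_decay: "\<exists>C\<ge>0. \<forall>x. \<bar>x ^ k * he i x * he j x\<bar> \<le> C / (1 + x\<^sup>2)"
proof -
  obtain C where C: "C \<ge> 0" "\<And>x. \<bar>x ^ k * he i x\<bar> \<le> C / (1 + x\<^sup>2)" using he_power_decay by blast
  obtain D where D: "D \<ge> 0" "\<And>x. \<bar>he j x\<bar> \<le> D" using he_bounded by blast
  have "\<bar>x ^ k * he i x * he j x\<bar> \<le> C / (1 + x\<^sup>2) * D" for x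
    unfolding abs_mult[of "x ^ k * he i x"] using C D by (intro mult_mono) auto
  then show ?thesis using C D by (intro exI[of _ "C * D"]) auto
qed

lemma integrable_power_he_mult [simp, intro]:
  "integrable lborel (\<lambda>x. x ^ k * he i x * he j x)"
  using power_he_mult_decay[of k i j] by (auto intro: integrable_decay)

lemma integrable_he_mult [simp, intro]:
  "integrable lborel (\<lambda>x. he i x * he j x)" "integrable lborel (\<lambda>x. x * he i x * he j x)"
  using integrable_power_he_mult[of 0 i j] integrable_power_he_mult[of 1 i j] by simp_all

section \<open>Orthogonality by integration by parts\<close>

lemma integral_deriv_eq_0:
  fixes F :: "real \<Rightarrow> real"
  assumes F: "\<And>x. (F has_real_derivative F' x) (at x)" and cont: "\<And>x. isCont F' x"
    and int: "integrable lborel F'" and "(F \<longlongrightarrow> 0) at_top" "(F \<longlongrightarrow> 0) at_bot"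
  shows "(\<integral>x. F' x \<partial>lborel) = 0"
proof -
  have 3: "((F \<circ> real_of_ereal) \<longlongrightarrow> 0) (at_right (-\<infinity>))"
    "((F \<circ> real_of_ereal) \<longlongrightarrow> 0) (at_left \<infinity>)"
    using assms by (simp_all add: ereal_tendsto_simps)
  have "(LBINT x=-\<infinity>..\<infinity>. F' x) = 0 - 0"
    by (rule interval_integral_FTC_integrable[of _ _ F, OF _ _ _ _ 3])
       (use F cont int in \<open>auto simp: set_integrable_def has_real_derivative_iff_has_vector_derivative\<close>)
  then show ?thesis
    by (simp add: interval_lebesgue_integral_def set_lebesgue_integral_def)
qed

lemma tendsto_0_decay:
  fixes F :: "real \<Rightarrow> real"
  assumes "\<And>x. \<bar>F x\<bar> \<le> C / (1 + x\<^sup>2)"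
  shows "(F \<longlongrightarrow> 0) at_top" "(F \<longlongrightarrow> 0) at_bot"
proof -
  have a: "((\<lambda>x::real. C / (1 + x\<^sup>2)) \<longlongrightarrow> 0) at_top"
    by real_asymp
  have b: "((\<lambda>x::real. C / (1 + x\<^sup>2)) \<longlongrightarrow> 0) at_bot"
    by real_asymp
  show "(F \<longlongrightarrow> 0) at_top" "(F \<longlongrightarrow> 0) at_bot"
    by (rule tendsto_rabs_zero_cancel, rule tendsto_sandwich[OF _ _ tendsto_const a], use assms in auto)
       (rule tendsto_rabs_zero_cancel, rule tendsto_sandwich[OF _ _ tendsto_const b], use assms in auto)
qed

lemma integral_he_0: "(\<integral>x. he 0 x * he 0 x \<partial>lborel) = 1"
proof -
  have "has_bochner_integral lborel (\<lambda>x::real. exp (- x\<^sup>2)) (2 * (sqrt pi / 2))"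
    using has_bochner_integral_even_function[OF gaussian_moment_0] by simp
  moreover have "he 0 x * he 0 x = exp (- x\<^sup>2) / sqrt pi" for x
  proof -
    have "pi powr (1/4) * pi powr (1/4) = sqrt pi" by (simp flip: powr_add add: powr_half_sqrt)
    moreover have "exp (- (x\<^sup>2) / 2) * exp (- (x\<^sup>2) / 2) = exp (- x\<^sup>2)" by (simp flip: exp_add)
    ultimately show ?thesis by (simp add: he.simps)
  qed
  ultimately show ?thesis
    by (simp add: has_bochner_integral_iff)
qed

text \<open>Adding the identities from \<open>(f g)' = f' g + f g'\<close> and from the symmetry of multiplication by
  \<open>x\<close> shifts both indices down by one.\<close>

lemma integral_he_shift:
  "(\<integral>x. he i x * he (Suc j) x \<partial>lborel) = real i * (\<integral>x. he (i - 1) x * he j x \<partial>lborel)"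
proof -
  let ?I = "\<lambda>i j. (\<integral>x. he i x * he j x \<partial>lborel)"
  \<comment> \<open>One factor is differentiated in annihilation form and the other in creation
    form, so the terms with the factor \<open>x\<close> cancel.\<close>
  let ?F' = "\<lambda>x. (real i * he (i - 1) x * sqrt 2 - x * he i x) * he j x + he i x * (x * he j x - sqrt 2 * he (Suc j) x)"
  have eq: "?F' = (\<lambda>x. sqrt 2 * (real i * (he (i - 1) x * he j x) - he i x * he (Suc j) x))"
    by (auto simp: algebra_simps fun_eq_iff)
  obtain C where C: "\<And>x. \<bar>x ^ 0 * he i x * he j x\<bar> \<le> C / (1 + x\<^sup>2)"
    using power_he_mult_decay by blast
  have "(\<integral>x. ?F' x \<partial>lborel) = 0"
  proof (rule integral_deriv_eq_0[of "\<lambda>x. he i x * he j x"])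
    show "((\<lambda>x. he i x * he j x) has_real_derivative ?F' x) (at x)" for x
      by (rule derivative_eq_intros he_has_derivative[of j] he_has_derivative'[of i] refl)+
         (simp add: algebra_simps)
    show "isCont ?F' x" for x
      by (intro continuous_intros)
    show "integrable lborel ?F'" unfolding eq
      by (intro integrable_mult_right Bochner_Integration.integrable_diff integrable_he_mult)
    show "((\<lambda>x. he i x * he j x) \<longlongrightarrow> 0) at_top" "((\<lambda>x. he i x * he j x) \<longlongrightarrow> 0) at_bot"
      using C by (auto intro: tendsto_0_decay[where C = C])
  qed
  then show ?thesis unfolding eq by simp
qed

text \<open>Both indices are lowered until one of them is \<open>0\<close>. Off the diagonal the
  factor \<open>real i\<close> of \<open>integral_he_shift\<close> then vanishes; on the diagonal
  these factors build up the factorial.\<close>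

lemma he_orthogonal: "(\<integral>x. he i x * he j x \<partial>lborel) = (if i = j then fact i else 0)"
proof (induction j arbitrary: i)
  case 0
  show ?case
  proof (cases i)
    case (Suc k)
    have "(\<integral>x. he i x * he 0 x \<partial>lborel) = (\<integral>x. he 0 x * he (Suc k) x \<partial>lborel)"
      by (simp add: Suc mult.commute)
    then show ?thesis using Suc by (simp add: integral_he_shift)
  qed (use integral_he_0 in simp)
next
  case (Suc j)
  show ?case by (cases i) (auto simp: integral_he_shift Suc)
qed

lemma hermite_orthonormal:
  "(\<integral>x. hermite_fun i x * hermite_fun j x \<partial>lborel) = (if i = j then 1 else 0)"
  by (simp add: hermite_fun_eq he_orthogonal real_sqrt_mult_self)

text \<open>The arithmetic-geometric mean inequality, weighted by the ratio
  \<open>sqrt (Suc n)\<close> of the two \<open>L^2\<close> norms. With this weight both terms are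
  equal, so the result is as good as Cauchy-Schwarz.\<close>

lemma integral_abs_he_mult_le:
  "(\<integral>x. \<bar>he n x * he (Suc n) x\<bar> \<partial>lborel) \<le> sqrt (real (Suc n)) * fact n"
proof -
  let ?s = "sqrt (real (Suc n))"
  have am: "\<bar>a * b\<bar> \<le> (?s * (a * a) + (b * b) / ?s) / 2" for a b :: real
  proof -
    have "0 \<le> (?s * \<bar>a\<bar> - \<bar>b\<bar>)\<^sup>2" by simp
    also have "\<dots> = ?s * (?s * (a * a)) - 2 * ?s * \<bar>a * b\<bar> + b * b"
      by (simp add: power2_eq_square algebra_simps abs_mult)
    finally have "2 * ?s * \<bar>a * b\<bar> \<le> ?s * (?s * (a * a)) + b * b" by simp
    then show ?thesis by (simp add: field_simps del: of_nat_Suc)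
  qed
  have "(\<integral>x. \<bar>he n x * he (Suc n) x\<bar> \<partial>lborel) \<le>
        (\<integral>x. (?s * (he n x * he n x) + he (Suc n) x * he (Suc n) x / ?s) / 2 \<partial>lborel)"
    by (intro integral_mono am integrable_abs integrable_he_mult Bochner_Integration.integrable_add
        integrable_divide integrable_mult_right)
  also have "\<dots> = (?s * fact n + fact (Suc n) / ?s) / 2"
    by (subst integral_divide_zero, subst Bochner_Integration.integral_add)
       (simp_all add: he_orthogonal del: of_nat_Suc)
  also have "fact (Suc n) / ?s = ?s * fact n"
    by (simp add: field_simps real_sqrt_mult_self del: of_nat_Suc)
  finally show ?thesis by (simp add: mult.commute)
qed

text \<open>The derivative of each square is a difference of consecutive products
  \<open>he j * he (Suc j) / fact j\<close>, so the sum telescopes to its last product.\<close>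

lemma christoffel_has_derivative:
  "((\<lambda>x. \<Sum>j\<le>n. (he j x)\<^sup>2 / fact j) has_real_derivative - sqrt 2 * he n x * he (Suc n) x / fact n) (at x)"
proof (induction n)
  case 0
  have "((\<lambda>x. (he 0 x)\<^sup>2) has_real_derivative 2 * he 0 x * (x * he 0 x - sqrt 2 * he (Suc 0) x)) (at x)"
    using DERIV_power[OF he_has_derivative[of 0 x], of 2] by (simp add: ac_simps)
  moreover have "2 * he 0 x * (x * he 0 x - sqrt 2 * he (Suc 0) x) = - sqrt 2 * he 0 x * he (Suc 0) x"
  proof -
    have "x * he 0 x - sqrt 2 * he (Suc 0) x = - (sqrt 2 * he (Suc 0) x) / 2"
      using arg_cong[OF he_recurrence[of x 0], of "\<lambda>t. sqrt 2 * t"]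
      by (simp add: mult.assoc[symmetric])
    then show ?thesis by simp
  qed
  ultimately show ?case by simp
next
  case (Suc n)
  have s: "sqrt 2 * (sqrt 2 * a) = 2 * a" for a :: real
    by (simp flip: mult.assoc)
  \<comment> \<open>\<open>d\<close> is the mean of the creation form and the annihilation form of
    the derivative of \<open>he (Suc n)\<close>, in which \<open>x\<close> cancels.\<close>
  define d where "d = (real (Suc n) * he n x * sqrt 2 - sqrt 2 * he (Suc (Suc n)) x) / 2"
  have "2 * (real (Suc n) * he n x * sqrt 2 - x * he (Suc n) x) = real (Suc n) * he n x * sqrt 2 - sqrt 2 * he (Suc (Suc n)) x"
    using arg_cong[OF he_recurrence[of x "Suc n"], of "\<lambda>t. sqrt 2 * t"] by (simp add: algebra_simps s)
  then have d: "real (Suc n) * he n x * sqrt 2 - x * he (Suc n) x = d"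
    by (simp add: d_def)
  have 1: "((\<lambda>x. (he (Suc n) x)\<^sup>2 / fact (Suc n)) has_real_derivative 2 * he (Suc n) x * d / fact (Suc n)) (at x)"
    unfolding d[symmetric]
    using DERIV_cdivide[OF DERIV_power[OF he_has_derivative'[of "Suc n" x], of 2], of "fact (Suc n)"]
    by (simp add: ac_simps del: fact_Suc of_nat_Suc)
  have 2: "- sqrt 2 * he n x * he (Suc n) x / fact n + 2 * he (Suc n) x * d / fact (Suc n) =
      - sqrt 2 * he (Suc n) x * he (Suc (Suc n)) x / fact (Suc n)"
  proof -
    have "- w * a * b / F + 2 * b * ((S * a * w - w * c) / 2) / (S * F) = - w * b * c / (S * F)"
      if "S \<noteq> 0" "F \<noteq> 0" for a b c w S F :: real
      using that by (simp add: divide_simps) algebra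
    then show ?thesis
      unfolding d_def fact_Suc of_nat_mult[symmetric] by (simp del: of_nat_Suc)
  qed
  show ?case
    using DERIV_cong[OF DERIV_add[OF Suc 1] 2] by (simp del: fact_Suc)
qed

text \<open>The sum tends to \<open>0\<close> at infinity, so its value at \<open>x\<close> is at
  most the \<open>L^1\<close> norm of its derivative, a single product of neighbours.\<close>

lemma christoffel_le: "(\<Sum>j\<le>n. (he j x)\<^sup>2 / fact j) \<le> sqrt (2 * real (Suc n))"
proof -
  let ?K = "\<lambda>x. \<Sum>j\<le>n. (he j x)\<^sup>2 / fact j"
  let ?K' = "\<lambda>x. - sqrt 2 * he n x * he (Suc n) x / fact n"
  have *: "?K x \<le> ?K T + sqrt (2 * real (Suc n))" if "x \<le> T" for T
  proof -
    have "(\<integral>y. ?K' y * indicator {x..T} y \<partial>lborel) = ?K T - ?K x"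
      by (rule integral_FTC_Icc_real) (use that christoffel_has_derivative[of n] in \<open>auto intro!: continuous_intros\<close>)
    then have "?K x - ?K T = (\<integral>y. - ?K' y * indicator {x..T} y \<partial>lborel)"
      by simp
    also have "\<dots> \<le> (\<integral>y. sqrt 2 / fact n * \<bar>he n y * he (Suc n) y\<bar> \<partial>lborel)"
    proof (rule integral_mono)
      have "integrable lborel (\<lambda>y. sqrt 2 / fact n * (indicator {x..T} y * (he n y * he (Suc n) y)))"
        by (intro integrable_mult_right integrable_mult_indicator[where 'b = real, simplified] integrable_he_mult) auto
      then show "integrable lborel (\<lambda>y. - ?K' y * indicator {x..T} y)"
        by (simp add: mult_ac)
      show "integrable lborel (\<lambda>y. sqrt 2 / fact n * \<bar>he n y * he (Suc n) y\<bar>)"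
        by (intro integrable_mult_right integrable_abs integrable_he_mult)
      show "- ?K' y * indicator {x..T} y \<le> sqrt 2 / fact n * \<bar>he n y * he (Suc n) y\<bar>" for y
        using abs_ge_self[of "he n y * he (Suc n) y"]
        by (auto simp: indicator_def mult.assoc intro!: divide_right_mono mult_left_mono)
    qed
    also have "\<dots> \<le> sqrt 2 / fact n * (sqrt (real (Suc n)) * fact n)"
      unfolding integral_mult_right_zero by (intro mult_left_mono integral_abs_he_mult_le) auto
    finally show ?thesis by (simp add: real_sqrt_mult del: of_nat_Suc)
  qed
  have "(?K \<longlongrightarrow> (\<Sum>j\<le>n. 0\<^sup>2 / fact j)) at_top"
  proof (intro tendsto_intros)
    fix j show "(he j \<longlongrightarrow> 0) at_top" using he_decay[of j] by (auto intro: tendsto_0_decay)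
  qed auto
  then have "((\<lambda>T. ?K T + sqrt (2 * real (Suc n))) \<longlongrightarrow> 0 + sqrt (2 * real (Suc n))) at_top"
    by (intro tendsto_intros) auto
  from tendsto_lowerbound[OF this eventually_mono[OF eventually_ge_at_top[of x] *]]
  show ?thesis by simp
qed

section \<open>Smooth functions\<close>

text \<open>\<open>smooth\<close> without the quantifier over the order. The recursion replaces
  \<open>u\<close> by \<open>deriv u\<close>, so inductions on \<open>n\<close> with
  \<open>u\<close> arbitrary can follow the rules of differentiation.\<close>

fun ndiff :: "nat \<Rightarrow> (real \<Rightarrow> real) \<Rightarrow> bool" where
  "ndiff 0 u = True"
| "ndiff (Suc n) u = ((\<forall>x. u differentiable (at x)) \<and> ndiff n (deriv u))"

lemma ndiff_iff: "ndiff n u \<longleftrightarrow> (\<forall>k<n. \<forall>x. ((deriv ^^ k) u) differentiable (at x))"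
proof (induction n arbitrary: u)
  case (Suc n)
  then show ?case
    by (simp add: All_less_Suc2 funpow_Suc_right o_def del: funpow.simps(2))
qed auto

lemma smooth_iff_ndiff: "smooth u \<longleftrightarrow> (\<forall>n. ndiff n u)"
  by (auto simp: smooth_def ndiff_iff)

lemma ndiff_SucD: "ndiff (Suc n) u \<Longrightarrow> ndiff n u"
  by (simp add: ndiff_iff del: ndiff.simps)

lemma DERIV_deriv_differentiable:
  "u differentiable (at x) \<Longrightarrow> (u has_real_derivative deriv u x) (at x)"
  using DERIV_deriv_iff_real_differentiable by blast

lemma ndiff_SucI:
  assumes "\<And>x. (u has_real_derivative u' x) (at x)" "ndiff n u'"
  shows "ndiff (Suc n) u"
proof -
  have "deriv u = u'" using assms(1) by (simp add: DERIV_imp_deriv fun_eq_iff)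
  then show ?thesis using assms real_differentiable_def by auto
qed

lemma ndiff_const: "ndiff n (\<lambda>x. c)"
proof (induction n arbitrary: c)
  case (Suc n) show ?case by (rule ndiff_SucI[where u' = "\<lambda>x. 0", OF _ Suc]) simp
qed simp

lemma ndiff_ident: "ndiff n (\<lambda>x. x)"
proof (cases n)
  case (Suc m)
  then show ?thesis
    using ndiff_SucI[where u = "\<lambda>x. x" and u' = "\<lambda>x. 1", OF DERIV_ident ndiff_const[of m 1]]
    by (simp del: ndiff.simps)
qed simp

lemma ndiff_add: "ndiff n u \<Longrightarrow> ndiff n v \<Longrightarrow> ndiff n (\<lambda>x. u x + v x)"
proof (induction n arbitrary: u v)
  case (Suc n)
  then show ?case
    by (intro ndiff_SucI[where u' = "\<lambda>x. deriv u x + deriv v x"])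
       (auto intro!: DERIV_add DERIV_deriv_differentiable)
qed simp

lemma ndiff_mult: "ndiff n u \<Longrightarrow> ndiff n v \<Longrightarrow> ndiff n (\<lambda>x. u x * v x)"
proof (induction n arbitrary: u v)
  case (Suc n)
  show ?case
  proof (rule ndiff_SucI)
    show "((\<lambda>x. u x * v x) has_real_derivative (deriv u x * v x + deriv v x * u x)) (at x)" for x
      using Suc.prems by (intro DERIV_mult DERIV_deriv_differentiable) auto
    show "ndiff n (\<lambda>x. deriv u x * v x + deriv v x * u x)"
      using Suc.prems Suc.prems[THEN ndiff_SucD] by (intro ndiff_add Suc.IH) auto
  qed
qed simp

lemma smooth_const: "smooth (\<lambda>x. c)"
  by (simp add: smooth_iff_ndiff ndiff_const)

lemma smooth_ident: "smooth (\<lambda>x. x)"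
  by (simp add: smooth_iff_ndiff ndiff_ident)

lemma smooth_add: "smooth u \<Longrightarrow> smooth v \<Longrightarrow> smooth (\<lambda>x. u x + v x)"
  by (simp add: smooth_iff_ndiff ndiff_add)

lemma smooth_mult: "smooth u \<Longrightarrow> smooth v \<Longrightarrow> smooth (\<lambda>x. u x * v x)"
  by (simp add: smooth_iff_ndiff ndiff_mult)

lemma smooth_deriv: "smooth u \<Longrightarrow> smooth (deriv u)"
  unfolding smooth_iff_ndiff by (metis ndiff.simps(2))

lemma smooth_has_derivative: "smooth u \<Longrightarrow> (u has_real_derivative deriv u x) (at x)"
  unfolding smooth_iff_ndiff by (metis ndiff.simps(2) DERIV_deriv_differentiable)

lemma smooth_isCont: "smooth u \<Longrightarrow> isCont u x"
  using smooth_has_derivative DERIV_isCont by blast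

lemma smooth_borel_measurable: "smooth u \<Longrightarrow> u \<in> borel_measurable borel"
  by (intro borel_measurable_continuous_onI continuous_at_imp_continuous_on) (simp add: smooth_isCont)

lemma smooth_diff: "smooth u \<Longrightarrow> smooth v \<Longrightarrow> smooth (\<lambda>x. u x - v x)"
  using smooth_add[OF _ smooth_mult[OF smooth_const[of "-1"]], of u v] by simp

lemma smooth_power: "smooth u \<Longrightarrow> smooth (\<lambda>x. u x ^ k)"
  by (induction k) (simp_all add: smooth_const smooth_mult)

lemma ndiff_affine: "ndiff n u \<Longrightarrow> ndiff n (\<lambda>x. u (a * x + b))"
proof (induction n arbitrary: u)
  case (Suc n)
  have "((\<lambda>x. u (a * x + b)) has_real_derivative deriv u (a * x + b) * a) (at x)" for x
    using Suc.prems
    by (intro DERIV_chain2[of u] DERIV_deriv_differentiable) (auto intro!: derivative_eq_intros)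
  then show ?case
    by (rule ndiff_SucI) (use Suc in \<open>auto intro: ndiff_mult ndiff_const\<close>)
qed simp

lemma smooth_affine: "smooth u \<Longrightarrow> smooth (\<lambda>x. u (a * x + b))"
  by (simp add: smooth_iff_ndiff ndiff_affine)

section \<open>Composition of functions vanishing near \<open>0\<close> with the square root\<close>

lemma has_derivative_zero_on_open:
  assumes "open S" "x \<in> S" "\<And>y. y \<in> S \<Longrightarrow> u y = (0::real)"
  shows "(u has_real_derivative 0) (at x)"
  by (rule has_field_derivative_transform_within_open[of "\<lambda>x. 0" _ _ S]) (use assms in auto)

lemma deriv_zero_on_open:
  assumes "open S" "x \<in> S" "\<And>y. y \<in> S \<Longrightarrow> u y = (0::real)"
  shows "deriv u x = 0"
  by (rule DERIV_imp_deriv[OF has_derivative_zero_on_open[OF assms]])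

text \<open>The jump of \<open>sgn\<close> lies where \<open>u\<close> vanishes identically;
  elsewhere \<open>sgn\<close> is locally constant.\<close>

lemma ndiff_sgn_mult:
  "ndiff n u \<Longrightarrow> (\<And>s. \<bar>s\<bar> < 1/2 \<Longrightarrow> u s = 0) \<Longrightarrow> ndiff n (\<lambda>s. sgn s * u s)"
proof (induction n arbitrary: u)
  case (Suc n)
  have d0: "deriv u s = 0" if "\<bar>s\<bar> < 1/2" for s
    by (rule deriv_zero_on_open[of "{-1/2<..<1/2}"]) (use that Suc.prems in auto)
  have "((\<lambda>s. sgn s * u s) has_real_derivative sgn s * deriv u s) (at s)" for s
  proof -
    have D: "(u has_real_derivative deriv u s) (at s)"
      using Suc.prems by (auto intro: DERIV_deriv_differentiable)
    consider "\<bar>s\<bar> < 1/2" | "s > 0" | "s < 0" by linarith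
    then show ?thesis
    proof cases
      case 1
      then show ?thesis
        using has_derivative_zero_on_open[of "ball 0 (1/2)" s "\<lambda>s. sgn s * u s"] Suc.prems d0
      by (auto simp: dist_norm)
    next
      case 2
      then show ?thesis
        using has_field_derivative_transform_within_open[OF D, of "{0<..}" "\<lambda>s. sgn s * u s"] by auto
    next
      case 3
      then show ?thesis
        using has_field_derivative_transform_within_open[OF DERIV_minus[OF D], of "{..<0}" "\<lambda>s. sgn s * u s"] by auto
    qed
  qed
  then show ?case
    by (rule ndiff_SucI) (use Suc d0 in auto)
qed simp

text \<open>The exponent \<open>m\<close> varies because differentiation raises it. Near
  \<open>0\<close> the quotient vanishes identically, also at \<open>0\<close> itself, where the
  numerator is zero.\<close>

lemma ndiff_divide_power:
  "ndiff n u \<Longrightarrow> (\<And>s. \<bar>s\<bar> < 1/2 \<Longrightarrow> u s = 0) \<Longrightarrow> ndiff n (\<lambda>s. u s / s ^ m)"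
proof (induction n arbitrary: u m)
  case (Suc n)
  have d0: "deriv u s = 0" if "\<bar>s\<bar> < 1/2" for s
    by (rule deriv_zero_on_open[of "{-1/2<..<1/2}"]) (use that Suc.prems in auto)
  have "((\<lambda>s. u s / s ^ m) has_real_derivative deriv u s / s ^ m + (- real m) * (u s / s ^ Suc m)) (at s)" for s
  proof (cases "\<bar>s\<bar> < 1/2")
    case True
    then show ?thesis
      using has_derivative_zero_on_open[of "ball 0 (1/2)" s "\<lambda>s. u s / s ^ m"] Suc.prems d0
      by (auto simp: dist_norm)
  next
    case False
    have D: "(u has_real_derivative deriv u s) (at s)"
      using Suc.prems by (auto intro: DERIV_deriv_differentiable)
    have "((\<lambda>s. u s / s ^ m) has_real_derivative (deriv u s * s ^ m - u s * (real m * s ^ (m - Suc 0))) / (s ^ m * s ^ m)) (at s)"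
      using False by (intro DERIV_divide D DERIV_pow) auto
    moreover have "(deriv u s * s ^ m - u s * (real m * s ^ (m - Suc 0))) / (s ^ m * s ^ m) = deriv u s / s ^ m + (- real m) * (u s / s ^ Suc m)"
      using False by (cases m) (auto simp: field_simps)
    ultimately show ?thesis by (simp only:)
  qed
  moreover have "ndiff n (\<lambda>s. deriv u s / s ^ m + (- real m) * (u s / s ^ Suc m))"
    by (intro ndiff_add ndiff_mult ndiff_const Suc.IH)
       (use Suc.prems d0 ndiff_SucD[OF Suc.prems(1)] in auto)
  ultimately show ?case by (rule ndiff_SucI)
qed simp

text \<open>The derivative is again a function of \<open>sqrt t\<close> that vanishes near
  \<open>0\<close>, so the induction closes.\<close>

lemma ndiff_sqrt:
  "ndiff n u \<Longrightarrow> (\<And>s. \<bar>s\<bar> < 1/2 \<Longrightarrow> u s = 0) \<Longrightarrow> ndiff n (\<lambda>t. u (sqrt t))"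
proof (induction n arbitrary: u)
  case (Suc n)
  \<comment> \<open>\<open>sqrt\<close> is the odd extension of the root to negative arguments; its
    derivative is \<open>sgn s / (2 * s)\<close> at \<open>s = sqrt t\<close>, which explains the
    sign.\<close>
  let ?w = "\<lambda>s. 1/2 * (sgn s * (deriv u s / s ^ 1))"
  have d0: "deriv u s = 0" if "\<bar>s\<bar> < 1/2" for s
    by (rule deriv_zero_on_open[of "{-1/2<..<1/2}"]) (use that Suc.prems in auto)
  have sm: "\<bar>sqrt t\<bar> < 1/2" if "\<bar>t\<bar> < 1/4" for t
  proof -
    have "sqrt \<bar>t\<bar> < sqrt (1/4)" using that by (simp only: real_sqrt_less_iff)
    then show ?thesis by (simp add: abs_if real_sqrt_minus real_sqrt_divide split: if_splits)
  qed
  have "((\<lambda>t. u (sqrt t)) has_real_derivative ?w (sqrt t)) (at t)" for t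
  proof (cases "\<bar>t\<bar> < 1/4")
    case True
    then show ?thesis
      using has_derivative_zero_on_open[of "ball 0 (1/4)" t "\<lambda>t. u (sqrt t)"] Suc.prems d0 sm
      by (auto simp: dist_norm)
  next
    case False
    then have "(sqrt has_real_derivative sgn (sqrt t) / (2 * sqrt t)) (at t)"
      by (intro DERIV_real_sqrt_generic) (auto simp: field_simps sgn_if)
    moreover have "(u has_real_derivative deriv u (sqrt t)) (at (sqrt t))"
      using Suc.prems by (auto intro: DERIV_deriv_differentiable)
    ultimately show ?thesis
      using DERIV_chain2 by (force elim!: DERIV_cong)
  qed
  moreover have "ndiff n ?w"
    by (intro ndiff_mult ndiff_const ndiff_sgn_mult ndiff_divide_power) (use Suc.prems d0 in auto)
  then have "ndiff n (\<lambda>t. ?w (sqrt t))" by (rule Suc.IH) (use d0 in auto)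
  ultimately show ?case by (rule ndiff_SucI)
qed simp

text \<open>\<open>h - 1\<close> vanishes near \<open>0\<close> because the filter is constant
  there, and \<open>ndiff_sqrt\<close> applies to it.\<close>

lemma smooth_filter_sqrt:
  assumes "low_pass_filter h" shows "smooth (\<lambda>t. h (sqrt t))"
proof -
  have "smooth (\<lambda>s. h s - 1)" using assms by (auto simp: low_pass_filter_def intro: smooth_diff smooth_const)
  then have "ndiff n (\<lambda>t. h (sqrt t) - 1)" for n
    using assms by (intro ndiff_sqrt[of n "\<lambda>s. h s - 1"]) (auto simp: smooth_iff_ndiff low_pass_filter_def)
  then have "smooth (\<lambda>t. (h (sqrt t) - 1) + 1)"
    by (intro smooth_add smooth_const) (simp add: smooth_iff_ndiff)
  then show ?thesis by simp
qed

lemma deriv_pow_zero_outside: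
  assumes "\<And>t. R < \<bar>t\<bar> \<Longrightarrow> u t = (0::real)" "R < \<bar>t\<bar>" shows "(deriv ^^ r) u t = 0"
  using assms(2)
proof (induction r arbitrary: t)
  case (Suc r)
  have "open {t::real. R < \<bar>t\<bar>}" by (intro open_Collect_less continuous_intros)
  then show ?case using Suc by (auto intro: deriv_zero_on_open[of "{t. R < \<bar>t\<bar>}"])
qed (use assms in auto)

lemma smooth_deriv_pow: "smooth u \<Longrightarrow> smooth ((deriv ^^ r) u)"
  by (induction r) (auto intro: smooth_deriv)

lemma smooth_compact_bounded:
  assumes "smooth u" "\<And>t. R < \<bar>t\<bar> \<Longrightarrow> u t = 0"
  shows "\<exists>M\<ge>0. \<forall>t. \<bar>u t\<bar> \<le> M"
proof -
  have "continuous_on {-R..R} u" using assms(1) by (intro continuous_at_imp_continuous_on) (simp add: smooth_isCont)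
  then have "bounded (u ` {-R..R})" by (intro compact_imp_bounded compact_continuous_image) auto
  then obtain M where "\<forall>t\<in>{-R..R}. \<bar>u t\<bar> \<le> M" by (auto simp: bounded_iff)
  then have "\<bar>u t\<bar> \<le> max M 0" for t
  proof (cases "R < \<bar>t\<bar>")
    case False
    then have "t \<in> {-R..R}" by auto
    with \<open>\<forall>t\<in>{-R..R}. _\<close> show ?thesis by (auto simp: le_max_iff_disj)
  qed (simp add: assms)
  then show ?thesis by (intro exI[of _ "max M 0"]) auto
qed

section \<open>Localization of the kernels\<close>

definition fdiff :: "(nat \<Rightarrow> real) \<Rightarrow> nat \<Rightarrow> real" where
  "fdiff c j = c (Suc j) - c j"

definition sdiff :: "real \<Rightarrow> (real \<Rightarrow> real) \<Rightarrow> real \<Rightarrow> real" where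
  "sdiff a g t = g (t + a) - g t"

lemma fdiff_sampled: "(fdiff ^^ r) (\<lambda>j. g (a * real j)) = (\<lambda>j. (sdiff a ^^ r) g (a * real j))"
  by (induction r) (auto simp: fdiff_def sdiff_def fun_eq_iff algebra_simps)

lemma sdiff_has_derivative:
  "smooth g \<Longrightarrow> ((sdiff a ^^ r) g has_real_derivative (sdiff a ^^ r) (deriv g) t) (at t)"
proof (induction r arbitrary: t)
  case (Suc r)
  have "((\<lambda>t. (sdiff a ^^ r) g (t + a)) has_real_derivative (sdiff a ^^ r) (deriv g) (t + a)) (at t)"
    using Suc.IH[OF Suc.prems, of "t + a"] DERIV_shift[of "(sdiff a ^^ r) g" _ t a] by simp
  from DERIV_diff[OF this Suc.IH[OF Suc.prems]] show ?case by (simp add: sdiff_def[abs_def])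
qed (auto intro: smooth_has_derivative)

text \<open>The mean value theorem turns one difference into \<open>a\<close> times a derivative. By
  \<open>sdiff_has_derivative\<close> differences commute with derivatives, so this
  iterates.\<close>

lemma sdiff_bound:
  assumes "smooth g" "\<And>t. \<bar>(deriv ^^ r) g t\<bar> \<le> M" "0 \<le> a"
  shows "\<bar>(sdiff a ^^ r) g t\<bar> \<le> M * a ^ r"
  using assms(1,2)
proof (induction r arbitrary: g t)
  case (Suc r)
  have B: "\<bar>(sdiff a ^^ r) (deriv g) s\<bar> \<le> M * a ^ r" for s
    using Suc.prems by (intro Suc.IH) (auto simp: smooth_deriv funpow_swap1)
  show ?case
  proof (cases "a = 0")
    case False
    then have "t < t + a" using assms by auto
    have "\<exists>z>t. z < t + a \<and> (sdiff a ^^ r) g (t + a) - (sdiff a ^^ r) g t = (t + a - t) * (sdiff a ^^ r) (deriv g) z"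
      by (rule MVT2[OF \<open>t < t + a\<close>]) (rule sdiff_has_derivative[OF Suc.prems(1)])
    then obtain z where "(sdiff a ^^ r) g (t + a) - (sdiff a ^^ r) g t = a * (sdiff a ^^ r) (deriv g) z"
      by auto
    then have "\<bar>(sdiff a ^^ Suc r) g t\<bar> = a * \<bar>(sdiff a ^^ r) (deriv g) z\<bar>"
      using assms by (simp add: sdiff_def abs_mult)
    also have "\<dots> \<le> a * (M * a ^ r)"
      using B assms by (intro mult_left_mono) auto
    finally show ?thesis by (simp add: mult_ac)
  qed (auto simp: sdiff_def)
qed simp

text \<open>\<open>wk N p q c\<close> is the kernel of \<open>(a\<^sup>*)\<^sup>p c(A) a\<^sup>q\<close>, where \<open>a\<^sup>*\<close> and \<open>a\<close> are the creation and
  annihilation operators and \<open>A = a\<^sup>* a\<close>. A commutator with multiplication by \<open>x\<close> replaces \<open>c\<close> by its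
  difference or lowers \<open>p + q\<close>.\<close>

definition wk :: "nat \<Rightarrow> nat \<Rightarrow> nat \<Rightarrow> (nat \<Rightarrow> real) \<Rightarrow> real \<Rightarrow> real \<Rightarrow> real" where
  "wk N p q c x y = (\<Sum>j<N. c j / fact j * (he (j + p) x * he (j + q) y))"

text \<open>The factor \<open>real j\<close> cancels against \<open>fact j\<close>. Since
  \<open>c N = 0\<close>, the term \<open>j = N\<close> may be added before reindexing, so the
  length of the sum stays \<open>N\<close>.\<close>

lemma wk_shift:
  assumes "c N = 0"
  shows "(\<Sum>j<N. c j / fact j * real j * f j) = (\<Sum>j<N. c (Suc j) / fact j * f (Suc j))"
proof -
  have "(\<Sum>j<N. c j / fact j * real j * f j) = (\<Sum>j<Suc N. c j / fact j * real j * f j)"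
    using assms by simp
  also have "\<dots> = (\<Sum>j<N. c (Suc j) / fact (Suc j) * real (Suc j) * f (Suc j))"
    by (subst sum.lessThan_Suc_shift) simp
  also have "\<dots> = (\<Sum>j<N. c (Suc j) / fact j * f (Suc j))"
    by (intro sum.cong refl) (simp add: divide_simps)
  finally show ?thesis .
qed

text \<open>The recurrence at index \<open>j + p\<close> yields the coefficient
  \<open>j + p\<close>: its part \<open>p\<close> lowers \<open>p\<close>, and its part
  \<open>j\<close> goes through \<open>wk_shift\<close>, which raises \<open>q\<close> and shifts
  \<open>c\<close>.\<close>

lemma wk_mult_x:
  assumes "c N = 0"
  shows "sqrt 2 * x * wk N p q c x y =
    wk N (Suc p) q c x y + real p * wk N (p - 1) q c x y + wk N p (Suc q) (\<lambda>j. c (Suc j)) x y"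
proof -
  have "sqrt 2 * x * wk N p q c x y = (\<Sum>j<N. c j / fact j * ((sqrt 2 * x * he (j + p) x) * he (j + q) y))"
    by (simp add: wk_def sum_distrib_left mult_ac)
  also have "\<dots> = (\<Sum>j<N. c j / fact j * (he (j + Suc p) x * he (j + q) y)
      + real p * (c j / fact j * (he (j + (p - 1)) x * he (j + q) y))
      + c j / fact j * real j * (he (j + p - 1) x * he (j + q) y))"
  proof (intro sum.cong refl)
    fix j
    have "real p * he (j + p - 1) x = real p * he (j + (p - 1)) x" by (cases p) auto
    then show "c j / fact j * ((sqrt 2 * x * he (j + p) x) * he (j + q) y) =
      c j / fact j * (he (j + Suc p) x * he (j + q) y)
      + real p * (c j / fact j * (he (j + (p - 1)) x * he (j + q) y))
      + c j / fact j * real j * (he (j + p - 1) x * he (j + q) y)"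
      unfolding he_recurrence by (cases "p = 0") (auto simp: algebra_simps)
  qed
  also have "\<dots> = wk N (Suc p) q c x y + real p * wk N (p - 1) q c x y
      + (\<Sum>j<N. c j / fact j * real j * (he (j + p - 1) x * he (j + q) y))"
    by (simp add: sum.distrib wk_def sum_distrib_left)
  also have "(\<Sum>j<N. c j / fact j * real j * (he (j + p - 1) x * he (j + q) y)) = wk N p (Suc q) (\<lambda>j. c (Suc j)) x y"
    by (subst wk_shift[where c = c, OF assms]) (simp add: wk_def)
  finally show ?thesis .
qed

lemma wk_swap: "wk N p q c x y = wk N q p c y x"
  by (simp add: wk_def mult.commute)

text \<open>Multiplication by \<open>x\<close> gives unshifted coefficients with
  \<open>Suc p\<close> and shifted ones with \<open>Suc q\<close>; multiplication by
  \<open>y\<close> does the opposite. Subtraction pairs them into differences.\<close>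

lemma wk_commutator:
  assumes "c N = 0"
  shows "sqrt 2 * (x - y) * wk N p q c x y =
    real p * wk N (p - 1) q c x y - real q * wk N p (q - 1) c x y
    + wk N p (Suc q) (fdiff c) x y - wk N (Suc p) q (fdiff c) x y"
proof -
  have f: "wk N a b (fdiff c) x y = wk N a b (\<lambda>j. c (Suc j)) x y - wk N a b c x y" for a b
    by (simp add: wk_def fdiff_def diff_divide_distrib left_diff_distrib sum_subtractf)
  have "sqrt 2 * y * wk N p q c x y = wk N p (Suc q) c x y + real q * wk N p (q - 1) c x y + wk N (Suc p) q (\<lambda>j. c (Suc j)) x y"
    using wk_mult_x[of c N y q p x] assms by (simp add: wk_swap[of N _ _ _ y x])
  with wk_mult_x[of c N x p q y] assms show ?thesis
    by (simp add: f algebra_simps)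
qed

text \<open>Passing from \<open>fact j\<close> to \<open>fact (j + p)\<close> costs at most
  \<open>(N + p) ^ p\<close>; then the bound for the Christoffel sum applies.\<close>

lemma he_shifted_square_sum:
  assumes "0 < N"
  shows "(\<Sum>j<N. (he (j + p) x)\<^sup>2 / fact j) \<le> real (N + p) ^ p * sqrt (2 * real (N + p))"
proof -
  have "(\<Sum>j<N. (he (j + p) x)\<^sup>2 / fact j) \<le> (\<Sum>j<N. real (N + p) ^ p * ((he (j + p) x)\<^sup>2 / fact (j + p)))"
  proof (intro sum_mono)
    fix j assume "j \<in> {..<N}"
    have "(fact (j + p) :: real) \<le> fact j * real (N + p) ^ p"
    proof -
      have "(fact (j + p) :: real) = fact j * (\<Prod>i<p. real (j + Suc i))"
        by (induction p) (auto simp: algebra_simps)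
      also have "(\<Prod>i<p. real (j + Suc i)) \<le> (\<Prod>i<p. real (N + p))"
        by (intro prod_mono) (use \<open>j \<in> _\<close> in auto)
      finally show ?thesis by (simp add: mult_left_mono)
    qed
    then have "1 / fact j \<le> real (N + p) ^ p / fact (j + p)"
      by (simp add: field_simps)
    from mult_left_mono[OF this, of "(he (j + p) x)\<^sup>2"]
    show "(he (j + p) x)\<^sup>2 / fact j \<le> real (N + p) ^ p * ((he (j + p) x)\<^sup>2 / fact (j + p))"
      by (simp add: mult_ac)
  qed
  also have "\<dots> = real (N + p) ^ p * (\<Sum>j<N. (he (j + p) x)\<^sup>2 / fact (j + p))"
    by (simp add: sum_distrib_left)
  also have "(\<Sum>j<N. (he (j + p) x)\<^sup>2 / fact (j + p)) = (\<Sum>j\<in>{p..<N+p}. (he j x)\<^sup>2 / fact j)"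
    using sum.shift_bounds_nat_ivl[of "\<lambda>j. (he j x)\<^sup>2 / fact j" 0 p N] by (simp add: atLeast0LessThan)
  also have "\<dots> \<le> (\<Sum>j\<le>N + p - 1. (he j x)\<^sup>2 / fact j)"
    by (intro sum_mono2) auto
  also have "\<dots> \<le> sqrt (2 * real (N + p))"
    using christoffel_le[of x "N + p - 1"] assms by simp
  finally show ?thesis by (simp add: mult_left_mono)
qed

text \<open>Cauchy-Schwarz separates \<open>x\<close> from \<open>y\<close>. With
  \<open>M = N + p + q\<close> the two square sums contribute \<open>M ^ p\<close>,
  \<open>M ^ q\<close> and two factors \<open>sqrt (2 * M)\<close>.\<close>

lemma wk_bound:
  assumes "0 < N" "\<And>j. \<bar>c j\<bar> \<le> D"
  shows "\<bar>wk N p q c x y\<bar> \<le> D * sqrt (2 * real (N + p + q) ^ (p + q + 1))"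
proof -
  let ?a = "\<lambda>j. \<bar>he (j + p) x\<bar> / sqrt (fact j)" and ?b = "\<lambda>j. \<bar>he (j + q) y\<bar> / sqrt (fact j)"
  let ?M = "real (N + p + q)"
  have D: "0 \<le> D" using assms(2)[of 0] by linarith
  have "\<bar>wk N p q c x y\<bar> \<le> (\<Sum>j<N. \<bar>c j\<bar> * (?a j * ?b j))"
    unfolding wk_def by (rule order_trans[OF sum_abs]) (simp add: abs_mult mult_ac)
  also have "\<dots> \<le> (\<Sum>j<N. D * (?a j * ?b j))"
    by (intro sum_mono mult_right_mono assms) auto
  also have "\<dots> = D * (\<Sum>j<N. ?a j * ?b j)"
    by (simp only: sum_distrib_left)
  also have "(\<Sum>j<N. ?a j * ?b j) \<le> sqrt (2 * ?M ^ (p + q + 1))"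
  proof (rule real_le_rsqrt)
    have "(\<Sum>j<N. ?a j * ?b j)\<^sup>2 \<le> (\<Sum>j<N. (?a j)\<^sup>2) * (\<Sum>j<N. (?b j)\<^sup>2)"
      by (rule Cauchy_Schwarz_ineq_sum)
    also have "\<dots> \<le> (?M ^ p * sqrt (2 * ?M)) * (?M ^ q * sqrt (2 * ?M))"
    proof (intro mult_mono)
      have "(\<Sum>j<N. (?a j)\<^sup>2) \<le> real (N + p) ^ p * sqrt (2 * real (N + p))"
        using he_shifted_square_sum[OF assms(1), of p x] by (simp add: power_divide)
      also have "\<dots> \<le> ?M ^ p * sqrt (2 * ?M)" by (intro mult_mono power_mono) auto
      finally show "(\<Sum>j<N. (?a j)\<^sup>2) \<le> ?M ^ p * sqrt (2 * ?M)" .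
      have "(\<Sum>j<N. (?b j)\<^sup>2) \<le> real (N + q) ^ q * sqrt (2 * real (N + q))"
        using he_shifted_square_sum[OF assms(1), of q y] by (simp add: power_divide)
      also have "\<dots> \<le> ?M ^ q * sqrt (2 * ?M)" by (intro mult_mono power_mono) auto
      finally show "(\<Sum>j<N. (?b j)\<^sup>2) \<le> ?M ^ q * sqrt (2 * ?M)" .
    qed (auto intro!: sum_nonneg)
    also have "\<dots> = ?M ^ p * ?M ^ q * (sqrt (2 * ?M) * sqrt (2 * ?M))"
      by (simp only: mult_ac)
    also have "\<dots> = 2 * ?M ^ (p + q + 1)"
      by (simp only: real_sqrt_mult_self) (simp add: power_add)
    finally show "(\<Sum>j<N. ?a j * ?b j)\<^sup>2 \<le> 2 * ?M ^ (p + q + 1)" .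
  qed
  finally show ?thesis using D by (simp add: mult_left_mono)
qed

section \<open>Filter coefficients and decay of the kernel\<close>

definition coef :: "(real \<Rightarrow> real) \<Rightarrow> real \<Rightarrow> nat \<Rightarrow> real" where
  "coef h n j = h (sqrt (real j) / n)"

text \<open>The number of indices \<open>j\<close> with \<open>sqrt j < n\<close>, hence the length
  of the spectral sums of order \<open>n\<close>.\<close>

definition cutoff :: "real \<Rightarrow> nat" where
  "cutoff n = nat \<lceil>n\<^sup>2\<rceil>"

lemma cutoff_pos: "1 \<le> n \<Longrightarrow> 0 < cutoff n"
  by (simp add: cutoff_def)

lemma cutoff_le: "1 \<le> n \<Longrightarrow> real (cutoff n) \<le> 2 * n\<^sup>2"
proof -
  assume "1 \<le> n"
  then have "1 \<le> n\<^sup>2" by simp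
  then show ?thesis unfolding cutoff_def by linarith
qed

lemma less_cutoff_iff: "0 < n \<Longrightarrow> j < cutoff n \<longleftrightarrow> sqrt (real j) < n"
proof -
  assume "0 < n"
  have "j < cutoff n \<longleftrightarrow> real j < n\<^sup>2"
    unfolding cutoff_def by linarith
  also have "\<dots> \<longleftrightarrow> sqrt (real j) < n"
    using \<open>0 < n\<close> by (metis abs_of_pos real_sqrt_abs real_sqrt_less_iff)
  finally show ?thesis .
qed

lemma hermite_index_set: "0 < n \<Longrightarrow> {j. sqrt (real j) < n} = {..<cutoff n}"
  by (auto simp: less_cutoff_iff)

lemma coef_zero:
  assumes "low_pass_filter h" "0 < n" "cutoff n \<le> j" shows "coef h n j = 0"
proof -
  have "1 \<le> sqrt (real j) / n"
    using less_cutoff_iff[OF assms(2), of j] assms by (simp add: not_less le_divide_eq)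
  then have "1 \<le> \<bar>sqrt (real j) / n\<bar>" by linarith
  then show ?thesis using assms(1) unfolding low_pass_filter_def coef_def by blast
qed

lemma fdiff_coef_zero:
  assumes "low_pass_filter h" "0 < n" "cutoff n \<le> j" shows "(fdiff ^^ r) (coef h n) j = 0"
  using assms(3) by (induction r arbitrary: j) (auto simp: fdiff_def coef_zero assms)

lemma coef_sampled: "0 < n \<Longrightarrow> coef h n = (\<lambda>j. (\<lambda>t. h (sqrt t)) (1 / n\<^sup>2 * real j))"
  by (simp add: coef_def fun_eq_iff real_sqrt_divide)

text \<open>The coefficients sample a smooth function with compactly supported derivatives at
  spacing \<open>1 / n^2\<close>, so every difference gains a factor \<open>n^-2\<close>.\<close>

lemma fdiff_coef_bound:
  assumes "low_pass_filter h"
  shows "\<exists>C\<ge>0. \<forall>n\<ge>1. \<forall>j. \<bar>(fdiff ^^ r) (coef h n) j\<bar> \<le> C * n powr (- 2 * real r)"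
proof -
  let ?G = "\<lambda>t. h (sqrt t)"
  have G: "smooth ?G" by (rule smooth_filter_sqrt[OF assms])
  have "?G t = 0" if "1 < \<bar>t\<bar>" for t
  proof -
    have "\<bar>sqrt t\<bar> = sqrt \<bar>t\<bar>" by (simp add: abs_if real_sqrt_minus)
    then have "1 \<le> \<bar>sqrt t\<bar>" using that by simp
    then show ?thesis using assms by (auto simp: low_pass_filter_def)
  qed
  then have "(deriv ^^ r) ?G t = 0" if "1 < \<bar>t\<bar>" for t
    using deriv_pow_zero_outside[of 1 ?G t r] that by auto
  then obtain M where M: "M \<ge> 0" "\<And>t. \<bar>(deriv ^^ r) ?G t\<bar> \<le> M"
    using smooth_compact_bounded[OF smooth_deriv_pow[OF G], of 1 r] by auto
  have "\<bar>(fdiff ^^ r) (coef h n) j\<bar> \<le> M * n powr (- 2 * real r)" if "n \<ge> 1" for n j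
  proof -
    have "\<bar>(fdiff ^^ r) (coef h n) j\<bar> \<le> M * (1 / n\<^sup>2) ^ r"
      unfolding coef_sampled[OF less_le_trans[OF zero_less_one that]] fdiff_sampled[of r ?G]
      by (rule sdiff_bound[OF G M(2)]) simp
    also have "(1 / n\<^sup>2) ^ r = n powr (- 2 * real r)"
    proof -
      have "n powr (- 2 * real r) = inverse (n powr real (2 * r))"
        by (simp flip: powr_minus)
      also have "\<dots> = inverse (n ^ (2 * r))"
        using that by (subst powr_realpow) auto
      finally show ?thesis
        by (simp add: power_mult power_one_over inverse_eq_divide)
    qed
    finally show ?thesis .
  qed
  then show ?thesis using M by blast
qed

text \<open>Count of exponents: \<open>N\<close> is of order \<open>n^2\<close>, so
  \<open>wk_bound\<close> gives \<open>1 + p + q\<close>, and \<open>r\<close> differences give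
  \<open>- 2 * r\<close>. By \<open>wk_commutator\<close> a factor \<open>x - y\<close> either
  lowers \<open>p\<close> or \<open>q\<close>, or raises \<open>r\<close> together with
  \<open>p\<close> or \<open>q\<close>; each changes the exponent by \<open>-1\<close>. Hence the
  induction on \<open>k\<close> runs over all \<open>p\<close>, \<open>q\<close>, \<open>r\<close>
  at once.\<close>

lemma wk_decay:
  assumes "low_pass_filter h"
  shows "\<exists>C\<ge>0. \<forall>n\<ge>1. \<forall>x y. \<bar>sqrt 2 * (x - y)\<bar> ^ k * \<bar>wk (cutoff n) p q ((fdiff ^^ r) (coef h n)) x y\<bar>
     \<le> C * n powr (1 + real p + real q - 2 * real r - real k)"
proof (induction k arbitrary: p q r)
  case 0
  obtain D where D: "D \<ge> 0" "\<And>n j. n \<ge> 1 \<Longrightarrow> \<bar>(fdiff ^^ r) (coef h n) j\<bar> \<le> D * n powr (- 2 * real r)"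
    using fdiff_coef_bound[OF assms] by blast
  let ?m = "p + q + 1"
  let ?C = "D * sqrt (2 * (2 + real p + real q) ^ ?m)"
  have "\<bar>wk (cutoff n) p q ((fdiff ^^ r) (coef h n)) x y\<bar> \<le> ?C * n powr (1 + real p + real q - 2 * real r)" if "n \<ge> 1" for n x y
  proof -
    have "1 \<le> n\<^sup>2" using that by simp
    then have "real p * 1 \<le> real p * n\<^sup>2" "real q * 1 \<le> real q * n\<^sup>2" by (auto intro!: mult_left_mono simp del: mult_1_right)
    then have "real (cutoff n + p + q) \<le> (2 + real p + real q) * n\<^sup>2"
      using cutoff_le[OF that] by (simp add: algebra_simps)
    then have "real (cutoff n + p + q) ^ ?m \<le> ((2 + real p + real q) * n\<^sup>2) ^ ?m"
      by (intro power_mono) auto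
    then have "sqrt (2 * real (cutoff n + p + q) ^ ?m) \<le> sqrt (2 * (2 + real p + real q) ^ ?m * (n ^ ?m)\<^sup>2)"
      by (simp add: power_mult_distrib mult_ac flip: power_mult)
    also have "\<dots> = sqrt (2 * (2 + real p + real q) ^ ?m) * n ^ ?m"
      using that by (simp only: real_sqrt_mult real_sqrt_abs) (simp add: abs_mult power_abs)
    finally have s: "sqrt (2 * real (cutoff n + p + q) ^ ?m) \<le> sqrt (2 * (2 + real p + real q) ^ ?m) * n ^ ?m" .
    have "\<bar>wk (cutoff n) p q ((fdiff ^^ r) (coef h n)) x y\<bar> \<le> D * n powr (- 2 * real r) * sqrt (2 * real (cutoff n + p + q) ^ ?m)"
      using wk_bound[OF cutoff_pos[OF that] D(2)[OF that]] .
    also have "\<dots> \<le> D * n powr (- 2 * real r) * (sqrt (2 * (2 + real p + real q) ^ ?m) * n ^ ?m)"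
      using s D by (intro mult_left_mono) auto
    also have "\<dots> = ?C * (n powr (- 2 * real r) * n powr real ?m)"
      by (subst powr_realpow) (use that in auto)
    also have "n powr (- 2 * real r) * n powr real ?m = n powr (1 + real p + real q - 2 * real r)"
      by (simp add: powr_add[symmetric] algebra_simps)
    finally show ?thesis .
  qed
  then show ?case using D by (intro exI[of _ ?C]) auto
next
  case (Suc k)
  let ?c = "\<lambda>n. (fdiff ^^ r) (coef h n)"
  let ?t = "\<lambda>x y. \<bar>sqrt 2 * (x - y)\<bar>"
  let ?e = "1 + real p + real q - 2 * real r - real (Suc k)"
  obtain A where A: "A \<ge> 0" "\<And>n x y. n \<ge> 1 \<Longrightarrow> ?t x y ^ k * \<bar>wk (cutoff n) (p - 1) q (?c n) x y\<bar>
     \<le> A * n powr (1 + real (p - 1) + real q - 2 * real r - real k)" using Suc[of "p - 1" q r] by blast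
  obtain B where B: "B \<ge> 0" "\<And>n x y. n \<ge> 1 \<Longrightarrow> ?t x y ^ k * \<bar>wk (cutoff n) p (q - 1) (?c n) x y\<bar>
     \<le> B * n powr (1 + real p + real (q - 1) - 2 * real r - real k)" using Suc[of p "q - 1" r] by blast
  obtain E where E: "E \<ge> 0" "\<And>n x y. n \<ge> 1 \<Longrightarrow> ?t x y ^ k * \<bar>wk (cutoff n) p (Suc q) (fdiff (?c n)) x y\<bar>
     \<le> E * n powr (1 + real p + real (Suc q) - 2 * real (Suc r) - real k)" using Suc[of p "Suc q" "Suc r"] by auto
  obtain F where F: "F \<ge> 0" "\<And>n x y. n \<ge> 1 \<Longrightarrow> ?t x y ^ k * \<bar>wk (cutoff n) (Suc p) q (fdiff (?c n)) x y\<bar>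
     \<le> F * n powr (1 + real (Suc p) + real q - 2 * real (Suc r) - real k)" using Suc[of "Suc p" q "Suc r"] by auto
  have "?t x y ^ Suc k * \<bar>wk (cutoff n) p q (?c n) x y\<bar> \<le> (real p * A + real q * B + E + F) * n powr ?e"
    if n: "n \<ge> 1" for n x y
  proof -
    let ?T = "?t x y ^ k" and ?w = "\<lambda>p q c. wk (cutoff n) p q c x y"
    have "?t x y ^ Suc k * \<bar>?w p q (?c n)\<bar> = ?T * \<bar>sqrt 2 * (x - y) * ?w p q (?c n)\<bar>"
      by (simp add: abs_mult mult_ac)
    also have "sqrt 2 * (x - y) * ?w p q (?c n) = real p * ?w (p - 1) q (?c n) - real q * ?w p (q - 1) (?c n)
      + ?w p (Suc q) (fdiff (?c n)) - ?w (Suc p) q (fdiff (?c n))"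
      using n by (intro wk_commutator fdiff_coef_zero[OF assms]) auto
    also have "?T * \<bar>\<dots>\<bar> \<le> ?T * (real p * \<bar>?w (p - 1) q (?c n)\<bar> + real q * \<bar>?w p (q - 1) (?c n)\<bar>
      + \<bar>?w p (Suc q) (fdiff (?c n))\<bar> + \<bar>?w (Suc p) q (fdiff (?c n))\<bar>)"
    proof (intro mult_left_mono)
      have "\<bar>a - b + c - d\<bar> \<le> \<bar>a\<bar> + \<bar>b\<bar> + \<bar>c\<bar> + \<bar>d\<bar>" for a b c d :: real by linarith
      from this[of "real p * ?w (p - 1) q (?c n)" "real q * ?w p (q - 1) (?c n)"]
      show "\<bar>real p * ?w (p - 1) q (?c n) - real q * ?w p (q - 1) (?c n) + ?w p (Suc q) (fdiff (?c n)) - ?w (Suc p) q (fdiff (?c n))\<bar> \<le>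
        real p * \<bar>?w (p - 1) q (?c n)\<bar> + real q * \<bar>?w p (q - 1) (?c n)\<bar>
      + \<bar>?w p (Suc q) (fdiff (?c n))\<bar> + \<bar>?w (Suc p) q (fdiff (?c n))\<bar>"
        by (simp add: abs_mult)
    qed auto
    also have "\<dots> = real p * (?T * \<bar>?w (p - 1) q (?c n)\<bar>) + real q * (?T * \<bar>?w p (q - 1) (?c n)\<bar>)
      + ?T * \<bar>?w p (Suc q) (fdiff (?c n))\<bar> + ?T * \<bar>?w (Suc p) q (fdiff (?c n))\<bar>"
      by (simp only: distrib_left mult_ac)
    also have "\<dots> \<le> real p * (A * n powr ?e) + real q * (B * n powr ?e) + E * n powr ?e + F * n powr ?e"
    proof (intro add_mono)
      show "real p * (?T * \<bar>?w (p - 1) q (?c n)\<bar>) \<le> real p * (A * n powr ?e)"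
      \<comment> \<open>For \<open>p = 0\<close> the truncated \<open>p - 1\<close> would spoil the
        exponent, but the term has the factor \<open>real p = 0\<close>. The same happens with
        \<open>q\<close> below.\<close>
      proof (cases p)
        case (Suc p')
        have "1 + real (p - 1) + real q - 2 * real r - real k = ?e" using Suc by simp
        from A(2)[OF n, of x y, unfolded this] show ?thesis by (rule mult_left_mono) simp
      qed simp
      show "real q * (?T * \<bar>?w p (q - 1) (?c n)\<bar>) \<le> real q * (B * n powr ?e)"
      proof (cases q)
        case (Suc q')
        have "1 + real p + real (q - 1) - 2 * real r - real k = ?e" using Suc by simp
        from B(2)[OF n, of x y, unfolded this] show ?thesis by (rule mult_left_mono) simp
      qed simp
      have "1 + real p + real (Suc q) - 2 * real (Suc r) - real k = ?e" by simp
      from E(2)[OF n, of x y, unfolded this] show "?T * \<bar>?w p (Suc q) (fdiff (?c n))\<bar> \<le> E * n powr ?e" .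
      have "1 + real (Suc p) + real q - 2 * real (Suc r) - real k = ?e" by simp
      from F(2)[OF n, of x y, unfolded this] show "?T * \<bar>?w (Suc p) q (fdiff (?c n))\<bar> \<le> F * n powr ?e" .
    qed
    also have "\<dots> = (real p * A + real q * B + E + F) * n powr ?e" by (simp add: algebra_simps)
    finally show ?thesis .
  qed
  then show ?case using A B E F by (intro exI[of _ "real p * A + real q * B + E + F"]) auto
qed

lemma kernel_eq_sum:
  assumes "low_pass_filter h" "0 < n"
  shows "kernel h n x y = (\<Sum>j<cutoff n. coef h n j * hermite_fun j x * hermite_fun j y)"
  unfolding kernel_def
  by (subst suminf_finite[of "{..<cutoff n}"]) (use assms coef_zero[OF assms] in \<open>auto simp: coef_def not_less\<close>)

lemma kernel_eq_wk:
  assumes "low_pass_filter h" "0 < n"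
  shows "kernel h n x y = wk (cutoff n) 0 0 (coef h n) x y"
  unfolding kernel_eq_sum[OF assms] wk_def
  by (intro sum.cong refl) (simp add: hermite_fun_eq field_simps)

lemma kernel_decay:
  assumes "low_pass_filter h"
  shows "\<exists>C\<ge>0. \<forall>n\<ge>1. \<forall>x y. \<bar>x - y\<bar> ^ k * \<bar>kernel h n x y\<bar> \<le> C * n powr (1 - real k)"
proof -
  obtain C where C: "C \<ge> 0" "\<And>n x y. n \<ge> 1 \<Longrightarrow> \<bar>sqrt 2 * (x - y)\<bar> ^ k * \<bar>kernel h n x y\<bar> \<le> C * n powr (1 - real k)"
    using wk_decay[OF assms, of k 0 0 0] by (auto simp: kernel_eq_wk[OF assms])
  have "\<bar>x - y\<bar> ^ k * \<bar>kernel h n x y\<bar> \<le> \<bar>sqrt 2 * (x - y)\<bar> ^ k * \<bar>kernel h n x y\<bar>" for n x y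
  proof (intro mult_right_mono power_mono)
    show "\<bar>x - y\<bar> \<le> \<bar>sqrt 2 * (x - y)\<bar>" by (simp add: abs_mult mult_le_cancel_right1)
  qed auto
  then show ?thesis using C by (meson order_trans)
qed

text \<open>The cases \<open>k = 0\<close> and \<open>k = 2\<close> combined. The majorant is a
  multiple of a Poisson kernel of width \<open>1 / n\<close>, whose integral in either variable does
  not depend on \<open>n\<close>.\<close>

lemma kernel_poisson_bound:
  assumes "low_pass_filter h"
  shows "\<exists>C\<ge>0. \<forall>n\<ge>1. \<forall>x y. \<bar>kernel h n x y\<bar> \<le> C * (n / (1 + (n * (x - y))\<^sup>2))"
proof -
  obtain C D where C: "C \<ge> 0" "\<And>n x y. n \<ge> 1 \<Longrightarrow> \<bar>x - y\<bar> ^ 0 * \<bar>kernel h n x y\<bar> \<le> C * n powr (1 - real 0)"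
    and D: "D \<ge> 0" "\<And>n x y. n \<ge> 1 \<Longrightarrow> \<bar>x - y\<bar> ^ 2 * \<bar>kernel h n x y\<bar> \<le> D * n powr (1 - real 2)"
    using kernel_decay[OF assms] by meson
  have "\<bar>kernel h n x y\<bar> \<le> (C + D) * (n / (1 + (n * (x - y))\<^sup>2))" if n: "n \<ge> 1" for n x y
  proof -
    have "n\<^sup>2 * (\<bar>x - y\<bar> ^ 2 * \<bar>kernel h n x y\<bar>) \<le> n\<^sup>2 * (D * n powr (1 - real 2))"
      using D(2)[OF n, of x y] by (intro mult_left_mono) auto
    also have "n\<^sup>2 * (D * n powr (1 - real 2)) = D * n"
      using n by (simp add: powr_minus field_simps power2_eq_square)
    finally have "n\<^sup>2 * (\<bar>x - y\<bar> ^ 2 * \<bar>kernel h n x y\<bar>) \<le> D * n" .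
    moreover have "\<bar>kernel h n x y\<bar> \<le> C * n"
      using C(2)[OF n, of x y] n by simp
    moreover have "\<bar>kernel h n x y\<bar> * (1 + (n * (x - y))\<^sup>2) = \<bar>kernel h n x y\<bar> + n\<^sup>2 * (\<bar>x - y\<bar> ^ 2 * \<bar>kernel h n x y\<bar>)"
      by (simp add: distrib_left power_mult_distrib mult_ac)
    ultimately have "\<bar>kernel h n x y\<bar> * (1 + (n * (x - y))\<^sup>2) \<le> (C + D) * n"
      by (simp add: distrib_right)
    then show ?thesis by (simp add: pos_le_divide_eq)
  qed
  then show ?thesis using C D by (intro exI[of _ "C + D"]) auto
qed

section \<open>Norms\<close>

lemma one_plus_square_nonzero [simp]: "1 + (x::real)\<^sup>2 \<noteq> 0"
  using one_plus_square_pos[of x] by linarith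

lemma ennpowr_le_iff:
  assumes "0 < r" "0 \<le> c"
  shows "ennpowr a r \<le> ennreal c \<longleftrightarrow> a \<le> ennreal (c powr (1 / r))"
proof (cases a)
  case (real t)
  have "t powr r \<le> c \<longleftrightarrow> t \<le> c powr (1 / r)"
  proof
    assume "t powr r \<le> c"
    then have "(t powr r) powr (1 / r) \<le> c powr (1 / r)" using assms by (intro powr_mono2) auto
    then show "t \<le> c powr (1 / r)" using real assms by (simp add: powr_powr)
  next
    assume "t \<le> c powr (1 / r)"
    then have "t powr r \<le> (c powr (1 / r)) powr r" using assms real by (intro powr_mono2) auto
    then show "t powr r \<le> c" using real assms by (simp add: powr_powr)
  qed
  then show ?thesis using real assms by (simp add: ennpowr_def)
qed (simp add: ennpowr_def top_unique)

lemma ennpowr_mono: "0 < r \<Longrightarrow> a \<le> b \<Longrightarrow> ennpowr a r \<le> ennpowr b r"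
  by (cases a; cases b) (auto simp: ennpowr_def top_unique intro!: powr_mono2)

lemma ennpowr_mult:
  assumes "0 < r" "0 \<le> k"
  shows "ennpowr (ennreal k * a) r = ennreal (k powr r) * ennpowr a r"
proof (cases a)
  case (real t)
  then have "ennreal k * a = ennreal (k * t)" using assms by (simp add: ennreal_mult)
  then have "ennpowr (ennreal k * a) r = ennreal ((k * t) powr r)"
    using real(1) assms by (simp only: ennpowr_def) simp
  also have "\<dots> = ennreal (k powr r) * ennpowr a r"
    using real assms by (simp add: ennpowr_def powr_mult ennreal_mult)
  finally show ?thesis .
next
  case top
  then show ?thesis using assms by (cases "k = 0") (auto simp: ennpowr_def ennreal_mult_top)
qed

lemma ennpowr_less_top_iff: "ennpowr a r < \<infinity> \<longleftrightarrow> a < \<infinity>"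
  by (simp add: ennpowr_def less_top)

lemma ennpowr_0 [simp]: "ennpowr 0 r = 0"
  by (simp add: ennpowr_def)

lemma one_le_enn2real: "1 \<le> p \<Longrightarrow> p \<noteq> top \<Longrightarrow> 1 \<le> enn2real p"
  using enn2real_mono[of 1 p] by (simp add: less_top)

lemma Lp_norm_eq_nn_integral:
  assumes "B \<in> sets lebesgue" "p \<noteq> top"
  shows "Lp_norm p B f = ennpowr (\<integral>\<^sup>+x. ennreal (\<bar>f x\<bar> powr enn2real p) * indicator B x \<partial>lebesgue) (1 / enn2real p)"
  using assms by (simp add: Lp_norm_def nn_integral_restrict_space)

lemma Lp_norm_le_iff:
  assumes "B \<in> sets lebesgue" "1 \<le> p" "p \<noteq> top" "0 \<le> c"
  shows "Lp_norm p B f \<le> ennreal c \<longleftrightarrow>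
    (\<integral>\<^sup>+x. ennreal (\<bar>f x\<bar> powr enn2real p) * indicator B x \<partial>lebesgue) \<le> ennreal (c powr enn2real p)"
  using one_le_enn2real[OF assms(2,3)] assms by (simp add: Lp_norm_eq_nn_integral ennpowr_le_iff)

lemma Lp_norm_top_le_iff:
  assumes [measurable]: "B \<in> sets lebesgue" "f \<in> borel_measurable lebesgue"
  shows "Lp_norm top B f \<le> C \<longleftrightarrow> (AE x in lebesgue. x \<in> B \<longrightarrow> ennreal \<bar>f x\<bar> \<le> C)"
proof -
  have [measurable]: "f \<in> borel_measurable (lebesgue_on B)"
    by (rule measurable_restrict_space1) simp
  have "Lp_norm top B f \<le> C \<longleftrightarrow> (AE x in lebesgue_on B. ennreal \<bar>f x\<bar> \<le> C)"
  proof
    assume "Lp_norm top B f \<le> C"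
    with esssup_AE[where f = "\<lambda>x. ennreal \<bar>f x\<bar>" and M = "lebesgue_on B"]
    show "AE x in lebesgue_on B. ennreal \<bar>f x\<bar> \<le> C"
      by (auto simp: Lp_norm_def intro: order_trans elim!: eventually_mono)
  next
    assume "AE x in lebesgue_on B. ennreal \<bar>f x\<bar> \<le> C"
    then show "Lp_norm top B f \<le> C"
      unfolding Lp_norm_def by (auto intro!: esssup_I)
  qed
  then show ?thesis by (simp add: AE_restrict_space_iff)
qed

text \<open>On \<open>A\<close> the function \<open>f\<close> may differ from zero only inside
  \<open>B\<close>, almost everywhere. One statement thus covers restriction to a smaller set,
  multiplication by a bounded function, and cutoffs supported in \<open>B\<close>.\<close>

lemma Lp_norm_mono_mult:
  assumes [measurable]: "A \<in> sets lebesgue" "B \<in> sets lebesgue"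
      "f \<in> borel_measurable lebesgue" "g \<in> borel_measurable lebesgue"
    and p: "1 \<le> p" and c: "0 \<le> c"
    and le: "AE x in lebesgue. x \<in> A \<longrightarrow> \<bar>f x\<bar> \<le> (if x \<in> B then c * \<bar>g x\<bar> else 0)"
  shows "Lp_norm p A f \<le> ennreal c * Lp_norm p B g"
proof (cases "p = top")
  case True
  have "AE x in lebesgue. x \<in> B \<longrightarrow> ennreal \<bar>g x\<bar> \<le> Lp_norm top B g"
    using Lp_norm_top_le_iff[of B g "Lp_norm top B g"] by simp
  with le have "AE x in lebesgue. x \<in> A \<longrightarrow> ennreal \<bar>f x\<bar> \<le> ennreal c * Lp_norm top B g"
  proof eventually_elim
    case (elim x)
    show ?case
    proof
      assume "x \<in> A"
      show "ennreal \<bar>f x\<bar> \<le> ennreal c * Lp_norm top B g"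
      proof (cases "x \<in> B")
        case True
        with elim \<open>x \<in> A\<close> have "ennreal \<bar>f x\<bar> \<le> ennreal c * ennreal \<bar>g x\<bar>"
          using c by (simp flip: ennreal_mult' add: ennreal_leI)
        also have "\<dots> \<le> ennreal c * Lp_norm top B g"
          using elim True by (intro mult_left_mono) auto
        finally show ?thesis .
      qed (use elim \<open>x \<in> A\<close> in auto)
    qed
  qed
  then show ?thesis
    using True by (simp add: Lp_norm_top_le_iff)
next
  case False
  define q where "q = enn2real p"
  have q: "1 \<le> q" using one_le_enn2real[OF p False] by (simp add: q_def)
  have "(\<integral>\<^sup>+x. ennreal (\<bar>f x\<bar> powr q) * indicator A x \<partial>lebesgue)
      \<le> (\<integral>\<^sup>+x. ennreal (c powr q) * (ennreal (\<bar>g x\<bar> powr q) * indicator B x) \<partial>lebesgue)"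
  proof (rule nn_integral_mono_AE, use le in eventually_elim)
    case (elim x)
    have "\<bar>f x\<bar> powr q \<le> c powr q * \<bar>g x\<bar> powr q" if "x \<in> A" "x \<in> B"
    proof -
      have "\<bar>f x\<bar> powr q \<le> (c * \<bar>g x\<bar>) powr q" using elim that q by (intro powr_mono2) auto
      then show ?thesis using c by (simp add: powr_mult)
    qed
    with elim show ?case
      by (auto simp: indicator_def ennreal_mult'[symmetric] intro!: ennreal_leI)
  qed
  also have "\<dots> = ennreal (c powr q) * (\<integral>\<^sup>+x. ennreal (\<bar>g x\<bar> powr q) * indicator B x \<partial>lebesgue)"
    by (rule nn_integral_cmult) measurable
  finally have "ennpowr (\<integral>\<^sup>+x. ennreal (\<bar>f x\<bar> powr q) * indicator A x \<partial>lebesgue) (1 / q)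
    \<le> ennpowr (ennreal (c powr q) * (\<integral>\<^sup>+x. ennreal (\<bar>g x\<bar> powr q) * indicator B x \<partial>lebesgue)) (1 / q)"
    using q by (intro ennpowr_mono) auto
  also have "\<dots> = ennreal c * ennpowr (\<integral>\<^sup>+x. ennreal (\<bar>g x\<bar> powr q) * indicator B x \<partial>lebesgue) (1 / q)"
    using q c by (subst ennpowr_mult) (auto simp: powr_powr)
  finally show ?thesis
    using False by (simp add: Lp_norm_eq_nn_integral q_def)
qed

lemma Lp_norm_mono:
  assumes "A \<in> sets lebesgue" "B \<in> sets lebesgue"
      "f \<in> borel_measurable lebesgue" "g \<in> borel_measurable lebesgue" "1 \<le> p"
    and "\<And>x. x \<in> A \<Longrightarrow> x \<in> B \<and> \<bar>f x\<bar> \<le> \<bar>g x\<bar>"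
  shows "Lp_norm p A f \<le> Lp_norm p B g"
  using Lp_norm_mono_mult[OF assms(1-5), of 1] assms(6) by auto

lemma Lp_norm_cong_AE:
  assumes "A \<in> sets lebesgue" "f \<in> borel_measurable lebesgue" "g \<in> borel_measurable lebesgue" "1 \<le> p"
    and "AE x in lebesgue. f x = g x"
  shows "Lp_norm p A f = Lp_norm p A g"
proof (rule antisym)
  show "Lp_norm p A f \<le> Lp_norm p A g"
    by (rule Lp_norm_mono_mult[OF assms(1,1,2,3,4), of 1, simplified])
       (use assms(5) in \<open>eventually_elim, simp\<close>)
  show "Lp_norm p A g \<le> Lp_norm p A f"
    by (rule Lp_norm_mono_mult[OF assms(1,1,3,2,4), of 1, simplified])
       (use assms(5) in \<open>eventually_elim, simp\<close>)
qed

text \<open>The graph of the convex function \<open>u powr q\<close> lies above its tangent at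
  \<open>s\<close>. This is Young's inequality with exponents \<open>q\<close> and
  \<open>q / (q - 1)\<close>, so \<open>q = 1\<close> is treated apart.\<close>

lemma powr_tangent:
  fixes u s q :: real
  assumes "1 \<le> q" "0 \<le> u" "0 \<le> s"
  shows "q * s powr (q - 1) * u \<le> u powr q + (q - 1) * s powr q"
proof (cases "q = 1")
  case True
  then show ?thesis using assms by (cases "s = 0") auto
next
  case False
  then have q: "1 < q" using assms by auto
  have "u * s powr (q - 1) \<le> u powr q / q + (s powr (q - 1)) powr (q / (q - 1)) / (q / (q - 1))"
    using q assms by (intro Youngs_inequality) (auto simp: field_simps)
  also have "(s powr (q - 1)) powr (q / (q - 1)) = s powr q" using q by (simp add: powr_powr)
  finally show ?thesis using q by (simp add: field_simps)
qed

text \<open>Convexity at the mean of \<open>u / a\<close> and \<open>v / b\<close> with weights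
  \<open>a / (a + b)\<close> and \<open>b / (a + b)\<close>: the pointwise form of Minkowski's
  inequality.\<close>

lemma powr_add_le_convex:
  fixes a b u v q :: real
  assumes "1 \<le> q" "0 < a" "0 < b" "0 \<le> u" "0 \<le> v"
  shows "(u + v) powr q \<le> (a + b) powr q * (a / (a + b) * (u powr q / a powr q) + b / (a + b) * (v powr q / b powr q))"
proof -
  define s where "s = (u + v) / (a + b)"
  define l m where "l = a / (a + b)" and "m = b / (a + b)"
  have lm: "0 \<le> l" "0 \<le> m" "l + m = 1" using assms by (auto simp: l_def m_def simp flip: add_divide_distrib)
  have s: "0 \<le> s" using assms by (simp add: s_def)
  have "q * s powr (q - 1) * (l * (u / a) + m * (v / b)) =
      l * (q * s powr (q - 1) * (u / a)) + m * (q * s powr (q - 1) * (v / b))"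
    by (simp add: algebra_simps)
  also have "\<dots> \<le> l * ((u / a) powr q + (q - 1) * s powr q) + m * ((v / b) powr q + (q - 1) * s powr q)"
    using assms s lm by (intro add_mono mult_left_mono powr_tangent) auto
  also have "\<dots> = l * (u / a) powr q + m * (v / b) powr q + (l + m) * ((q - 1) * s powr q)"
    by (simp add: algebra_simps)
  also have "(l + m) * ((q - 1) * s powr q) = q * s powr q - s powr q"
    unfolding lm by (simp add: left_diff_distrib)
  finally have *: "q * s powr (q - 1) * (l * (u / a) + m * (v / b)) \<le>
      l * (u / a) powr q + m * (v / b) powr q + (q * s powr q - s powr q)" .
  have e: "l * (u / a) + m * (v / b) = s"
    using assms by (simp add: l_def m_def s_def add_divide_distrib)
  have "q * s powr (q - 1) * s = q * s powr q"
    using s by (cases "s = 0") (auto simp: powr_diff)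
  then have "s powr q \<le> l * (u / a) powr q + m * (v / b) powr q"
    using *[unfolded e] by linarith
  then have "(u + v) powr q / (a + b) powr q \<le> a / (a + b) * (u powr q / a powr q) + b / (a + b) * (v powr q / b powr q)"
    using assms by (simp add: powr_divide s_def l_def m_def)
  moreover have "0 < (a + b) powr q" using assms by simp
  ultimately show ?thesis
    by (simp add: pos_divide_le_eq mult.commute)
qed

text \<open>Minkowski's inequality with strictly positive bounds in place of the norms, so that
  functions can be normalized even if a norm is zero.\<close>

lemma Lp_norm_add_le_real:
  assumes [measurable]: "B \<in> sets lebesgue" "f \<in> borel_measurable lebesgue" "g \<in> borel_measurable lebesgue"
    and p: "1 \<le> p" and a: "0 < a" "Lp_norm p B f \<le> ennreal a" and b: "0 < b" "Lp_norm p B g \<le> ennreal b"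
  shows "Lp_norm p B (\<lambda>x. f x + g x) \<le> ennreal (a + b)"
proof (cases "p = top")
  case True
  have "AE x in lebesgue. x \<in> B \<longrightarrow> ennreal \<bar>f x\<bar> \<le> ennreal a" "AE x in lebesgue. x \<in> B \<longrightarrow> ennreal \<bar>g x\<bar> \<le> ennreal b"
    using a b True Lp_norm_top_le_iff[of B f] Lp_norm_top_le_iff[of B g] by auto
  then have "AE x in lebesgue. x \<in> B \<longrightarrow> ennreal \<bar>f x + g x\<bar> \<le> ennreal (a + b)"
    by eventually_elim (use a b in \<open>auto intro!: ennreal_leI simp del: ennreal_plus\<close>)
  then show ?thesis using True by (simp add: Lp_norm_top_le_iff)
next
  case False
  define q where "q = enn2real p"
  have q: "1 \<le> q" using one_le_enn2real[OF p False] by (simp add: q_def)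
  let ?I = "\<lambda>f. (\<integral>\<^sup>+x. ennreal (\<bar>f x\<bar> powr q) * indicator B x \<partial>lebesgue)"
  have fa: "?I f \<le> ennreal (a powr q)" and gb: "?I g \<le> ennreal (b powr q)"
    using a b p False by (simp_all add: Lp_norm_le_iff q_def)
  \<comment> \<open>The coefficients of \<open>powr_add_le_convex\<close>; they satisfy
    \<open>\<alpha> * a powr q + \<beta> * b powr q = (a + b) powr q\<close>.\<close>
  define \<alpha> \<beta> where "\<alpha> = (a + b) powr q * (a / (a + b)) / a powr q" and "\<beta> = (a + b) powr q * (b / (a + b)) / b powr q"
  have nn: "0 \<le> \<alpha>" "0 \<le> \<beta>" using a b by (auto simp: \<alpha>_def \<beta>_def)
  have "?I (\<lambda>x. f x + g x) \<le> (\<integral>\<^sup>+x. ennreal \<alpha> * (ennreal (\<bar>f x\<bar> powr q) * indicator B x)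
      + ennreal \<beta> * (ennreal (\<bar>g x\<bar> powr q) * indicator B x) \<partial>lebesgue)"
  proof (rule nn_integral_mono)
    fix x
    have "\<bar>f x + g x\<bar> powr q \<le> (\<bar>f x\<bar> + \<bar>g x\<bar>) powr q" using q by (intro powr_mono2) auto
    also have "\<dots> \<le> \<alpha> * \<bar>f x\<bar> powr q + \<beta> * \<bar>g x\<bar> powr q"
      using powr_add_le_convex[OF q a(1) b(1), of "\<bar>f x\<bar>" "\<bar>g x\<bar>"]
      by (simp add: \<alpha>_def \<beta>_def distrib_left mult_ac)
    finally show "ennreal (\<bar>f x + g x\<bar> powr q) * indicator B x \<le>
      ennreal \<alpha> * (ennreal (\<bar>f x\<bar> powr q) * indicator B x) + ennreal \<beta> * (ennreal (\<bar>g x\<bar> powr q) * indicator B x)"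
      using nn by (auto simp: indicator_def ennreal_mult'[symmetric] ennreal_plus[symmetric] simp del: ennreal_plus intro!: ennreal_leI)
  qed
  also have "\<dots> = ennreal \<alpha> * ?I f + ennreal \<beta> * ?I g"
    by (simp add: nn_integral_add nn_integral_cmult)
  also have "\<dots> \<le> ennreal \<alpha> * ennreal (a powr q) + ennreal \<beta> * ennreal (b powr q)"
    by (intro add_mono mult_left_mono fa gb) auto
  also have "\<dots> = ennreal (\<alpha> * a powr q + \<beta> * b powr q)"
    using nn by (simp add: ennreal_mult')
  also have "\<alpha> * a powr q + \<beta> * b powr q = (a + b) powr q * (a / (a + b) + b / (a + b))"
    using a b by (simp add: \<alpha>_def \<beta>_def distrib_left)
  also have "a / (a + b) + b / (a + b) = 1" using a b by (simp flip: add_divide_distrib)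
  finally show ?thesis
    using a b p False by (subst Lp_norm_le_iff) (auto simp: q_def)
qed

lemma Lp_norm_triangle:
  assumes "B \<in> sets lebesgue" "f \<in> borel_measurable lebesgue" "g \<in> borel_measurable lebesgue" "1 \<le> p"
  shows "Lp_norm p B (\<lambda>x. f x + g x) \<le> Lp_norm p B f + Lp_norm p B g"
proof (cases "Lp_norm p B f < \<infinity> \<and> Lp_norm p B g < \<infinity>")
  case True
  obtain a b where ab: "0 \<le> a" "0 \<le> b" "Lp_norm p B f = ennreal a" "Lp_norm p B g = ennreal b"
    using True by (cases "Lp_norm p B f"; cases "Lp_norm p B g") auto
  show ?thesis
  proof (rule ennreal_le_epsilon)
    fix e :: real assume e: "0 < e"
    \<comment> \<open>The summands \<open>e / 2\<close> keep both bounds positive.\<close>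
    have "Lp_norm p B (\<lambda>x. f x + g x) \<le> ennreal ((a + e / 2) + (b + e / 2))"
      using ab e by (intro Lp_norm_add_le_real assms) (auto intro!: ennreal_leI)
    also have "(a + e / 2) + (b + e / 2) = a + b + e" by simp
    finally show "Lp_norm p B (\<lambda>x. f x + g x) \<le> Lp_norm p B f + Lp_norm p B g + ennreal e"
      using ab e by simp
  qed
qed (auto simp: not_less top_unique)

lemma Lp_norm_triangle_diff:
  assumes "B \<in> sets lebesgue" "f \<in> borel_measurable lebesgue" "g \<in> borel_measurable lebesgue" "1 \<le> p"
  shows "Lp_norm p B (\<lambda>x. f x - g x) \<le> Lp_norm p B f + Lp_norm p B g"
proof -
  have "Lp_norm p B (\<lambda>x. - g x) \<le> Lp_norm p B g" using assms by (intro Lp_norm_mono) auto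
  then show ?thesis
    using Lp_norm_triangle[OF assms(1,2) borel_measurable_uminus[OF assms(3)] assms(4)] add_left_mono order_trans
    by fastforce
qed

lemma Lp_norm_sum_le:
  assumes "finite I" "B \<in> sets lebesgue" "\<And>i. i \<in> I \<Longrightarrow> f i \<in> borel_measurable lebesgue" "1 \<le> p"
  shows "Lp_norm p B (\<lambda>x. \<Sum>i\<in>I. f i x) \<le> (\<Sum>i\<in>I. Lp_norm p B (f i))"
  using assms(1,3)
proof (induction I rule: finite_induct)
  case empty
  show ?case using Lp_norm_mono_mult[OF assms(2,2) borel_measurable_const borel_measurable_const assms(4), of 0 0 0] by simp
next
  case (insert i I)
  have "Lp_norm p B (\<lambda>x. f i x + (\<Sum>i\<in>I. f i x)) \<le> Lp_norm p B (f i) + Lp_norm p B (\<lambda>x. \<Sum>i\<in>I. f i x)"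
    using insert assms by (intro Lp_norm_triangle) auto
  also have "\<dots> \<le> Lp_norm p B (f i) + (\<Sum>i\<in>I. Lp_norm p B (f i))"
    using insert by (intro add_left_mono) auto
  finally show ?case using insert by simp
qed

lemma lebesgue_measurable_borel: "f \<in> borel_measurable borel \<Longrightarrow> (f :: real \<Rightarrow> real) \<in> borel_measurable lebesgue"
  by (simp add: measurable_completion)

lemma nn_integral_cauchy_density:
  "0 \<le> c \<Longrightarrow> (\<integral>\<^sup>+x. ennreal (c / (1 + x\<^sup>2)) \<partial>lborel) = ennreal (c * pi)"
  using integrable_cauchy_density integral_cauchy_density by (subst nn_integral_eq_integral) auto

text \<open>The constant \<open>4\<close> serves every \<open>p\<close>: the weight is at most
  \<open>1\<close>, so its power \<open>q\<close> is at most itself and has integral at most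
  \<open>pi\<close>, and \<open>pi < 4 \<le> 4 powr q\<close>.\<close>

lemma Lp_norm_decay_le:
  assumes [measurable]: "B \<in> sets lebesgue" "f \<in> borel_measurable lebesgue" and p: "1 \<le> p" and c: "0 \<le> c"
    and le: "\<And>x. x \<in> B \<Longrightarrow> \<bar>f x\<bar> \<le> c / (1 + x\<^sup>2)"
  shows "Lp_norm p B f \<le> ennreal (4 * c)"
proof (cases "p = top")
  case True
  have "\<bar>f x\<bar> \<le> 4 * c" if "x \<in> B" for x
  proof -
    have "c / (1 + x\<^sup>2) \<le> c / 1" using c by (intro divide_left_mono) auto
    then show ?thesis using le[OF that] c by simp
  qed
  then show ?thesis using True by (auto simp: Lp_norm_top_le_iff intro!: ennreal_leI)
next
  case False
  define q where "q = enn2real p"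
  have q: "1 \<le> q" using one_le_enn2real[OF p False] by (simp add: q_def)
  have "(\<integral>\<^sup>+x. ennreal (\<bar>f x\<bar> powr q) * indicator B x \<partial>lebesgue) \<le> (\<integral>\<^sup>+x. ennreal (c powr q / (1 + x\<^sup>2)) \<partial>lebesgue)"
  proof (rule nn_integral_mono)
    fix x
    have "\<bar>f x\<bar> powr q \<le> c powr q / (1 + x\<^sup>2)" if "x \<in> B"
    proof -
      have "\<bar>f x\<bar> powr q \<le> (c / (1 + x\<^sup>2)) powr q" using le[OF that] q by (intro powr_mono2) auto
      also have "\<dots> = c powr q / (1 + x\<^sup>2) powr q" using c by (simp add: powr_divide)
      also have "\<dots> \<le> c powr q / (1 + x\<^sup>2) powr 1"
        using q by (intro divide_left_mono powr_mono mult_pos_pos) auto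
      finally show ?thesis by simp
    qed
    then show "ennreal (\<bar>f x\<bar> powr q) * indicator B x \<le> ennreal (c powr q / (1 + x\<^sup>2))"
      by (auto simp: indicator_def intro!: ennreal_leI)
  qed
  also have "\<dots> = ennreal (c powr q * pi)"
    by (simp add: nn_integral_completion nn_integral_cauchy_density)
  also have "\<dots> \<le> ennreal ((4 * c) powr q)"
  proof (intro ennreal_leI)
    have "pi \<le> 4 powr 1" using pi_less_4 by simp
    also have "\<dots> \<le> 4 powr q" using q by (intro powr_mono) auto
    finally show "c powr q * pi \<le> (4 * c) powr q" using c by (simp add: powr_mult mult.commute[of pi] mult.commute[of "4 powr q"] mult_left_mono)
  qed
  finally show ?thesis using p c False by (subst Lp_norm_le_iff) (auto simp: q_def)
qed

section \<open>All spaces \<open>Xspace p\<close> inside one weighted space\<close>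

lemma Xspace_measurable: "f \<in> Xspace p \<Longrightarrow> f \<in> borel_measurable lebesgue"
  by (auto simp: Xspace_def intro!: lebesgue_measurable_borel borel_measurable_continuous_onI split: if_splits)

lemma Xspace_top_bounded:
  assumes "f \<in> Xspace top" shows "\<exists>M\<ge>0. \<forall>x. \<bar>f x\<bar> \<le> M"
proof -
  from assms have c: "continuous_on UNIV f" and l: "(f \<longlongrightarrow> 0) at_infinity" by (auto simp: Xspace_def)
  from tendstoD[OF l, of 1] obtain R where R: "\<And>x. R \<le> norm x \<Longrightarrow> \<bar>f x\<bar> < 1"
    by (auto simp: eventually_at_infinity dist_norm)
  have "bounded (f ` {-R..R})"
    using c by (intro compact_imp_bounded compact_continuous_image) (auto intro: continuous_on_subset)
  then obtain M where M: "\<forall>x\<in>{-R..R}. \<bar>f x\<bar> \<le> M" by (auto simp: bounded_iff)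
  have "\<bar>f x\<bar> \<le> max M 1" for x
  proof (cases "R \<le> norm x")
    case False
    then have "x \<in> {-R..R}" by auto
    with M show ?thesis by (auto simp: le_max_iff_disj)
  qed (use R[of x] in auto)
  then show ?thesis by (intro exI[of _ "max M 1"]) auto
qed

lemma Xspace_norm_finite:
  assumes "f \<in> Xspace p" shows "Lp_norm p UNIV f < \<infinity>"
proof (cases "p = top")
  case True
  then obtain M where "M \<ge> 0" "\<And>x. \<bar>f x\<bar> \<le> M" using Xspace_top_bounded assms by auto
  then have "Lp_norm top UNIV f \<le> ennreal M"
    using Xspace_measurable[OF assms] by (subst Lp_norm_top_le_iff) (auto intro!: ennreal_leI)
  then show ?thesis using True by (auto simp: order_le_less_trans)
qed (use assms in \<open>auto simp: Xspace_def\<close>)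

text \<open>Where \<open>|f|\<close> exceeds \<open>1\<close> it is at most its power
  \<open>q\<close>; elsewhere the weight alone is integrable. Thus all exponents lead to the same
  weighted space.\<close>

lemma weighted_integrable:
  assumes f: "f \<in> borel_measurable lebesgue" and p: "1 \<le> p" and fin: "Lp_norm p UNIV f < \<infinity>"
  shows "integrable lebesgue (\<lambda>x. f x / (1 + x\<^sup>2))"
proof -
  have meas: "(\<lambda>x. f x / (1 + x\<^sup>2)) \<in> borel_measurable lebesgue"
    using f by (intro borel_measurable_divide lebesgue_measurable_borel[of "\<lambda>x. 1 + x\<^sup>2"]) auto
  obtain a where a: "0 \<le> a" "Lp_norm p UNIV f = ennreal a" using fin by (cases "Lp_norm p UNIV f") auto
  have w: "(\<integral>\<^sup>+x. ennreal (1 / (1 + x\<^sup>2)) \<partial>lebesgue) = ennreal pi"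
    using nn_integral_cauchy_density[of 1] by (simp add: nn_integral_completion)
  have "(\<integral>\<^sup>+x. ennreal (norm (f x / (1 + x\<^sup>2))) \<partial>lebesgue) < \<infinity>"
  proof (cases "p = top")
    case True
    then have "AE x in lebesgue. ennreal \<bar>f x\<bar> \<le> ennreal a"
      using a f by (auto simp: Lp_norm_top_le_iff dest: eq_refl)
    then have "(\<integral>\<^sup>+x. ennreal (norm (f x / (1 + x\<^sup>2))) \<partial>lebesgue) \<le> (\<integral>\<^sup>+x. ennreal (a / (1 + x\<^sup>2)) \<partial>lebesgue)"
      using a by (intro nn_integral_mono_AE) (auto elim!: eventually_mono intro!: ennreal_leI divide_right_mono)
    also have "\<dots> < \<infinity>" using a by (simp add: nn_integral_completion nn_integral_cauchy_density)
    finally show ?thesis .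
  next
    case False
    define q where "q = enn2real p"
    have q: "1 \<le> q" using one_le_enn2real[OF p False] by (simp add: q_def)
    have I: "(\<integral>\<^sup>+x. ennreal (\<bar>f x\<bar> powr q) \<partial>lebesgue) \<le> ennreal (a powr q)"
      using a p False Lp_norm_le_iff[of UNIV p a f] by (simp add: q_def)
    have "(\<integral>\<^sup>+x. ennreal (norm (f x / (1 + x\<^sup>2))) \<partial>lebesgue) \<le>
        (\<integral>\<^sup>+x. ennreal (1 / (1 + x\<^sup>2)) + ennreal (\<bar>f x\<bar> powr q) \<partial>lebesgue)"
    proof (rule nn_integral_mono)
      fix x
      have "norm (f x / (1 + x\<^sup>2)) \<le> 1 / (1 + x\<^sup>2) + \<bar>f x\<bar> powr q"
      proof (cases "\<bar>f x\<bar> \<le> 1")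
        case True
        then have "norm (f x / (1 + x\<^sup>2)) \<le> 1 / (1 + x\<^sup>2)" by (simp add: divide_right_mono)
        then show ?thesis by (smt (verit) powr_ge_zero)
      next
        case False
        have "norm (f x / (1 + x\<^sup>2)) \<le> \<bar>f x\<bar> powr 1" by (simp add: divide_le_eq mult_le_cancel_left1 distrib_left)
        also have "\<dots> \<le> \<bar>f x\<bar> powr q" using False q by (intro powr_mono) auto
        finally show ?thesis by (smt (verit) divide_nonneg_pos one_plus_square_pos)
      qed
      then show "ennreal (norm (f x / (1 + x\<^sup>2))) \<le> ennreal (1 / (1 + x\<^sup>2)) + ennreal (\<bar>f x\<bar> powr q)"
        by (simp add: ennreal_plus[symmetric] ennreal_leI del: ennreal_plus)
    qed
    also have "\<dots> = (\<integral>\<^sup>+x. ennreal (1 / (1 + x\<^sup>2)) \<partial>lebesgue) + (\<integral>\<^sup>+x. ennreal (\<bar>f x\<bar> powr q) \<partial>lebesgue)"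
    proof (rule nn_integral_add)
      show "(\<lambda>x. ennreal (1 / (1 + x\<^sup>2))) \<in> borel_measurable lebesgue"
        by (intro measurable_compose[OF _ measurable_ennreal] lebesgue_measurable_borel) simp
    qed (use f in simp)
    also have "\<dots> < \<infinity>"
      using I w by (auto simp: ennreal_add_less_top order_le_less_trans)
    finally show ?thesis .
  qed
  then show ?thesis using meas by (simp add: integrable_iff_bounded)
qed

text \<open>Schur test: the case \<open>p < \<infinity>\<close> integrates the tangent line inequality at \<open>s = \<bar>T x\<bar> / M\<close>.\<close>

lemma Schur_test_borel:
  fixes P :: "real \<Rightarrow> real \<Rightarrow> real"
  assumes P [measurable]: "(\<lambda>z. P (fst z) (snd z)) \<in> borel_measurable (borel \<Otimes>\<^sub>M borel)"
    and P0: "\<And>x y. 0 \<le> P x y" and M: "0 < M"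
    and Py: "\<And>x. (\<integral>\<^sup>+y. ennreal (P x y) \<partial>lborel) \<le> ennreal M"
    and Px: "\<And>y. (\<integral>\<^sup>+x. ennreal (P x y) \<partial>lborel) \<le> ennreal M"
    and f [measurable]: "f \<in> borel_measurable borel" and T [measurable]: "T \<in> borel_measurable borel"
    and p: "1 \<le> p"
    and le: "\<And>x. ennreal \<bar>T x\<bar> \<le> (\<integral>\<^sup>+y. ennreal (P x y) * ennreal \<bar>f y\<bar> \<partial>lborel)"
  shows "Lp_norm p UNIV T \<le> ennreal M * Lp_norm p UNIV f"
proof -
  have [measurable]: "P x \<in> borel_measurable borel" for x
    using measurable_compose[OF measurable_Pair1' P, of x] by simp
  have [measurable]: "(\<lambda>x. P x y) \<in> borel_measurable borel" for y
    using measurable_compose[OF measurable_Pair2' P, of y] by simp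
  note lm = lebesgue_measurable_borel[OF f] lebesgue_measurable_borel[OF T]
  show ?thesis
  proof (cases "p = top")
    case True
    have "AE y in lebesgue. ennreal \<bar>f y\<bar> \<le> Lp_norm top UNIV f"
      using Lp_norm_top_le_iff[of UNIV f "Lp_norm top UNIV f"] lm by simp
    then have AE: "AE y in lborel. ennreal \<bar>f y\<bar> \<le> Lp_norm top UNIV f"
      by (subst (asm) AE_completion_iff) auto
    have "ennreal \<bar>T x\<bar> \<le> ennreal M * Lp_norm top UNIV f" for x
    proof -
      have "ennreal \<bar>T x\<bar> \<le> (\<integral>\<^sup>+y. ennreal (P x y) * Lp_norm top UNIV f \<partial>lborel)"
        by (rule order_trans[OF le nn_integral_mono_AE], use AE in eventually_elim) (auto intro!: mult_left_mono)
      also have "\<dots> = (\<integral>\<^sup>+y. ennreal (P x y) \<partial>lborel) * Lp_norm top UNIV f"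
        by (rule nn_integral_multc) measurable
      also have "\<dots> \<le> ennreal M * Lp_norm top UNIV f" using Py by (intro mult_right_mono) auto
      finally show ?thesis .
    qed
    then show ?thesis using True lm by (simp add: Lp_norm_top_le_iff)
  next
    case False
    define q where "q = enn2real p"
    have q: "1 \<le> q" using one_le_enn2real[OF p False] by (simp add: q_def)
    let ?J = "\<lambda>x. \<integral>\<^sup>+y. ennreal (P x y) * ennreal (\<bar>f y\<bar> powr q) \<partial>lborel"
    have J: "ennreal (\<bar>T x\<bar> powr q) \<le> ennreal (M powr (q - 1)) * ?J x" for x
    proof -
      define s where "s = \<bar>T x\<bar> / M"
      have s: "0 \<le> s" "\<bar>T x\<bar> = M * s" using M by (auto simp: s_def)
      have "ennreal (q * M * s powr q) = ennreal (q * s powr (q - 1)) * ennreal \<bar>T x\<bar>"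
        using s M q by (cases "s = 0") (auto simp: powr_diff field_simps simp flip: ennreal_mult')
      also have "\<dots> \<le> ennreal (q * s powr (q - 1)) * (\<integral>\<^sup>+y. ennreal (P x y) * ennreal \<bar>f y\<bar> \<partial>lborel)"
        using le by (intro mult_left_mono) auto
      also have "\<dots> = (\<integral>\<^sup>+y. ennreal (q * s powr (q - 1)) * (ennreal (P x y) * ennreal \<bar>f y\<bar>) \<partial>lborel)"
        by (rule nn_integral_cmult[symmetric]) measurable
      also have "\<dots> \<le> (\<integral>\<^sup>+y. ennreal (P x y) * ennreal (\<bar>f y\<bar> powr q) + ennreal (P x y) * ennreal ((q - 1) * s powr q) \<partial>lborel)"
      proof (rule nn_integral_mono)
        fix y
        have "P x y * (q * s powr (q - 1) * \<bar>f y\<bar>) \<le> P x y * (\<bar>f y\<bar> powr q + (q - 1) * s powr q)"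
          using powr_tangent[OF q, of "\<bar>f y\<bar>" s] s P0 by (intro mult_left_mono) auto
        then show "ennreal (q * s powr (q - 1)) * (ennreal (P x y) * ennreal \<bar>f y\<bar>) \<le>
          ennreal (P x y) * ennreal (\<bar>f y\<bar> powr q) + ennreal (P x y) * ennreal ((q - 1) * s powr q)"
          using P0[of x y] q
          by (simp add: ennreal_mult'[symmetric] ennreal_plus[symmetric] distrib_left mult_ac del: ennreal_plus)
      qed
      also have "\<dots> = ?J x + (\<integral>\<^sup>+y. ennreal (P x y) \<partial>lborel) * ennreal ((q - 1) * s powr q)"
        by (subst nn_integral_add) (auto simp: nn_integral_multc)
      also have "\<dots> \<le> ?J x + ennreal M * ennreal ((q - 1) * s powr q)"
        by (intro add_left_mono mult_right_mono Py) auto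
      also have "ennreal M * ennreal ((q - 1) * s powr q) = ennreal ((q - 1) * M * s powr q)"
        using M q by (simp add: ennreal_mult'[symmetric] mult_ac)
      finally have "ennreal (q * M * s powr q) \<le> ?J x + ennreal ((q - 1) * M * s powr q)" .
      moreover have "ennreal (q * M * s powr q) = ennreal (M * s powr q) + ennreal ((q - 1) * M * s powr q)"
      proof -
        have "q * M * s powr q = M * s powr q + (q - 1) * M * s powr q" by (simp add: algebra_simps)
        then show ?thesis using M q by (simp only:) (rule ennreal_plus, auto)
      qed
      \<comment> \<open>The common summand is finite and cancels: of \<open>q\<close> copies of
        \<open>M * s powr q\<close> the second term of the tangent inequality absorbs
        \<open>q - 1\<close>.\<close>
      ultimately have "ennreal (M * s powr q) \<le> ?J x"
        by (simp add: add.commute[of _ "ennreal ((q - 1) * M * s powr q)"] ennreal_add_left_cancel_le)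
      then have "ennreal (M powr (q - 1)) * ennreal (M * s powr q) \<le> ennreal (M powr (q - 1)) * ?J x"
        by (intro mult_left_mono) auto
      moreover have "M powr (q - 1) * (M * s powr q) = \<bar>T x\<bar> powr q"
        using M s by (simp add: powr_diff powr_mult)
      ultimately show ?thesis by (simp add: ennreal_mult'[symmetric])
    qed
    have "(\<integral>\<^sup>+x. ennreal (\<bar>T x\<bar> powr q) \<partial>lborel) \<le> (\<integral>\<^sup>+x. ennreal (M powr (q - 1)) * ?J x \<partial>lborel)"
      by (rule nn_integral_mono) (rule J)
    also have "\<dots> = ennreal (M powr (q - 1)) * (\<integral>\<^sup>+x. ?J x \<partial>lborel)"
      by (rule nn_integral_cmult) measurable
    also have "(\<integral>\<^sup>+x. ?J x \<partial>lborel) = (\<integral>\<^sup>+y. (\<integral>\<^sup>+x. ennreal (P x y) * ennreal (\<bar>f y\<bar> powr q) \<partial>lborel) \<partial>lborel)"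
    proof (rule lborel_pair.Fubini'[symmetric])
      have "(\<lambda>z. ennreal (P (fst z) (snd z)) * ennreal (\<bar>f (snd z)\<bar> powr q)) \<in> borel_measurable (borel \<Otimes>\<^sub>M borel)"
        by measurable
      then show "(\<lambda>(x, y). ennreal (P x y) * ennreal (\<bar>f y\<bar> powr q)) \<in> borel_measurable (lborel \<Otimes>\<^sub>M lborel)"
        by (simp add: split_beta' cong: measurable_cong_sets sets_pair_measure_cong)
    qed
    also have "\<dots> = (\<integral>\<^sup>+y. (\<integral>\<^sup>+x. ennreal (P x y) \<partial>lborel) * ennreal (\<bar>f y\<bar> powr q) \<partial>lborel)"
      by (simp add: nn_integral_multc)
    also have "\<dots> \<le> (\<integral>\<^sup>+y. ennreal M * ennreal (\<bar>f y\<bar> powr q) \<partial>lborel)"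
      by (intro nn_integral_mono mult_right_mono Px) auto
    also have "\<dots> = ennreal M * (\<integral>\<^sup>+y. ennreal (\<bar>f y\<bar> powr q) \<partial>lborel)"
      by (rule nn_integral_cmult) measurable
    finally have "(\<integral>\<^sup>+x. ennreal (\<bar>T x\<bar> powr q) \<partial>lborel) \<le>
        ennreal (M powr (q - 1)) * (ennreal M * (\<integral>\<^sup>+y. ennreal (\<bar>f y\<bar> powr q) \<partial>lborel))"
      by (simp add: mult_left_mono)
    also have "\<dots> = ennreal (M powr q) * (\<integral>\<^sup>+y. ennreal (\<bar>f y\<bar> powr q) \<partial>lborel)"
      using M by (simp add: mult.assoc[symmetric] ennreal_mult'[symmetric] powr_diff)
    finally have "ennpowr (\<integral>\<^sup>+x. ennreal (\<bar>T x\<bar> powr q) \<partial>lborel) (1 / q) \<le>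
        ennpowr (ennreal (M powr q) * (\<integral>\<^sup>+y. ennreal (\<bar>f y\<bar> powr q) \<partial>lborel)) (1 / q)"
      using q by (intro ennpowr_mono) auto
    also have "\<dots> = ennreal M * ennpowr (\<integral>\<^sup>+y. ennreal (\<bar>f y\<bar> powr q) \<partial>lborel) (1 / q)"
      using M q by (subst ennpowr_mult) (auto simp: powr_powr)
    finally show ?thesis
      using False by (simp add: Lp_norm_eq_nn_integral nn_integral_completion q_def)
  qed
qed

section \<open>Sequence spaces\<close>

text \<open>Membership in \<open>l^\<rho>\<close>, meant for nonnegative sequences; hence an upper
  bound suffices when \<open>\<rho>\<close> is infinite.\<close>

definition rho_summable :: "ennreal \<Rightarrow> (nat \<Rightarrow> real) \<Rightarrow> bool" where
  "rho_summable \<rho> c \<longleftrightarrow> (if \<rho> = top then \<exists>M. \<forall>n. c n \<le> M else summable (\<lambda>n. c n powr enn2real \<rho>))"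

lemma enn2real_pos: "0 < \<rho> \<Longrightarrow> \<rho> \<noteq> top \<Longrightarrow> 0 < enn2real \<rho>"
  by (simp add: enn2real_positive_iff less_top)

text \<open>Membership becomes the existence of a real majorant. Later proofs only transform
  \<open>c\<close>, and infinite values no longer occur in them.\<close>

lemma seq_space_iff:
  assumes "0 < \<rho>"
  shows "a \<in> seq_space \<rho> \<gamma> \<longleftrightarrow>
    (\<exists>c. (\<forall>n. 0 \<le> c n) \<and> rho_summable \<rho> c \<and> (\<forall>n. a n \<le> ennreal (2 powr (- \<gamma> * real n) * c n)))"
proof -
  let ?w = "\<lambda>n. 2 powr (\<gamma> * real n)" and ?v = "\<lambda>n. 2 powr (- \<gamma> * real n)"
  have wv: "?w n * ?v n = 1" for n by (simp flip: powr_add)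
  have le1: "ennreal (?w n) * a n \<le> ennreal c" if "a n \<le> ennreal (?v n * c)" "0 \<le> c" for n c
  proof -
    have "ennreal (?w n) * a n \<le> ennreal (?w n) * ennreal (?v n * c)" using that by (intro mult_left_mono) auto
    also have "\<dots> = ennreal (?w n * ?v n * c)" using that by (simp only: ennreal_mult'[symmetric] mult.assoc powr_ge_zero)
    finally show ?thesis by (simp only: wv mult_1_left)
  qed
  have le2: "a n \<le> ennreal (?v n * c)" if "ennreal (?w n) * a n \<le> ennreal c" "0 \<le> c" for n c
  proof -
    have "ennreal (?v n) * (ennreal (?w n) * a n) \<le> ennreal (?v n) * ennreal c" using that by (intro mult_left_mono) auto
    also have "ennreal (?v n) * (ennreal (?w n) * a n) = ennreal (?w n * ?v n) * a n"
      by (simp add: ennreal_mult' mult_ac)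
    also have "\<dots> = a n" by (simp only: wv ennreal_1 mult_1_left)
    finally show ?thesis using that by (simp only: ennreal_mult' powr_ge_zero)
  qed
  show ?thesis
  proof
    assume a: "a \<in> seq_space \<rho> \<gamma>"
    show "\<exists>c. (\<forall>n. 0 \<le> c n) \<and> rho_summable \<rho> c \<and> (\<forall>n. a n \<le> ennreal (?v n * c n))"
    proof (cases "\<rho> = top")
      case True
      then obtain M where M: "0 \<le> M" "(SUP n. ennreal (?w n) * a n) = ennreal M"
        using a by (cases "SUP n. ennreal (?w n) * a n") (auto simp: seq_space_def seq_norm_def)
      then have "a n \<le> ennreal (?v n * M)" for n
        by (intro le2) (auto simp flip: M(2) intro: SUP_upper)
      then show ?thesis using M True by (intro exI[of _ "\<lambda>n. M"]) (auto simp: rho_summable_def)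
    next
      case False
      define r where "r = enn2real \<rho>"
      have r: "0 < r" using enn2real_pos assms False by (simp add: r_def)
      let ?t = "\<lambda>n. ennpowr (ennreal (?w n) * a n) r"
      have fin: "(\<Sum>n. ?t n) < top"
        using a False by (simp add: seq_space_def seq_norm_def r_def ennpowr_less_top_iff[simplified])
      have tn: "ennreal (?w n) * a n < top" for n
      proof -
        have "sum ?t {n} \<le> suminf ?t" by (rule sum_le_suminf) auto
        then have "?t n < top" using fin by (simp add: order_le_less_trans)
        then show ?thesis using ennpowr_less_top_iff by simp
      qed
      define c where "c n = enn2real (ennreal (?w n) * a n)" for n
      have c: "0 \<le> c n" "ennreal (?w n) * a n = ennreal (c n)" for n
        using tn[of n] by (simp_all add: c_def)
      have "?t n = ennreal (c n powr r)" for n by (simp add: c ennpowr_def)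
      then have "(\<Sum>n. ennreal (c n powr r)) \<noteq> top" using fin by simp
      then have "summable (\<lambda>n. c n powr r)" by (intro summable_suminf_not_top) auto
      moreover have "a n \<le> ennreal (?v n * c n)" for n using c by (intro le2) auto
      ultimately show ?thesis using c False unfolding rho_summable_def r_def by auto
    qed
  next
    assume "\<exists>c. (\<forall>n. 0 \<le> c n) \<and> rho_summable \<rho> c \<and> (\<forall>n. a n \<le> ennreal (?v n * c n))"
    then obtain c where c: "\<And>n. 0 \<le> c n" "rho_summable \<rho> c" "\<And>n. a n \<le> ennreal (?v n * c n)" by blast
    have wa: "ennreal (?w n) * a n \<le> ennreal (c n)" for n using le1 c by blast
    show "a \<in> seq_space \<rho> \<gamma>"
    proof (cases "\<rho> = top")
      case True
      then obtain M where "\<And>n. c n \<le> M" using c by (auto simp: rho_summable_def)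
      then have "ennreal (?w n) * a n \<le> ennreal M" for n using wa order_trans ennreal_leI by blast
      then have "(SUP n. ennreal (?w n) * a n) \<le> ennreal M" by (intro SUP_least)
      then show ?thesis using True by (auto simp: seq_space_def seq_norm_def order_le_less_trans)
    next
      case False
      define r where "r = enn2real \<rho>"
      have r: "0 < r" using enn2real_pos assms False by (simp add: r_def)
      have s: "summable (\<lambda>n. c n powr r)" using c False by (simp add: rho_summable_def r_def)
      have "ennpowr (ennreal (?w n) * a n) r \<le> ennreal (c n powr r)" for n
        using ennpowr_mono[OF r wa[of n]] c(1)[of n] by (simp add: ennpowr_def)
      then have "(\<Sum>n. ennpowr (ennreal (?w n) * a n) r) \<le> (\<Sum>n. ennreal (c n powr r))"
        by (intro suminf_le) auto
      also have "\<dots> < top" using s by (subst suminf_ennreal2) auto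
      finally show ?thesis
        using False by (simp add: seq_space_def seq_norm_def r_def ennpowr_less_top_iff[simplified])
    qed
  qed
qed

lemma rho_summable_mono:
  assumes "rho_summable \<rho> c" "\<And>n. 0 \<le> d n" "\<And>n. d n \<le> c n"
  shows "rho_summable \<rho> d"
proof (cases "\<rho> = top")
  case True
  then obtain M where "\<And>n. c n \<le> M" using assms by (auto simp: rho_summable_def)
  then have "d n \<le> M" for n using assms(3) order_trans by blast
  then show ?thesis using True by (auto simp: rho_summable_def)
next
  case False
  have "summable (\<lambda>n. d n powr enn2real \<rho>)"
    by (rule summable_comparison_test'[where g = "\<lambda>n. c n powr enn2real \<rho>" and N = 0])
       (use assms False in \<open>auto simp: rho_summable_def intro!: powr_mono2\<close>)
  then show ?thesis using False by (simp add: rho_summable_def)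
qed

lemma rho_summable_cmult:
  assumes "rho_summable \<rho> c" "0 \<le> K" "\<And>n. 0 \<le> c n"
  shows "rho_summable \<rho> (\<lambda>n. K * c n)"
  using assms unfolding rho_summable_def
  by (auto simp: powr_mult intro: mult_left_mono summable_mult split: if_splits)

text \<open>For \<open>\<rho> < 1\<close> the triangle inequality fails; bounding the sum by twice
  the maximum works for every exponent at the price of \<open>2 powr r\<close>.\<close>

lemma rho_summable_add:
  assumes "0 < \<rho>" "rho_summable \<rho> c" "rho_summable \<rho> d" "\<And>n. 0 \<le> c n" "\<And>n. 0 \<le> d n"
  shows "rho_summable \<rho> (\<lambda>n. c n + d n)"
proof (cases "\<rho> = top")
  case True then show ?thesis using assms by (auto simp: rho_summable_def) (meson add_mono)
next
  case False
  define r where "r = enn2real \<rho>"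
  have r: "0 < r" using enn2real_pos assms False by (simp add: r_def)
  have "norm ((c n + d n) powr r) \<le> 2 powr r * (c n powr r + d n powr r)" for n
  proof -
    have "(c n + d n) powr r \<le> (2 * max (c n) (d n)) powr r" using assms r by (intro powr_mono2) auto
    also have "\<dots> = 2 powr r * max (c n) (d n) powr r" using assms by (simp add: powr_mult le_max_iff_disj)
    also have "max (c n) (d n) powr r \<le> c n powr r + d n powr r" by (simp add: max_def)
    finally show ?thesis by simp
  qed
  moreover have "summable (\<lambda>n. 2 powr r * (c n powr r + d n powr r))"
    using assms False by (intro summable_mult summable_add) (auto simp: rho_summable_def r_def)
  ultimately have "summable (\<lambda>n. (c n + d n) powr r)"
    using summable_comparison_test'[of "\<lambda>n. 2 powr r * (c n powr r + d n powr r)" 0 "\<lambda>n. (c n + d n) powr r"]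
    by blast
  then show ?thesis using False by (simp add: rho_summable_def r_def)
qed

lemma summable_powr_geometric: "0 < \<theta> \<Longrightarrow> summable (\<lambda>k. 2 powr (- \<theta> * real k))"
proof -
  assume "0 < \<theta>"
  then have "2 powr (- \<theta>) < 2 powr (0::real)" by (intro powr_less_mono) auto
  then have "norm (2 powr (- \<theta>)) < 1" by simp
  then have "summable (\<lambda>k. (2 powr (- \<theta>)) ^ k)" by (rule summable_geometric)
  moreover have "(2 powr (- \<theta>)) ^ k = 2 powr (- \<theta> * real k)" for k
    by (simp add: powr_realpow[symmetric] powr_powr)
  ultimately show ?thesis by simp
qed

lemma rho_summable_geometric:
  assumes "0 < \<rho>" "0 < \<theta>" shows "rho_summable \<rho> (\<lambda>n. 2 powr (- \<theta> * real n))"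
proof (cases "\<rho> = top")
  case True
  have "2 powr (- \<theta> * real n) \<le> 2 powr 0" for n using assms by (intro powr_mono) auto
  then show ?thesis using True by (auto simp: rho_summable_def)
next
  case False
  then have "0 < \<theta> * enn2real \<rho>" using enn2real_pos assms by simp
  from summable_powr_geometric[OF this] show ?thesis
    using False by (simp add: rho_summable_def powr_powr mult_ac)
qed

lemma rho_summable_Suc_iff: "rho_summable \<rho> (\<lambda>n. c (Suc n)) \<longleftrightarrow> rho_summable \<rho> c"
proof (cases "\<rho> = top")
  case True
  have "\<exists>M. \<forall>n. c n \<le> M" if "\<And>n. c (Suc n) \<le> M" for M
  proof (intro exI allI)
    fix n show "c n \<le> max (c 0) M" using that by (cases n) (auto simp: le_max_iff_disj)
  qed
  then show ?thesis using True by (auto simp: rho_summable_def)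
qed (simp add: rho_summable_def summable_Suc_iff[of "\<lambda>n. c n powr enn2real \<rho>"])

lemma rho_summable_bounded:
  assumes "0 < \<rho>" "rho_summable \<rho> c" "\<And>n. 0 \<le> c n" shows "\<exists>M\<ge>0. \<forall>n. c n \<le> M"
proof (cases "\<rho> = top")
  case True
  then obtain M where "\<And>n. c n \<le> M" using assms by (auto simp: rho_summable_def)
  moreover have "0 \<le> M" using assms(3)[of 0] calculation[of 0] by linarith
  ultimately show ?thesis by blast
next
  case False
  define r where "r = enn2real \<rho>"
  have r: "0 < r" using enn2real_pos assms False by (simp add: r_def)
  have s: "summable (\<lambda>n. c n powr r)" using assms False by (simp add: rho_summable_def r_def)
  have "c n \<le> (\<Sum>n. c n powr r) powr (1 / r)" for n
  proof -
    have "c n powr r \<le> (\<Sum>n. c n powr r)" using sum_le_suminf[OF s, of "{n}"] by auto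
    then have "(c n powr r) powr (1 / r) \<le> (\<Sum>n. c n powr r) powr (1 / r)" using r by (intro powr_mono2) auto
    then show ?thesis using r assms(3)[of n] by (simp add: powr_powr)
  qed
  then show ?thesis by (intro exI[of _ "(\<Sum>n. c n powr r) powr (1 / r)"]) auto
qed

text \<open>Hardy's inequality for all \<open>\<rho> > 0\<close> at once: half of the geometric decay bounds the sum by
  a supremum, and the supremum by an \<open>\<ell>\<^sup>\<rho>\<close> sum.\<close>

lemma rho_summable_tail:
  assumes \<rho>: "0 < \<rho>" and c: "rho_summable \<rho> c" "\<And>n. 0 \<le> c n" and \<theta>: "0 < \<theta>"
  shows "summable (\<lambda>k. 2 powr (- \<theta> * real k) * c (n + k))"
    and "rho_summable \<rho> (\<lambda>n. \<Sum>k. 2 powr (- \<theta> * real k) * c (n + k))"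
proof -
  obtain M where M: "0 \<le> M" "\<And>n. c n \<le> M" using rho_summable_bounded[OF \<rho> c] by blast
  have gsum: "summable (\<lambda>k. 2 powr (- \<theta> * real k) * M)" if "0 < \<theta>" for \<theta>
    using summable_powr_geometric[OF that] by (rule summable_mult2)
  have sm: "summable (\<lambda>k. 2 powr (- \<theta> * real k) * c (n + k))" if "0 < \<theta>" for \<theta> n
    by (rule summable_comparison_test'[OF gsum[OF that], of 0]) (use M c in \<open>auto intro!: mult_left_mono\<close>)
  then show "summable (\<lambda>k. 2 powr (- \<theta> * real k) * c (n + k))" using \<theta> .
  show "rho_summable \<rho> (\<lambda>n. \<Sum>k. 2 powr (- \<theta> * real k) * c (n + k))"
  proof (cases "\<rho> = top")
    case True
    have "(\<Sum>k. 2 powr (- \<theta> * real k) * c (n + k)) \<le> (\<Sum>k. 2 powr (- \<theta> * real k) * M)" for n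
      by (intro suminf_le sm gsum \<theta> mult_left_mono M) auto
    then show ?thesis using True by (auto simp: rho_summable_def)
  next
    case False
    define r where "r = enn2real \<rho>"
    have r: "0 < r" using enn2real_pos \<rho> False by (simp add: r_def)
    \<comment> \<open>Chosen so that the power \<open>1 / r\<close> of
      \<open>2 powr (- \<eta> * k)\<close> is \<open>2 powr (- (\<theta> / 2) * k)\<close>. The
      other half of the decay is kept for the sum over \<open>k\<close>.\<close>
    define \<eta> where "\<eta> = \<theta> / 2 * r"
    have \<eta>: "0 < \<eta>" using \<theta> r by (simp add: \<eta>_def)
    define d where "d n = c n powr r" for n
    have sd: "summable d" using c False unfolding d_def by (simp add: rho_summable_def r_def)
    have d0: "0 \<le> d n" for n by (simp add: d_def)
    have dM: "d n \<le> suminf d" for n using sum_le_suminf[OF sd, of "{n}"] d0 by auto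
    have D0: "0 \<le> suminf d" using d0 dM order_trans by blast
    have ssm: "summable (\<lambda>k. 2 powr (- \<eta> * real k) * d (n + k))" for n
      by (rule summable_comparison_test'[OF summable_mult2[OF summable_powr_geometric[OF \<eta>], of "suminf d"], of 0])
         (use dM d0 in \<open>auto intro!: mult_left_mono\<close>)
    define s where "s n = (\<Sum>k. 2 powr (- \<eta> * real k) * d (n + k))" for n
    have s0: "0 \<le> s n" for n unfolding s_def by (intro suminf_nonneg ssm) (auto simp: d0)
    have "summable s"
    proof (rule summableI_nonneg_bounded[OF s0])
      fix N
      \<comment> \<open>With the sums interchanged, for each \<open>k\<close> a shifted window of
        \<open>d\<close> contributes at most \<open>suminf d\<close>.\<close>
      have "(\<Sum>n<N. s n) = (\<Sum>k. \<Sum>n<N. 2 powr (- \<eta> * real k) * d (n + k))"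
        unfolding s_def by (rule suminf_sum[symmetric]) (rule ssm)
      also have "\<dots> \<le> (\<Sum>k. 2 powr (- \<eta> * real k) * suminf d)"
      proof (intro suminf_le summable_sum ssm summable_mult2 summable_powr_geometric \<eta>)
        fix k
        have "(\<Sum>n<N. d (n + k)) = (\<Sum>n\<in>{k..<N+k}. d n)"
          using sum.shift_bounds_nat_ivl[of d 0 k N] by (simp add: atLeast0LessThan)
        also have "\<dots> \<le> suminf d" by (intro sum_le_suminf sd) (auto simp: d0)
        finally have "(\<Sum>n<N. d (n + k)) \<le> suminf d" .
        then show "(\<Sum>n<N. 2 powr (- \<eta> * real k) * d (n + k)) \<le> 2 powr (- \<eta> * real k) * suminf d"
          unfolding sum_distrib_left[symmetric] by (intro mult_left_mono) auto
      qed
      finally show "(\<Sum>n<N. s n) \<le> (\<Sum>k. 2 powr (- \<eta> * real k) * suminf d)" .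
    qed
    define G where "G = (\<Sum>k. 2 powr (- (\<theta> / 2) * real k))"
    have sG: "summable (\<lambda>k. 2 powr (- (\<theta> / 2) * real k))" using \<theta> by (intro summable_powr_geometric) auto
    have G0: "0 \<le> G" unfolding G_def by (intro suminf_nonneg sG) auto
    \<comment> \<open>\<open>s n\<close> dominates each of its terms, so its root of order
      \<open>r\<close> bounds all \<open>2 powr (- (\<theta> / 2) * k) * c (n + k)\<close> at
      once.\<close>
    have main: "(\<Sum>k. 2 powr (- \<theta> * real k) * c (n + k)) \<le> G * s n powr (1 / r)" for n
    proof -
      have "2 powr (- \<theta> * real k) * c (n + k) \<le> 2 powr (- (\<theta> / 2) * real k) * s n powr (1 / r)" for k
      proof -
        have "2 powr (- \<eta> * real k) * d (n + k) \<le> s n"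
          unfolding s_def using sum_le_suminf[OF ssm, of "{k}" n] d0 by auto
        then have "(2 powr (- \<eta> * real k) * d (n + k)) powr (1 / r) \<le> s n powr (1 / r)"
          using r d0 by (intro powr_mono2) auto
        moreover have "(2 powr (- \<eta> * real k) * d (n + k)) powr (1 / r) = 2 powr (- (\<theta> / 2) * real k) * c (n + k)"
          using r c(2)[of "n + k"] by (simp add: d_def powr_mult powr_powr \<eta>_def)
        ultimately have "2 powr (- (\<theta> / 2) * real k) * (2 powr (- (\<theta> / 2) * real k) * c (n + k)) \<le>
            2 powr (- (\<theta> / 2) * real k) * s n powr (1 / r)"
          by (intro mult_left_mono) auto
        moreover have "2 powr (- (\<theta> / 2) * real k) * 2 powr (- (\<theta> / 2) * real k) = 2 powr (- \<theta> * real k)"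
          by (simp flip: powr_add)
        ultimately show ?thesis by (simp only: mult.assoc[symmetric])
      qed
      then have "(\<Sum>k. 2 powr (- \<theta> * real k) * c (n + k)) \<le> (\<Sum>k. 2 powr (- (\<theta> / 2) * real k) * s n powr (1 / r))"
        by (intro suminf_le sm \<theta> summable_mult2 sG)
      also have "\<dots> = G * s n powr (1 / r)" unfolding G_def by (rule suminf_mult2[symmetric, OF sG])
      finally show ?thesis .
    qed
    have "rho_summable \<rho> (\<lambda>n. s n powr (1 / r))"
      using False \<open>summable s\<close> r s0 by (simp add: rho_summable_def r_def[symmetric] powr_powr)
    then have "rho_summable \<rho> (\<lambda>n. G * s n powr (1 / r))"
      using G0 by (intro rho_summable_cmult) auto
    then show ?thesis
      by (rule rho_summable_mono) (use main sm[OF \<theta>] c in \<open>auto intro!: suminf_nonneg\<close>)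
  qed
qed

lemma powr_add_mult: "2 powr a * (2 powr b * c) = 2 powr (a + b) * c" for a b c :: real
  by (simp add: powr_add)

lemma seq_space_mono:
  assumes "0 < \<rho>" "a \<in> seq_space \<rho> \<gamma>" "0 \<le> K" "\<And>n. b n \<le> ennreal K * a n"
  shows "b \<in> seq_space \<rho> \<gamma>"
proof -
  obtain c where c: "\<And>n. 0 \<le> c n" "rho_summable \<rho> c" "\<And>n. a n \<le> ennreal (2 powr (- \<gamma> * real n) * c n)"
    using assms(2) unfolding seq_space_iff[OF assms(1)] by blast
  have "b n \<le> ennreal (2 powr (- \<gamma> * real n) * (K * c n))" for n
  proof -
    have "b n \<le> ennreal K * ennreal (2 powr (- \<gamma> * real n) * c n)"
      using assms(4)[of n] c(3)[of n] by (meson mult_left_mono order_trans zero_le)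
    then show ?thesis using assms(3) by (simp add: ennreal_mult'[symmetric] mult_ac)
  qed
  then show ?thesis unfolding seq_space_iff[OF assms(1)]
    using rho_summable_cmult[OF c(2) assms(3) c(1)] c(1) assms(3) by (intro exI[of _ "\<lambda>n. K * c n"]) auto
qed

lemma seq_space_add:
  assumes "0 < \<rho>" "a \<in> seq_space \<rho> \<gamma>" "b \<in> seq_space \<rho> \<gamma>"
  shows "(\<lambda>n. a n + b n) \<in> seq_space \<rho> \<gamma>"
proof -
  obtain c where c: "\<And>n. 0 \<le> c n" "rho_summable \<rho> c" "\<And>n. a n \<le> ennreal (2 powr (- \<gamma> * real n) * c n)"
    using assms(2) unfolding seq_space_iff[OF assms(1)] by blast
  obtain d where d: "\<And>n. 0 \<le> d n" "rho_summable \<rho> d" "\<And>n. b n \<le> ennreal (2 powr (- \<gamma> * real n) * d n)"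
    using assms(3) unfolding seq_space_iff[OF assms(1)] by blast
  have "a n + b n \<le> ennreal (2 powr (- \<gamma> * real n) * (c n + d n))" for n
    using add_mono[OF c(3)[of n] d(3)[of n]] c(1)[of n] d(1)[of n]
    by (simp add: distrib_left)
  then show ?thesis unfolding seq_space_iff[OF assms(1)]
    using rho_summable_add[OF assms(1) c(2) d(2) c(1) d(1)] c(1) d(1)
    by (intro exI[of _ "\<lambda>n. c n + d n"]) auto
qed

lemma seq_space_fast_decay:
  assumes "0 < \<rho>" "\<gamma> < s" "0 \<le> K" "\<And>n. a n \<le> ennreal (K * 2 powr (- s * real n))"
  shows "a \<in> seq_space \<rho> \<gamma>"
proof -
  have "K * 2 powr (- s * real n) = 2 powr (- \<gamma> * real n) * (K * 2 powr (- (s - \<gamma>) * real n))" for n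
    by (simp add: algebra_simps flip: powr_add)
  then have "a n \<le> ennreal (2 powr (- \<gamma> * real n) * (K * 2 powr (- (s - \<gamma>) * real n)))" for n
    using assms(4)[of n] by (simp only:)
  moreover have "rho_summable \<rho> (\<lambda>n. K * 2 powr (- (s - \<gamma>) * real n))"
    using assms by (intro rho_summable_cmult rho_summable_geometric) auto
  ultimately show ?thesis unfolding seq_space_iff[OF assms(1)]
    using assms(3) by (intro exI[of _ "\<lambda>n. K * 2 powr (- (s - \<gamma>) * real n)"]) auto
qed

text \<open>A shift of the index changes the weight by the constant factor
  \<open>2 powr \<gamma>\<close>; only the finiteness of the dropped entry has to be known.\<close>

lemma seq_space_Suc_iff:
  assumes "0 < \<rho>" "a 0 < \<infinity>"
  shows "(\<lambda>n. a (Suc n)) \<in> seq_space \<rho> \<gamma> \<longleftrightarrow> a \<in> seq_space \<rho> \<gamma>"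
proof
  assume "(\<lambda>n. a (Suc n)) \<in> seq_space \<rho> \<gamma>"
  then obtain c where c: "\<And>n. 0 \<le> c n" "rho_summable \<rho> c" "\<And>n. a (Suc n) \<le> ennreal (2 powr (- \<gamma> * real n) * c n)"
    unfolding seq_space_iff[OF assms(1)] by blast
  define d where "d n = (case n of 0 \<Rightarrow> enn2real (a 0) | Suc m \<Rightarrow> 2 powr \<gamma> * c m)" for n
  have "rho_summable \<rho> (\<lambda>n. d (Suc n))"
    unfolding d_def using c by (simp add: rho_summable_cmult)
  then have "rho_summable \<rho> d" by (simp only: rho_summable_Suc_iff)
  moreover have "0 \<le> d n" for n using c by (auto simp: d_def split: nat.split)
  moreover have "a n \<le> ennreal (2 powr (- \<gamma> * real n) * d n)" for n
  proof (cases n)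
    case (Suc m)
    have "2 powr (- \<gamma> * real n) * d n = 2 powr (- \<gamma> * real m) * c m"
      unfolding Suc d_def nat.case by (simp only: powr_add_mult) (simp add: algebra_simps)
    then show ?thesis using c(3)[of m] Suc by simp
  qed (use assms(2) in \<open>simp add: d_def\<close>)
  ultimately show "a \<in> seq_space \<rho> \<gamma>" unfolding seq_space_iff[OF assms(1)] by blast
next
  assume "a \<in> seq_space \<rho> \<gamma>"
  then obtain c where c: "\<And>n. 0 \<le> c n" "rho_summable \<rho> c" "\<And>n. a n \<le> ennreal (2 powr (- \<gamma> * real n) * c n)"
    unfolding seq_space_iff[OF assms(1)] by blast
  have "2 powr (- \<gamma> * real (Suc n)) * c (Suc n) = 2 powr (- \<gamma> * real n) * (2 powr (- \<gamma>) * c (Suc n))" for n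
    by (simp only: powr_add_mult) (simp add: algebra_simps)
  then have "a (Suc n) \<le> ennreal (2 powr (- \<gamma> * real n) * (2 powr (- \<gamma>) * c (Suc n)))" for n
    using c(3)[of "Suc n"] by (simp only:)
  moreover have "rho_summable \<rho> (\<lambda>n. 2 powr (- \<gamma>) * c (Suc n))"
    using c by (intro rho_summable_cmult) (auto simp: rho_summable_Suc_iff)
  ultimately show "(\<lambda>n. a (Suc n)) \<in> seq_space \<rho> \<gamma>"
    unfolding seq_space_iff[OF assms(1)] using c by (intro exI[of _ "\<lambda>n. 2 powr (- \<gamma>) * c (Suc n)"]) auto
qed

lemma seq_space_finite:
  assumes "0 < \<rho>" "a \<in> seq_space \<rho> \<gamma>" shows "a n < \<infinity>"
  using assms(2) unfolding seq_space_iff[OF assms(1)] by (auto intro: order_le_less_trans)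

text \<open>Measuring \<open>a (n + k)\<close> with the weight at \<open>n\<close> leaves a factor
  \<open>2 powr (- \<gamma> * k)\<close>; as \<open>\<gamma>\<close> is positive, this is the
  geometric decay asked for by \<open>rho_summable_tail\<close>.\<close>

lemma seq_space_tail:
  assumes "0 < \<rho>" "0 < \<gamma>" "a \<in> seq_space \<rho> \<gamma>"
  shows "(\<lambda>n. \<Sum>k. a (n + k)) \<in> seq_space \<rho> \<gamma>"
proof -
  obtain c where c: "\<And>n. 0 \<le> c n" "rho_summable \<rho> c" "\<And>n. a n \<le> ennreal (2 powr (- \<gamma> * real n) * c n)"
    using assms(3) unfolding seq_space_iff[OF assms(1)] by blast
  let ?d = "\<lambda>n. \<Sum>k. 2 powr (- \<gamma> * real k) * c (n + k)"
  note sm = rho_summable_tail[OF assms(1) c(2,1) assms(2)]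
  have *: "(\<Sum>k. a (n + k)) \<le> ennreal (2 powr (- \<gamma> * real n) * ?d n)" for n
  proof -
    have "(\<Sum>k. a (n + k)) \<le> (\<Sum>k. ennreal (2 powr (- \<gamma> * real n) * (2 powr (- \<gamma> * real k) * c (n + k))))"
    proof (intro suminf_le)
      fix k
      have "- \<gamma> * real n + - \<gamma> * real k = - \<gamma> * real (n + k)" by (simp add: algebra_simps)
      then show "a (n + k) \<le> ennreal (2 powr (- \<gamma> * real n) * (2 powr (- \<gamma> * real k) * c (n + k)))"
        using c(3)[of "n + k"] by (simp only: powr_add_mult)
    qed auto
    also have "\<dots> = ennreal (\<Sum>k. 2 powr (- \<gamma> * real n) * (2 powr (- \<gamma> * real k) * c (n + k)))"
      using c by (intro suminf_ennreal2 summable_mult sm) auto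
    also have "(\<Sum>k. 2 powr (- \<gamma> * real n) * (2 powr (- \<gamma> * real k) * c (n + k))) = 2 powr (- \<gamma> * real n) * ?d n"
      by (rule suminf_mult[OF sm(1)])
    finally show ?thesis .
  qed
  have "0 \<le> ?d n" for n using c by (intro suminf_nonneg sm) auto
  then show ?thesis
    unfolding seq_space_iff[OF assms(1)] by (intro exI[of _ ?d] conjI allI sm(2) *)
qed

section \<open>Matrix elements of multiplication operators\<close>

lemma hermite_square_le: "(hermite_fun j x)\<^sup>2 \<le> sqrt (2 * real (Suc j))"
proof -
  have "(he j x)\<^sup>2 / fact j \<le> (\<Sum>i\<le>j. (he i x)\<^sup>2 / fact i)"
    by (rule member_le_sum[of j "{..j}" "\<lambda>i. (he i x)\<^sup>2 / fact i"]) auto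
  also have "\<dots> \<le> sqrt (2 * real (Suc j))" by (rule christoffel_le)
  finally show ?thesis by (simp add: hermite_fun_eq power_divide)
qed

lemma hermite_le: "\<bar>hermite_fun j x\<bar> \<le> 2 * real (Suc j)"
proof (rule power2_le_imp_le)
  have "sqrt (2 * real (Suc j)) \<le> sqrt ((2 * real (Suc j))\<^sup>2)"
    by (intro real_sqrt_le_mono self_le_power) auto
  also have "\<dots> \<le> (2 * real (Suc j))\<^sup>2"
    unfolding real_sqrt_abs by (simp add: power2_eq_square)
  finally show "\<bar>hermite_fun j x\<bar>\<^sup>2 \<le> (2 * real (Suc j))\<^sup>2"
    using hermite_square_le[of j x] by simp
qed simp

lemma hermite_fun_Suc: "sqrt (real (Suc j)) * hermite_fun (Suc j) x = he (Suc j) x / sqrt (fact j)"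
proof -
  have "sqrt (fact (Suc j)) = sqrt (real (Suc j)) * sqrt (fact j)"
    by (simp only: fact_Suc real_sqrt_mult)
  moreover have "s * (t / (s * u)) = t / u" if "s \<noteq> 0" for s t u :: real
    using that by simp
  ultimately show ?thesis by (simp only: hermite_fun_eq) simp
qed

lemma hermite_recurrence:
  "sqrt 2 * x * hermite_fun j x = sqrt (real (Suc j)) * hermite_fun (Suc j) x + sqrt (real j) * hermite_fun (j - 1) x"
proof -
  have "sqrt 2 * x * hermite_fun j x = he (Suc j) x / sqrt (fact j) + real j * he (j - 1) x / sqrt (fact j)"
    using he_recurrence[of x j] by (simp add: hermite_fun_eq add_divide_distrib[symmetric])
  moreover have "real j * he (j - 1) x / sqrt (fact j) = sqrt (real j) * hermite_fun (j - 1) x"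
  proof (cases j)
    case (Suc i)
    have "sqrt (fact (Suc i)) = sqrt (real (Suc i)) * sqrt (fact i)"
      by (simp only: fact_Suc real_sqrt_mult)
    moreover have "(s * s) * t / (s * u) = s * (t / u)" for s t u :: real
      by simp
    from this[of "sqrt (real (Suc i))"]
    have "real (Suc i) * t / (sqrt (real (Suc i)) * u) = sqrt (real (Suc i)) * (t / u)" for t u
      by (simp only: real_sqrt_mult_self abs_of_nat)
    ultimately show ?thesis
      by (simp only: Suc hermite_fun_eq diff_Suc_1)
  qed simp
  ultimately show ?thesis by (simp only: hermite_fun_Suc)
qed

text \<open>The recurrence expresses the product with \<open>x\<close> by the neighbours of
  \<open>j\<close>, with coefficients at most \<open>j + 1\<close>; this raises the power by one.
  The upper neighbour contributes \<open>2 ^ m\<close> because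
  \<open>j + 2 \<le> 2 * (j + 1)\<close>.\<close>

lemma x_mult_hermite_le:
  assumes "\<And>j. \<bar>t * hermite_fun j x\<bar> \<le> K * real (Suc j) ^ m"
  shows "\<bar>x * t * hermite_fun j x\<bar> \<le> (2 ^ m + 1) * K * real (Suc j) ^ Suc m"
proof -
  have K: "0 \<le> K" using order_trans[OF abs_ge_zero assms[of 0]] by simp
  have s2: "1 \<le> sqrt (2::real)" by simp
  have sq: "sqrt (real (Suc j)) \<le> real (Suc j)" "sqrt (real j) \<le> real (Suc j)"
    by (auto intro!: real_le_lsqrt simp: power2_eq_square algebra_simps)
  have "\<bar>x * t * hermite_fun j x\<bar> \<le> sqrt 2 * \<bar>x * t * hermite_fun j x\<bar>"
    using mult_right_mono[OF s2, of "\<bar>x * t * hermite_fun j x\<bar>"] by simp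
  also have "\<dots> = \<bar>t * (sqrt 2 * x * hermite_fun j x)\<bar>" by (simp add: abs_mult)
  also have "t * (sqrt 2 * x * hermite_fun j x) =
      sqrt (real (Suc j)) * (t * hermite_fun (Suc j) x) + sqrt (real j) * (t * hermite_fun (j - 1) x)"
    unfolding hermite_recurrence by (simp add: algebra_simps)
  also have "\<bar>\<dots>\<bar> \<le> sqrt (real (Suc j)) * \<bar>t * hermite_fun (Suc j) x\<bar> + sqrt (real j) * \<bar>t * hermite_fun (j - 1) x\<bar>"
    by (rule order_trans[OF abs_triangle_ineq]) (simp add: abs_mult)
  also have "\<dots> \<le> real (Suc j) * (K * (2 * real (Suc j)) ^ m) + real (Suc j) * (K * real (Suc j) ^ m)"
  proof (intro add_mono mult_mono sq)
    have "\<bar>t * hermite_fun (Suc j) x\<bar> \<le> K * real (Suc (Suc j)) ^ m" by (rule assms)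
    also have "\<dots> \<le> K * (2 * real (Suc j)) ^ m" using K by (intro mult_left_mono power_mono) auto
    finally show "\<bar>t * hermite_fun (Suc j) x\<bar> \<le> K * (2 * real (Suc j)) ^ m" .
    have "\<bar>t * hermite_fun (j - 1) x\<bar> \<le> K * real (Suc (j - 1)) ^ m" by (rule assms)
    also have "\<dots> \<le> K * real (Suc j) ^ m" using K by (intro mult_left_mono power_mono) auto
    finally show "\<bar>t * hermite_fun (j - 1) x\<bar> \<le> K * real (Suc j) ^ m" .
  qed auto
  also have "\<dots> = (2 ^ m + 1) * K * real (Suc j) ^ Suc m"
    by (simp add: power_mult_distrib algebra_simps del: of_nat_Suc)
  finally show ?thesis .
qed

text \<open>Two multiplications by \<open>x\<close> turn the constant \<open>2\<close> into
  \<open>3 * 2 = 6\<close> and then \<open>5 * 6 = 30\<close>; the bound without a power of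
  \<open>x\<close> adds \<open>2\<close>.\<close>

lemma hermite_decay: "\<bar>hermite_fun j x\<bar> \<le> 32 * real (Suc j) ^ 3 / (1 + x\<^sup>2)"
proof -
  have 0: "\<bar>1 * hermite_fun j x\<bar> \<le> 2 * real (Suc j) ^ 1" for j using hermite_le[of j x] by simp
  have 1: "\<bar>x * hermite_fun j x\<bar> \<le> 6 * real (Suc j) ^ 2" for j
    using x_mult_hermite_le[OF 0, of j] by (simp add: numeral_2_eq_2)
  have 2: "\<bar>x * x * hermite_fun j x\<bar> \<le> 30 * real (Suc j) ^ 3"
    using x_mult_hermite_le[OF 1, of j] by (simp add: numeral_3_eq_3 numeral_2_eq_2)
  have "real (Suc j) ^ 1 \<le> real (Suc j) ^ 3" by (intro power_increasing) auto
  with 0[of j] have "\<bar>hermite_fun j x\<bar> \<le> 2 * real (Suc j) ^ 3" by simp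
  with 2 have "\<bar>hermite_fun j x\<bar> + \<bar>x * x * hermite_fun j x\<bar> \<le> 32 * real (Suc j) ^ 3" by simp
  moreover have "\<bar>hermite_fun j x\<bar> + \<bar>x * x * hermite_fun j x\<bar> = \<bar>hermite_fun j x\<bar> * (1 + x\<^sup>2)"
    by (simp add: abs_mult power2_eq_square algebra_simps)
  ultimately show ?thesis by (simp add: pos_le_divide_eq)
qed

definition hermite_deriv :: "nat \<Rightarrow> real \<Rightarrow> real" where
  "hermite_deriv j x = x * hermite_fun j x - sqrt 2 * sqrt (real (Suc j)) * hermite_fun (Suc j) x"

lemma hermite_has_derivative: "(hermite_fun j has_real_derivative hermite_deriv j x) (at x)"
proof -
  have "hermite_fun j = (\<lambda>x. he j x / sqrt (fact j))" by (simp add: fun_eq_iff hermite_fun_eq)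
  moreover have "(x * he j x - sqrt 2 * he (Suc j) x) / sqrt (fact j) = hermite_deriv j x"
    unfolding hermite_deriv_def mult.assoc hermite_fun_Suc by (simp add: hermite_fun_eq diff_divide_distrib)
  ultimately show ?thesis
    using DERIV_cdivide[OF he_has_derivative[of j x], of "sqrt (fact j)"] by simp
qed

lemma hermite_has_derivative':
  "(hermite_fun (Suc j) has_real_derivative sqrt 2 * sqrt (real (Suc j)) * hermite_fun j x - x * hermite_fun (Suc j) x) (at x)"
proof -
  have "sqrt 2 * (sqrt 2 * x * hermite_fun (Suc j) x) =
      sqrt 2 * (sqrt (real (Suc (Suc j))) * hermite_fun (Suc (Suc j)) x + sqrt (real (Suc j)) * hermite_fun j x)"
    unfolding hermite_recurrence by simp
  then have "hermite_deriv (Suc j) x = sqrt 2 * sqrt (real (Suc j)) * hermite_fun j x - x * hermite_fun (Suc j) x"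
    by (simp add: hermite_deriv_def distrib_left mult.assoc[symmetric] del: of_nat_Suc)
  then show ?thesis using hermite_has_derivative[of "Suc j" x] by (simp only:)
qed

text \<open>The Hermite equation, with eigenvalue \<open>2 * j + 1\<close>; it follows by applying
  the creation form and then the annihilation form of the derivative.\<close>

lemma hermite_deriv_has_derivative:
  "(hermite_deriv j has_real_derivative (x\<^sup>2 - real (2 * j + 1)) * hermite_fun j x) (at x)"
proof -
  let ?s = "sqrt 2 * sqrt (real (Suc j))"
  have s: "?s * ?s = 2 * real (Suc j)"
    by (simp add: real_sqrt_mult_self mult_ac mult.assoc[symmetric] del: of_nat_Suc)
  have "(hermite_deriv j has_real_derivative
    (1 * hermite_fun j x + hermite_deriv j x * x) - ?s * (?s * hermite_fun j x - x * hermite_fun (Suc j) x)) (at x)"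
    unfolding hermite_deriv_def[of j, abs_def]
    by (intro DERIV_diff DERIV_mult DERIV_ident DERIV_cmult hermite_has_derivative'
        hermite_has_derivative[unfolded hermite_deriv_def[abs_def]])
  moreover have "(1 * hermite_fun j x + hermite_deriv j x * x) - ?s * (?s * hermite_fun j x - x * hermite_fun (Suc j) x)
    = x\<^sup>2 * hermite_fun j x + hermite_fun j x - (?s * ?s) * hermite_fun j x"
    by (simp add: hermite_deriv_def power2_eq_square algebra_simps)
  ultimately show ?thesis
    unfolding s by (simp add: algebra_simps)
qed

lemma isCont_hermite [continuous_intros]: "isCont (hermite_fun j) x" "isCont (hermite_deriv j) x"
  using DERIV_isCont[OF hermite_has_derivative] DERIV_isCont[OF hermite_deriv_has_derivative] by auto

lemma borel_measurable_hermite [measurable]: "hermite_fun j \<in> borel_measurable borel"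
  by (intro borel_measurable_continuous_onI continuous_at_imp_continuous_on) (simp add: isCont_hermite)

section \<open>Commutators with the Hermite operator\<close>

definition test_fun :: "real \<Rightarrow> (real \<Rightarrow> real) \<Rightarrow> bool" where
  "test_fun R u \<longleftrightarrow> smooth u \<and> (\<forall>x. R < \<bar>x\<bar> \<longrightarrow> u x = 0)"

lemma test_fun_deriv: "test_fun R u \<Longrightarrow> test_fun R (deriv u)"
  using deriv_pow_zero_outside[of R u _ 1] by (auto simp: test_fun_def smooth_deriv)

lemma test_fun_mult: "test_fun R u \<Longrightarrow> smooth v \<Longrightarrow> test_fun R (\<lambda>x. v x * u x)"
  by (auto simp: test_fun_def smooth_mult)

lemma integrable_compact_support:
  fixes f :: "real \<Rightarrow> real"
  assumes "\<And>x. isCont f x" "\<And>x. R < \<bar>x\<bar> \<Longrightarrow> f x = 0"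
  shows "integrable lborel f"
proof -
  have "integrable lborel (\<lambda>x. indicator {-R..R} x *\<^sub>R f x)"
    using assms(1) by (intro borel_integrable_compact continuous_at_imp_continuous_on) auto
  moreover have "(\<lambda>x. indicator {-R..R} x *\<^sub>R f x) = f"
  proof
    show "indicator {-R..R} x *\<^sub>R f x = f x" for x
      by (cases "R < \<bar>x\<bar>") (auto simp: assms(2) indicator_def)
  qed
  ultimately show ?thesis by (simp only:)
qed

lemma integral_deriv_compact_support:
  fixes F :: "real \<Rightarrow> real"
  assumes "\<And>x. (F has_real_derivative F' x) (at x)" "\<And>x. isCont F' x"
    and "\<And>x. R < \<bar>x\<bar> \<Longrightarrow> F x = 0" "\<And>x. R < \<bar>x\<bar> \<Longrightarrow> F' x = 0"
  shows "(\<integral>x. F' x \<partial>lborel) = 0"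
proof (rule integral_deriv_eq_0[OF assms(1,2)])
  show "integrable lborel F'" using assms by (intro integrable_compact_support)
  have "\<forall>\<^sub>F x in at_top. F x = 0"
    using eventually_gt_at_top[of "\<bar>R\<bar>"] by eventually_elim (auto intro: assms)
  then show "(F \<longlongrightarrow> 0) at_top" by (rule tendsto_eventually)
  have "\<forall>\<^sub>F x in at_bot. F x = 0"
    using eventually_gt_at_bot[of "- \<bar>R\<bar>"] eventually_le_at_bot[of "- \<bar>R\<bar> - 1"]
    by eventually_elim (auto intro: assms)
  then show "(F \<longlongrightarrow> 0) at_bot" by (rule tendsto_eventually)
qed

definition mel :: "(real \<Rightarrow> real) \<Rightarrow> nat \<Rightarrow> nat \<Rightarrow> real" where
  "mel u i j = (\<integral>x. u x * hermite_fun i x * hermite_fun j x \<partial>lborel)"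

text \<open>Commuting the Hermite operator with a multiplication operator leaves a first order term,
  so these elements must be estimated along with \<open>mel\<close>.\<close>

definition mel' :: "(real \<Rightarrow> real) \<Rightarrow> nat \<Rightarrow> nat \<Rightarrow> real" where
  "mel' u i j = (\<integral>x. u x * hermite_deriv i x * hermite_fun j x \<partial>lborel)"

lemma mel_integrable:
  assumes "test_fun R u"
  shows "integrable lborel (\<lambda>x. u x * hermite_fun i x * hermite_fun j x)"
    "integrable lborel (\<lambda>x. u x * hermite_deriv i x * hermite_fun j x)"
proof -
  have "isCont u x" for x using assms by (auto simp: test_fun_def intro: smooth_isCont)
  then show "integrable lborel (\<lambda>x. u x * hermite_fun i x * hermite_fun j x)"
    "integrable lborel (\<lambda>x. u x * hermite_deriv i x * hermite_fun j x)"
    using assms by (auto simp: test_fun_def intro!: integrable_compact_support[of _ R] continuous_intros)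
qed

text \<open>The two identities express the commutators of the Hermite operator \<open>x\<^sup>2 - d\<^sup>2/dx\<^sup>2\<close> with
  multiplication operators and with first order operators.\<close>

lemma mel_commutator:
  assumes u: "test_fun R u"
  shows "real (2 * j) * mel u i j - real (2 * i) * mel u i j = - 2 * mel' (deriv u) i j - mel (deriv (deriv u)) i j"
proof -
  let ?p = "hermite_fun i" and ?q = "hermite_fun j" and ?p' = "hermite_deriv i" and ?q' = "hermite_deriv j"
  \<comment> \<open>The first part is \<open>u\<close> times a Wronskian, whose derivative is the
    difference of the eigenvalues times the product. The second part cancels the terms with
    \<open>deriv u\<close> and the derivative on index \<open>j\<close>, so that only
    \<open>mel\<close> and \<open>mel'\<close> remain.\<close>
  define F where "F x = u x * (?p' x * ?q x - ?p x * ?q' x) + deriv u x * (?p x * ?q x)" for x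
  define F' where "F' x = 2 * (deriv u x * ?p' x * ?q x) + deriv (deriv u) x * ?p x * ?q x
     + (real (2 * j) - real (2 * i)) * (u x * ?p x * ?q x)" for x
  note u' = test_fun_deriv[OF u] and u'' = test_fun_deriv[OF test_fun_deriv[OF u]]
  have su: "smooth u" "smooth (deriv u)" "smooth (deriv (deriv u))" using u u' u'' by (auto simp: test_fun_def)
  have D: "(F has_real_derivative F' x) (at x)" for x
  proof -
    have "(F has_real_derivative
      (deriv u x * (?p' x * ?q x - ?p x * ?q' x) +
        (((x\<^sup>2 - real (2 * i + 1)) * ?p x * ?q x + ?q' x * ?p' x) - (?p' x * ?q' x + ((x\<^sup>2 - real (2 * j + 1)) * ?q x) * ?p x)) * u x)
      + (deriv (deriv u) x * (?p x * ?q x) + (?p' x * ?q x + ?q' x * ?p x) * deriv u x)) (at x)"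
      unfolding F_def[abs_def]
      by (intro DERIV_add DERIV_diff DERIV_mult smooth_has_derivative su hermite_has_derivative hermite_deriv_has_derivative)
    then show ?thesis by (rule DERIV_cong) (simp add: F'_def algebra_simps)
  qed
  have "(\<integral>x. F' x \<partial>lborel) = 0"
  proof (rule integral_deriv_compact_support[OF D])
    show "isCont F' x" for x
      unfolding F'_def[abs_def] by (intro continuous_intros smooth_isCont su)
    show "F x = 0" "F' x = 0" if "R < \<bar>x\<bar>" for x
      using that u u' u'' by (auto simp: F_def F'_def test_fun_def)
  qed
  moreover have "(\<integral>x. F' x \<partial>lborel) = 2 * mel' (deriv u) i j + mel (deriv (deriv u)) i j + (real (2 * j) - real (2 * i)) * mel u i j"
    unfolding F'_def mel_def mel'_def
    using mel_integrable[OF u] mel_integrable[OF u'] mel_integrable[OF u''] by simp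
  ultimately show ?thesis by (simp add: left_diff_distrib)
qed

lemma mel'_commutator:
  assumes u: "test_fun R u"
  shows "real (2 * j) * mel' u i j - real (2 * i) * mel' u i j =
    - 2 * mel (\<lambda>x. x\<^sup>2 * deriv u x) i j + 2 * real (2 * i + 1) * mel (deriv u) i j
    - mel' (deriv (deriv u)) i j - 2 * mel (\<lambda>x. x * u x) i j"
proof -
  let ?p = "hermite_fun i" and ?q = "hermite_fun j" and ?p' = "hermite_deriv i" and ?q' = "hermite_deriv j"
  let ?l = "real (2 * i + 1)"
  \<comment> \<open>The Wronskian construction for \<open>hermite_deriv i\<close> and
    \<open>hermite_fun j\<close>, the second derivative being written by the Hermite equation.
    Differentiating the potential \<open>x^2\<close> produces the extra term with
    \<open>x * u x\<close>.\<close>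
  define F where "F x = u x * (((x\<^sup>2 - ?l) * ?p x) * ?q x - ?p' x * ?q' x) + deriv u x * (?p' x * ?q x)" for x
  define F' where "F' x = 2 * (x\<^sup>2 * deriv u x * ?p x * ?q x) - 2 * ?l * (deriv u x * ?p x * ?q x)
     + deriv (deriv u) x * ?p' x * ?q x
     + (real (2 * j) - real (2 * i)) * (u x * ?p' x * ?q x) + 2 * (x * u x * ?p x * ?q x)" for x
  note u' = test_fun_deriv[OF u] and u'' = test_fun_deriv[OF test_fun_deriv[OF u]]
  have xu: "test_fun R (\<lambda>x. x\<^sup>2 * deriv u x)" "test_fun R (\<lambda>x. x * u x)"
    by (intro test_fun_mult u' smooth_power smooth_ident) (intro test_fun_mult u smooth_ident)
  have su: "smooth u" "smooth (deriv u)" "smooth (deriv (deriv u))" using u u' u'' by (auto simp: test_fun_def)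
  have D: "(F has_real_derivative F' x) (at x)" for x
  proof -
    have D2: "((\<lambda>x. x\<^sup>2 - ?l) has_real_derivative 2 * x) (at x)"
      by (auto intro!: derivative_eq_intros)
    have "(F has_real_derivative
      (deriv u x * (((x\<^sup>2 - ?l) * ?p x) * ?q x - ?p' x * ?q' x) +
        (((2 * x * ?p x + ?p' x * (x\<^sup>2 - ?l)) * ?q x + ?q' x * ((x\<^sup>2 - ?l) * ?p x))
          - ((x\<^sup>2 - real (2 * i + 1)) * ?p x * ?q' x + ((x\<^sup>2 - real (2 * j + 1)) * ?q x) * ?p' x)) * u x)
      + (deriv (deriv u) x * (?p' x * ?q x) + ((x\<^sup>2 - real (2 * i + 1)) * ?p x * ?q x + ?q' x * ?p' x) * deriv u x)) (at x)"
      unfolding F_def[abs_def]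
      by (intro DERIV_add[where 'a = real] DERIV_diff[where f = "\<lambda>x. (x\<^sup>2 - ?l) * ?p x * ?q x"] DERIV_mult smooth_has_derivative su hermite_has_derivative hermite_deriv_has_derivative D2)
    then show ?thesis by (rule DERIV_cong) (simp add: F'_def algebra_simps)
  qed
  have "(\<integral>x. F' x \<partial>lborel) = 0"
  proof (rule integral_deriv_compact_support[OF D])
    show "isCont F' x" for x
      unfolding F'_def[abs_def] by (intro continuous_intros smooth_isCont su)
    show "F x = 0" "F' x = 0" if "R < \<bar>x\<bar>" for x
      using that u u' u'' by (auto simp: F_def F'_def test_fun_def)
  qed
  moreover have "(\<integral>x. F' x \<partial>lborel) = 2 * mel (\<lambda>x. x\<^sup>2 * deriv u x) i j - 2 * ?l * mel (deriv u) i j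
      + mel' (deriv (deriv u)) i j + (real (2 * j) - real (2 * i)) * mel' u i j + 2 * mel (\<lambda>x. x * u x) i j"
    unfolding F'_def mel_def mel'_def
    using mel_integrable[OF u] mel_integrable[OF u'] mel_integrable[OF u''] mel_integrable[OF xu(1)] mel_integrable[OF xu(2)]
    by simp
  ultimately show ?thesis by (simp add: left_diff_distrib)
qed

lemma hermite_deriv_le:
  assumes "\<bar>x\<bar> \<le> R"
  shows "\<bar>hermite_deriv j x\<bar> \<le> (2 * R + 8) * sqrt (real (2 * j + 1)) * real (Suc j)"
proof -
  let ?l = "sqrt (real (2 * j + 1))"
  have l: "1 \<le> ?l" by simp
  have R: "0 \<le> R" using assms by linarith
  have s: "sqrt 2 * sqrt (real (Suc j)) \<le> 2 * ?l"
  proof -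
    have "sqrt 2 * sqrt (real (Suc j)) = sqrt (2 * real (Suc j))" by (simp only: real_sqrt_mult)
    also have "\<dots> \<le> sqrt (4 * real (2 * j + 1))" by (intro real_sqrt_le_mono) auto
    also have "\<dots> = 2 * ?l" by (simp only: real_sqrt_mult real_sqrt_four)
    finally show ?thesis .
  qed
  have "\<bar>hermite_deriv j x\<bar> \<le> \<bar>x\<bar> * \<bar>hermite_fun j x\<bar> + (sqrt 2 * sqrt (real (Suc j))) * \<bar>hermite_fun (Suc j) x\<bar>"
    unfolding hermite_deriv_def by (rule order_trans[OF abs_triangle_ineq4]) (simp add: abs_mult)
  also have "\<dots> \<le> R * (2 * real (Suc j)) + (2 * ?l) * (2 * real (Suc (Suc j)))"
    using R by (intro add_mono mult_mono assms hermite_le s) auto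
  also have "\<dots> \<le> (R * ?l) * (2 * real (Suc j)) + (2 * ?l) * (2 * (2 * real (Suc j)))"
    using R l mult_left_mono[OF l R] by (intro add_mono mult_mono) auto
  also have "\<dots> = (2 * R + 8) * ?l * real (Suc j)" by (simp add: algebra_simps)
  finally show ?thesis .
qed

lemma integral_compact_support_le:
  fixes f :: "real \<Rightarrow> real"
  assumes "\<And>x. isCont f x" "\<And>x. R < \<bar>x\<bar> \<Longrightarrow> f x = 0" "\<And>x. \<bar>x\<bar> \<le> R \<Longrightarrow> \<bar>f x\<bar> \<le> K" "0 \<le> R" "0 \<le> K"
  shows "\<bar>\<integral>x. f x \<partial>lborel\<bar> \<le> 2 * R * K"
proof -
  have "\<bar>\<integral>x. f x \<partial>lborel\<bar> \<le> (\<integral>x. \<bar>f x\<bar> \<partial>lborel)" by (rule integral_abs_bound)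
  also have "\<dots> \<le> (\<integral>x. K * indicator {-R..R} x \<partial>lborel)"
  proof (rule integral_mono)
    show "integrable lborel (\<lambda>x. \<bar>f x\<bar>)"
      using integrable_compact_support[OF assms(1,2)] by (rule integrable_abs)
    show "\<bar>f x\<bar> \<le> K * indicator {-R..R} x" for x
      using assms(2,3)[of x] by (auto simp: indicator_def)
  qed (auto simp: emeasure_lborel_Icc_eq)
  also have "\<dots> = 2 * R * K" using assms(4) by (simp add: mult.commute)
  finally show ?thesis .
qed

text \<open>A derivative of \<open>hermite_fun i\<close> costs about
  \<open>sqrt (2 * i + 1)\<close>, hence the extra factor in the bound for \<open>mel'\<close>.
  Dividing a commutator identity by the difference of the eigenvalues gains one factor of the stated
  ratio. As the identities couple \<open>mel\<close> and \<open>mel'\<close>, both bounds are proved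
  together for all test functions.\<close>

lemma mel_decay:
  assumes "test_fun R u" and R: "0 \<le> R"
  shows "\<exists>C\<ge>0. \<forall>i j. i < j \<longrightarrow>
    \<bar>mel u i j\<bar> \<le> C * (real (Suc i) * real (Suc j)) * (sqrt (real (2 * i + 1)) / (real (2 * j) - real (2 * i))) ^ k \<and>
    \<bar>mel' u i j\<bar> \<le> C * sqrt (real (2 * i + 1)) * (real (Suc i) * real (Suc j)) * (sqrt (real (2 * i + 1)) / (real (2 * j) - real (2 * i))) ^ k"
  using assms(1)
proof (induction k arbitrary: u)
  case 0
  obtain M where M: "0 \<le> M" "\<And>x. \<bar>u x\<bar> \<le> M"
    using smooth_compact_bounded[of u R] 0 by (auto simp: test_fun_def)
  have cont: "isCont u x" for x using 0 by (auto simp: test_fun_def intro: smooth_isCont)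
  have z: "u x = 0" if "R < \<bar>x\<bar>" for x using 0 that by (auto simp: test_fun_def)
  \<comment> \<open>The factor \<open>2 * (2 * R + 8)\<close> is the one \<open>mel'\<close> needs;
    it exceeds the \<open>4\<close> needed for \<open>mel\<close>.\<close>
  define C where "C = 2 * R * M * (2 * (2 * R + 8))"
  have "\<bar>mel u i j\<bar> \<le> C * (real (Suc i) * real (Suc j))" for i j
  proof -
    have "\<bar>mel u i j\<bar> \<le> 2 * R * (M * (2 * real (Suc i)) * (2 * real (Suc j)))"
      unfolding mel_def
    proof (rule integral_compact_support_le)
      show "\<bar>u x * hermite_fun i x * hermite_fun j x\<bar> \<le> M * (2 * real (Suc i)) * (2 * real (Suc j))" for x
        unfolding abs_mult using M by (intro mult_mono hermite_le) auto
    qed (use M R z in \<open>auto intro!: continuous_intros cont\<close>)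
    also have "\<dots> = 2 * R * M * 4 * (real (Suc i) * real (Suc j))" by (simp del: of_nat_Suc)
    also have "\<dots> \<le> C * (real (Suc i) * real (Suc j))"
      unfolding C_def using M R by (intro mult_right_mono mult_left_mono) auto
    finally show ?thesis .
  qed
  moreover have "\<bar>mel' u i j\<bar> \<le> C * sqrt (real (2 * i + 1)) * (real (Suc i) * real (Suc j))" for i j
  proof -
    have "\<bar>mel' u i j\<bar> \<le> 2 * R * (M * ((2 * R + 8) * sqrt (real (2 * i + 1)) * real (Suc i)) * (2 * real (Suc j)))"
      unfolding mel'_def
    proof (rule integral_compact_support_le)
      show "\<bar>u x * hermite_deriv i x * hermite_fun j x\<bar> \<le>
          M * ((2 * R + 8) * sqrt (real (2 * i + 1)) * real (Suc i)) * (2 * real (Suc j))" if "\<bar>x\<bar> \<le> R" for x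
        unfolding abs_mult using M R that by (intro mult_mono hermite_le hermite_deriv_le) auto
    qed (use M R z in \<open>auto intro!: continuous_intros cont\<close>)
    also have "\<dots> = C * sqrt (real (2 * i + 1)) * (real (Suc i) * real (Suc j))"
      by (simp add: C_def del: of_nat_Suc)
    finally show ?thesis .
  qed
  moreover have "0 \<le> C" using M R by (simp add: C_def)
  ultimately show ?case by (intro exI[of _ C]) simp
next
  case (Suc k)
  let ?l = "\<lambda>i. sqrt (real (2 * i + 1))" and ?d = "\<lambda>i j. real (2 * j) - real (2 * i)"
  let ?P = "\<lambda>i j. real (Suc i) * real (Suc j)"
  let ?r = "\<lambda>i j. ?l i / ?d i j"
  note u = Suc.prems and u' = test_fun_deriv[OF Suc.prems] and u'' = test_fun_deriv[OF test_fun_deriv[OF Suc.prems]]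
  have x2u: "test_fun R (\<lambda>x. x\<^sup>2 * deriv u x)" by (intro test_fun_mult u' smooth_power smooth_ident)
  have xu: "test_fun R (\<lambda>x. x * u x)" by (intro test_fun_mult u smooth_ident)
  obtain A where A: "A \<ge> 0" "\<And>i j. i < j \<Longrightarrow> \<bar>mel (deriv u) i j\<bar> \<le> A * ?P i j * ?r i j ^ k"
      "\<And>i j. i < j \<Longrightarrow> \<bar>mel' (deriv u) i j\<bar> \<le> A * ?l i * ?P i j * ?r i j ^ k"
    using Suc.IH[OF u'] by blast
  obtain B where B: "B \<ge> 0" "\<And>i j. i < j \<Longrightarrow> \<bar>mel (deriv (deriv u)) i j\<bar> \<le> B * ?P i j * ?r i j ^ k"
      "\<And>i j. i < j \<Longrightarrow> \<bar>mel' (deriv (deriv u)) i j\<bar> \<le> B * ?l i * ?P i j * ?r i j ^ k"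
    using Suc.IH[OF u''] by blast
  obtain D where D: "D \<ge> 0" "\<And>i j. i < j \<Longrightarrow> \<bar>mel (\<lambda>x. x\<^sup>2 * deriv u x) i j\<bar> \<le> D * ?P i j * ?r i j ^ k"
    using Suc.IH[OF x2u] by blast
  obtain E where E: "E \<ge> 0" "\<And>i j. i < j \<Longrightarrow> \<bar>mel (\<lambda>x. x * u x) i j\<bar> \<le> E * ?P i j * ?r i j ^ k"
    using Suc.IH[OF xu] by blast
  \<comment> \<open>The sum of the coefficients that arise from \<open>mel'_commutator\<close>; it
    exceeds the \<open>2 * A + B\<close> needed for \<open>mel\<close>.\<close>
  define C where "C = 2 * A + B + 2 * D + 2 * E"
  have C: "C \<ge> 0" using A B D E by (simp add: C_def)
  show ?case
  proof (intro exI[of _ C] conjI C allI impI)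
    fix i j :: nat assume ij: "i < j"
    have d: "0 < ?d i j" using ij by simp
    have l: "1 \<le> ?l i" by simp
    have ll: "?l i * ?l i = real (2 * i + 1)" by (simp only: real_sqrt_mult_self abs_of_nat)
    have l2: "?l i \<le> real (2 * i + 1)" "1 \<le> real (2 * i + 1)" using mult_right_mono[OF l, of "?l i"] ll by auto
    define T where "T = ?P i j * ?r i j ^ k"
    have T: "0 \<le> T" using d by (simp add: T_def)
    have TT: "T * (?l i / ?d i j) = ?P i j * ?r i j ^ Suc k" by (simp add: T_def)
    have b: "\<bar>mel (deriv u) i j\<bar> \<le> A * T" "\<bar>mel' (deriv u) i j\<bar> \<le> A * ?l i * T"
      "\<bar>mel (deriv (deriv u)) i j\<bar> \<le> B * T" "\<bar>mel' (deriv (deriv u)) i j\<bar> \<le> B * ?l i * T"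
      "\<bar>mel (\<lambda>x. x\<^sup>2 * deriv u x) i j\<bar> \<le> D * T" "\<bar>mel (\<lambda>x. x * u x) i j\<bar> \<le> E * T"
      using A(2,3)[OF ij] B(2,3)[OF ij] D(2)[OF ij] E(2)[OF ij] by (simp_all only: T_def mult.assoc)
    have "?d i j * \<bar>mel u i j\<bar> = \<bar>- 2 * mel' (deriv u) i j - mel (deriv (deriv u)) i j\<bar>"
      unfolding mel_commutator[OF u, of j i, symmetric] left_diff_distrib[symmetric] abs_mult abs_of_pos[OF d] ..
    also have "\<dots> \<le> 2 * (A * ?l i * T) + B * T" using b(2,3) by linarith
    also have "\<dots> \<le> 2 * (A * ?l i * T) + B * ?l i * T"
      using B(1) T l mult_left_mono[OF l B(1)] by (intro add_left_mono mult_right_mono) auto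
    also have "\<dots> = (2 * A + B) * ?l i * T" by (simp add: algebra_simps)
    also have "\<dots> \<le> C * ?l i * T"
      using T l D E by (intro mult_right_mono) (auto simp: C_def)
    finally have "\<bar>mel u i j\<bar> \<le> C * (T * (?l i / ?d i j))"
      using d by (simp add: pos_le_divide_eq mult_ac)
    then show "\<bar>mel u i j\<bar> \<le> C * ?P i j * ?r i j ^ Suc k" unfolding TT by (simp only: mult.assoc)
    have "?d i j * \<bar>mel' u i j\<bar> = \<bar>- 2 * mel (\<lambda>x. x\<^sup>2 * deriv u x) i j + 2 * real (2 * i + 1) * mel (deriv u) i j
    - mel' (deriv (deriv u)) i j - 2 * mel (\<lambda>x. x * u x) i j\<bar>"
      unfolding mel'_commutator[OF u, of j i, symmetric] left_diff_distrib[symmetric] abs_mult abs_of_pos[OF d] ..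
    also have "\<dots> \<le> 2 * \<bar>mel (\<lambda>x. x\<^sup>2 * deriv u x) i j\<bar> + \<bar>2 * real (2 * i + 1) * mel (deriv u) i j\<bar>
      + \<bar>mel' (deriv (deriv u)) i j\<bar> + 2 * \<bar>mel (\<lambda>x. x * u x) i j\<bar>"
      by linarith
    also have "\<bar>2 * real (2 * i + 1) * mel (deriv u) i j\<bar> = 2 * real (2 * i + 1) * \<bar>mel (deriv u) i j\<bar>"
      by (simp add: abs_mult)
    also have "2 * \<bar>mel (\<lambda>x. x\<^sup>2 * deriv u x) i j\<bar> + 2 * real (2 * i + 1) * \<bar>mel (deriv u) i j\<bar>
      + \<bar>mel' (deriv (deriv u)) i j\<bar> + 2 * \<bar>mel (\<lambda>x. x * u x) i j\<bar>
      \<le> 2 * (D * T) + 2 * real (2 * i + 1) * (A * T) + B * ?l i * T + 2 * (E * T)"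
      using b by (intro add_mono mult_left_mono) auto
    \<comment> \<open>All terms are enlarged to the order \<open>2 * i + 1\<close> of the eigenvalue
      term. This is the square of \<open>?l i\<close>: one factor stays in the bound for
      \<open>mel'\<close>, the other enters the gained ratio.\<close>
    also have "\<dots> \<le> 2 * (D * real (2 * i + 1) * T) + 2 * real (2 * i + 1) * (A * T) + B * real (2 * i + 1) * T + 2 * (E * real (2 * i + 1) * T)"
      using l2 B(1) D(1) E(1) T mult_left_mono[OF l2(1) B(1)] mult_left_mono[OF l2(2) D(1)] mult_left_mono[OF l2(2) E(1)]
      by (intro add_mono mult_left_mono mult_right_mono) auto
    also have "\<dots> = C * real (2 * i + 1) * T" by (simp add: C_def algebra_simps)
    also have "\<dots> = C * (?l i * ?l i) * T" by (simp only: ll)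
    finally have "\<bar>mel' u i j\<bar> \<le> C * ?l i * (T * (?l i / ?d i j))"
      using d by (simp add: pos_le_divide_eq mult_ac)
    then show "\<bar>mel' u i j\<bar> \<le> C * ?l i * ?P i j * ?r i j ^ Suc k" unfolding TT by (simp only: mult.assoc)
  qed
qed

section \<open>The summability operators\<close>

text \<open>The common domain of all estimates: it contains every \<open>Xspace p\<close> with
  \<open>1 \<le> p\<close>, and on it all Hermite coefficients exist because each Hermite function
  decays like the weight.\<close>

definition weighted :: "(real \<Rightarrow> real) \<Rightarrow> bool" where
  "weighted f \<longleftrightarrow> f \<in> borel_measurable lebesgue \<and> integrable lebesgue (\<lambda>x. f x / (1 + x\<^sup>2))"

definition wnorm :: "(real \<Rightarrow> real) \<Rightarrow> real" where
  "wnorm f = (LINT x|lebesgue. \<bar>f x\<bar> / (1 + x\<^sup>2))"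

definition hcoef :: "(real \<Rightarrow> real) \<Rightarrow> nat \<Rightarrow> real" where
  "hcoef f j = (LINT y|lebesgue. f y * hermite_fun j y)"

lemma wnorm_nonneg: "0 \<le> wnorm f"
  unfolding wnorm_def by (intro integral_nonneg_AE) (auto intro!: AE_I2)

lemma weighted_measurable: "weighted f \<Longrightarrow> f \<in> borel_measurable lebesgue"
  by (simp add: weighted_def)

lemma weighted_abs_integrable: "weighted f \<Longrightarrow> integrable lebesgue (\<lambda>x. \<bar>f x\<bar> / (1 + x\<^sup>2))"
  using integrable_abs[of lebesgue "\<lambda>x. f x / (1 + x\<^sup>2)"] by (simp add: weighted_def)

lemma weighted_Lp: "f \<in> borel_measurable lebesgue \<Longrightarrow> 1 \<le> p \<Longrightarrow> Lp_norm p UNIV f < \<infinity> \<Longrightarrow> weighted f"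
  using weighted_integrable by (simp add: weighted_def)

lemma weighted_Xspace: "f \<in> Xspace p \<Longrightarrow> 1 \<le> p \<Longrightarrow> weighted f"
  using weighted_Lp Xspace_measurable Xspace_norm_finite by blast

lemma weighted_mult_bounded:
  assumes f: "weighted f" and g: "g \<in> borel_measurable borel" and K: "\<And>x. \<bar>g x\<bar> \<le> K"
  shows "weighted (\<lambda>x. g x * f x)"
proof -
  have m: "(\<lambda>x. g x * f x) \<in> borel_measurable lebesgue"
    using weighted_measurable[OF f] lebesgue_measurable_borel[OF g] by simp
  have K0: "0 \<le> K" using order_trans[OF abs_ge_zero K] .
  have "integrable lebesgue (\<lambda>x. g x * f x / (1 + x\<^sup>2))"
  proof (rule Bochner_Integration.integrable_bound[OF integrable_mult_right[OF weighted_abs_integrable[OF f], of K]])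
    show "(\<lambda>x. g x * f x / (1 + x\<^sup>2)) \<in> borel_measurable lebesgue"
      using m by (intro borel_measurable_divide lebesgue_measurable_borel[of "\<lambda>x. 1 + x\<^sup>2"]) auto
    have "norm (g x * f x / (1 + x\<^sup>2)) \<le> norm (K * (\<bar>f x\<bar> / (1 + x\<^sup>2)))" for x
      using mult_right_mono[OF K[of x], of "\<bar>f x\<bar> / (1 + x\<^sup>2)"] K0 by (simp add: abs_mult)
    then show "AE x in lebesgue. norm (g x * f x / (1 + x\<^sup>2)) \<le> norm (K * (\<bar>f x\<bar> / (1 + x\<^sup>2)))" by simp
  qed
  then show ?thesis using m by (simp add: weighted_def)
qed

lemma weighted_diff: "weighted f \<Longrightarrow> weighted g \<Longrightarrow> weighted (\<lambda>x. f x - g x)"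
  by (auto simp: weighted_def diff_divide_distrib)

lemma weighted_bounded:
  assumes "f \<in> borel_measurable borel" "\<And>x. \<bar>f x\<bar> \<le> K" shows "weighted f"
proof -
  have "integrable lborel (\<lambda>x. 1 / (1 + x\<^sup>2) :: real)" by (rule integrable_cauchy_density)
  then have "weighted (\<lambda>x. 1)"
    by (simp add: weighted_def integrable_completion)
  from weighted_mult_bounded[OF this assms] show ?thesis by simp
qed

text \<open>Decay of \<open>g\<close> is demanded only where \<open>f\<close> does not vanish. This
  serves \<open>sigma_localized\<close>, where the kernel is bounded only off the ball on which
  \<open>f\<close> is zero.\<close>

lemma weighted_mult_decay:
  assumes f: "weighted f" and g: "g \<in> borel_measurable borel"
    and K: "0 \<le> K" "\<And>y. f y \<noteq> 0 \<Longrightarrow> \<bar>g y\<bar> \<le> K / (1 + y\<^sup>2)"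
  shows "integrable lebesgue (\<lambda>y. f y * g y)" "\<bar>LINT y|lebesgue. f y * g y\<bar> \<le> K * wnorm f"
proof -
  have *: "\<bar>f y * g y\<bar> \<le> K * (\<bar>f y\<bar> / (1 + y\<^sup>2))" for y
  proof (cases "f y = 0")
    case False
    from mult_left_mono[OF K(2)[OF False], of "\<bar>f y\<bar>"] show ?thesis by (simp add: abs_mult mult_ac)
  qed simp
  note i = integrable_mult_right[OF weighted_abs_integrable[OF f], of K]
  show int: "integrable lebesgue (\<lambda>y. f y * g y)"
  proof (rule Bochner_Integration.integrable_bound[OF i])
    show "(\<lambda>y. f y * g y) \<in> borel_measurable lebesgue"
      using weighted_measurable[OF f] lebesgue_measurable_borel[OF g] by simp
    show "AE y in lebesgue. norm (f y * g y) \<le> norm (K * (\<bar>f y\<bar> / (1 + y\<^sup>2)))"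
      using * order_trans[OF _ abs_ge_self] by (intro AE_I2) (simp only: real_norm_def, blast)
  qed
  have "\<bar>LINT y|lebesgue. f y * g y\<bar> \<le> (LINT y|lebesgue. \<bar>f y * g y\<bar>)" by (rule integral_abs_bound)
  also have "\<dots> \<le> (LINT y|lebesgue. K * (\<bar>f y\<bar> / (1 + y\<^sup>2)))"
    by (intro integral_mono integrable_abs int i *)
  also have "\<dots> = K * wnorm f" unfolding wnorm_def by (rule integral_mult_right_zero)
  finally show "\<bar>LINT y|lebesgue. f y * g y\<bar> \<le> K * wnorm f" .
qed

lemma hcoef_integrable: "weighted f \<Longrightarrow> integrable lebesgue (\<lambda>y. f y * hermite_fun j y)"
  by (rule weighted_mult_decay(1)[OF _ _ _ hermite_decay]) auto

lemma hcoef_le: "weighted f \<Longrightarrow> \<bar>hcoef f j\<bar> \<le> 32 * real (Suc j) ^ 3 * wnorm f"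
  unfolding hcoef_def by (rule weighted_mult_decay(2)[OF _ _ _ hermite_decay]) auto

lemma hcoef_diff: "weighted f \<Longrightarrow> weighted g \<Longrightarrow> hcoef (\<lambda>x. f x - g x) j = hcoef f j - hcoef g j"
  unfolding hcoef_def using hcoef_integrable[of f j] hcoef_integrable[of g j]
  by (simp add: left_diff_distrib)

lemma hcoef_borel: "f \<in> borel_measurable borel \<Longrightarrow> hcoef f j = (\<integral>y. f y * hermite_fun j y \<partial>lborel)"
  unfolding hcoef_def by (rule integral_completion) simp

lemma hermite_span_eq: "0 < t \<Longrightarrow> hermite_span t = {Q. \<exists>c. Q = (\<lambda>x. \<Sum>j<cutoff t. c j * hermite_fun j x)}"
  by (simp add: hermite_span_def hermite_index_set)

lemma weighted_span: "Q \<in> hermite_span t \<Longrightarrow> weighted Q"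
proof -
  assume "Q \<in> hermite_span t"
  then obtain c where c: "Q = (\<lambda>x. \<Sum>j | sqrt (real j) < t. c j * hermite_fun j x)"
    by (auto simp: hermite_span_def)
  show ?thesis
  proof (rule weighted_bounded)
    show "Q \<in> borel_measurable borel" unfolding c by measurable
    show "\<bar>Q x\<bar> \<le> (\<Sum>j | sqrt (real j) < t. \<bar>c j\<bar> * (2 * real (Suc j)))" for x
      unfolding c
      by (rule order_trans[OF sum_abs]) (auto simp: abs_mult intro!: sum_mono mult_left_mono hermite_le simp del: of_nat_Suc)
  qed
qed

lemma nn_integral_poisson:
  assumes "0 < n"
  shows "(\<integral>\<^sup>+y. ennreal (n / (1 + (n * (x - y))\<^sup>2)) \<partial>lborel) = ennreal pi"
proof -
  have "ennreal pi = (\<integral>\<^sup>+y. ennreal (1 / (1 + y\<^sup>2)) \<partial>lborel)"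
    using nn_integral_cauchy_density[of 1] by simp
  also have "\<dots> = ennreal \<bar>n\<bar> * (\<integral>\<^sup>+y. ennreal (1 / (1 + (- n * x + n * y)\<^sup>2)) \<partial>lborel)"
    using assms by (intro nn_integral_real_affine) auto
  also have "\<dots> = (\<integral>\<^sup>+y. ennreal \<bar>n\<bar> * ennreal (1 / (1 + (- n * x + n * y)\<^sup>2)) \<partial>lborel)"
    by (rule nn_integral_cmult[symmetric]) measurable
  also have "\<dots> = (\<integral>\<^sup>+y. ennreal (n / (1 + (n * (x - y))\<^sup>2)) \<partial>lborel)"
  proof (rule nn_integral_cong)
    fix y
    have "(- n * x + n * y)\<^sup>2 = (n * (x - y))\<^sup>2" by (simp add: power2_eq_square algebra_simps)
    then show "ennreal \<bar>n\<bar> * ennreal (1 / (1 + (- n * x + n * y)\<^sup>2)) = ennreal (n / (1 + (n * (x - y))\<^sup>2))"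
      using assms by (simp add: ennreal_mult'[symmetric])
  qed
  finally show ?thesis by simp
qed

lemma nn_integral_poisson':
  "0 < n \<Longrightarrow> (\<integral>\<^sup>+x. ennreal (n / (1 + (n * (x - y))\<^sup>2)) \<partial>lborel) = ennreal pi"
  using nn_integral_poisson[of n y] by (simp add: power2_commute[of y] power_mult_distrib)

text \<open>Fubini is applied to Borel functions; this replaces a Lebesgue measurable function by a
  Borel one with the same norms and the same \<open>sigma_op\<close>.\<close>

lemma borel_version:
  assumes "f \<in> borel_measurable lebesgue"
  obtains g :: "real \<Rightarrow> real" where "g \<in> borel_measurable borel" "AE x in lebesgue. f x = g x"
  using completion_ex_borel_measurable_real[OF assms] AE_completion that by force

lemma weighted_cong_AE:
  assumes "weighted f" "g \<in> borel_measurable borel" "AE x in lebesgue. f x = g x"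
  shows "weighted g" "wnorm g = wnorm f"
proof -
  have m: "g \<in> borel_measurable lebesgue" using assms by (intro lebesgue_measurable_borel)
  have d: "(\<lambda>x. u x / (1 + x\<^sup>2)) \<in> borel_measurable lebesgue" if "u \<in> borel_measurable lebesgue" for u :: "real \<Rightarrow> real"
    using that by (intro borel_measurable_divide lebesgue_measurable_borel[of "\<lambda>x. 1 + x\<^sup>2"]) auto
  have "integrable lebesgue (\<lambda>x. g x / (1 + x\<^sup>2))"
    by (rule integrable_cong_AE_imp[of _ "\<lambda>x. f x / (1 + x\<^sup>2)"])
       (use assms m d in \<open>auto simp: weighted_def elim!: eventually_mono\<close>)
  then show "weighted g" using m by (simp add: weighted_def)
  show "wnorm g = wnorm f" unfolding wnorm_def
    by (rule integral_cong_AE) (use assms m d[of "\<lambda>x. \<bar>g x\<bar>"] d[of "\<lambda>x. \<bar>f x\<bar>"] weighted_measurable in \<open>auto elim!: eventually_mono\<close>)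
qed

context
  fixes h :: "real \<Rightarrow> real"
  assumes h: "low_pass_filter h"
begin

lemma coef_abs_le: "\<bar>coef h n j\<bar> \<le> 1"
  using h by (auto simp: coef_def low_pass_filter_def abs_le_iff intro: order_trans[of _ 0])

lemma coef_eq_1: "0 < n \<Longrightarrow> sqrt (real j) \<le> n / 2 \<Longrightarrow> coef h n j = 1"
  using h by (auto simp: coef_def low_pass_filter_def field_simps)

lemma sigma_eq_sum:
  assumes "weighted f" "0 < n"
  shows "sigma_op h n f x = (\<Sum>j<cutoff n. coef h n j * hcoef f j * hermite_fun j x)"
proof -
  have "sigma_op h n f x = (LINT y|lebesgue. (\<Sum>j<cutoff n. coef h n j * hermite_fun j x * (f y * hermite_fun j y)))"
    unfolding sigma_op_def kernel_eq_sum[OF h assms(2)]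
    by (intro Bochner_Integration.integral_cong refl) (simp add: sum_distrib_right sum_distrib_left mult_ac)
  also have "\<dots> = (\<Sum>j<cutoff n. coef h n j * hermite_fun j x * hcoef f j)"
    unfolding hcoef_def
    using hcoef_integrable[OF assms(1)]
    by (subst Bochner_Integration.integral_sum) (auto simp del: integral_mult_right_zero simp: integral_mult_right_zero)
  finally show ?thesis by (simp add: mult_ac)
qed

lemma kernel_measurable: "0 < n \<Longrightarrow> kernel h n x \<in> borel_measurable borel"
proof -
  assume "0 < n"
  then have "kernel h n x = (\<lambda>y. \<Sum>j<cutoff n. coef h n j * hermite_fun j x * hermite_fun j y)"
    using kernel_eq_sum[OF h] by blast
  then show ?thesis by simp
qed

lemma sigma_continuous:
  assumes "weighted f" "0 < n" shows "isCont (sigma_op h n f) x"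
proof -
  have "sigma_op h n f = (\<lambda>x. \<Sum>j<cutoff n. coef h n j * hcoef f j * hermite_fun j x)"
    using sigma_eq_sum[OF assms] by blast
  then show ?thesis by (auto intro!: continuous_intros)
qed

lemma sigma_measurable:
  assumes "weighted f" "0 < n" shows "sigma_op h n f \<in> borel_measurable borel"
  using sigma_continuous[OF assms]
  by (intro borel_measurable_continuous_onI continuous_at_imp_continuous_on) auto

lemma sigma_diff:
  assumes "weighted f" "weighted g" "0 < n"
  shows "sigma_op h n (\<lambda>x. f x - g x) x = sigma_op h n f x - sigma_op h n g x"
  using assms by (simp add: sigma_eq_sum weighted_diff hcoef_diff algebra_simps sum_subtractf)

lemma sigma_cong_AE:
  assumes "AE x in lebesgue. f x = g x" "weighted f" "weighted g" "0 < n"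
  shows "sigma_op h n f = sigma_op h n g"
proof
  fix x
  have m: "kernel h n x \<in> borel_measurable lebesgue" using kernel_measurable[OF assms(4)] by (rule lebesgue_measurable_borel)
  show "sigma_op h n f x = sigma_op h n g x"
    unfolding sigma_op_def
    by (intro integral_cong_AE borel_measurable_times m weighted_measurable[OF assms(2)] weighted_measurable[OF assms(3)])
       (use assms(1) in \<open>auto elim!: eventually_mono\<close>)
qed

lemma sigma_in_span:
  assumes "weighted f" "0 < n" shows "sigma_op h n f \<in> hermite_span n"
  using sigma_eq_sum[OF assms] assms(2) by (auto simp: hermite_span_eq fun_eq_iff)

lemma sigma_reproduces:
  assumes "Q \<in> hermite_span t" "0 < t" "t \<le> n / 2"
  shows "sigma_op h n Q = Q"
proof -
  have n: "0 < n" using assms by linarith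
  obtain c where c: "Q = (\<lambda>x. \<Sum>j<cutoff t. c j * hermite_fun j x)"
    using assms by (auto simp: hermite_span_eq)
  have Qb: "Q \<in> borel_measurable borel" unfolding c by measurable
  have ii: "integrable lborel (\<lambda>y. hermite_fun i y * hermite_fun j y)" for i j
    using integrable_he_mult(1)[of i j] by (simp add: hermite_fun_eq)
  have hc: "hcoef Q j = (if j < cutoff t then c j else 0)" for j
  proof -
    have "hcoef Q j = (\<integral>y. (\<Sum>i<cutoff t. c i * (hermite_fun i y * hermite_fun j y)) \<partial>lborel)"
      unfolding hcoef_borel[OF Qb] unfolding c by (simp only: sum_distrib_right mult.assoc)
    also have "\<dots> = (\<Sum>i<cutoff t. c i * (if i = j then 1 else 0))"
      using ii by (subst Bochner_Integration.integral_sum) (auto simp: hermite_orthonormal)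
    finally show ?thesis by (simp add: if_distrib cong: if_cong)
  qed
  have sub: "cutoff t \<le> cutoff n"
  proof (rule ccontr)
    assume "\<not> cutoff t \<le> cutoff n"
    then have "sqrt (real (cutoff n)) < t" "\<not> sqrt (real (cutoff n)) < n"
      using less_cutoff_iff[OF assms(2), of "cutoff n"] less_cutoff_iff[OF n, of "cutoff n"] by auto
    then show False using assms by linarith
  qed
  have "sigma_op h n Q x = Q x" for x
  proof -
    have "sigma_op h n Q x = (\<Sum>j<cutoff n. coef h n j * hcoef Q j * hermite_fun j x)"
      using sigma_eq_sum[OF weighted_span[OF assms(1)] n] .
    also have "\<dots> = (\<Sum>j<cutoff t. c j * hermite_fun j x)"
    proof (rule sum.mono_neutral_cong_right)
      fix j assume "j \<in> {..<cutoff t}"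
      then have "sqrt (real j) \<le> n / 2" using less_cutoff_iff[OF assms(2)] assms by force
      then show "coef h n j * hcoef Q j * hermite_fun j x = c j * hermite_fun j x"
        using \<open>j \<in> _\<close> coef_eq_1[OF n] by (simp add: hc)
    qed (use sub in \<open>auto simp: hc\<close>)
    finally show ?thesis by (simp add: c)
  qed
  then show ?thesis by blast
qed

lemma poisson_bound:
  obtains C where "0 < C" "\<And>n x y. n \<ge> 1 \<Longrightarrow> \<bar>kernel h n x y\<bar> \<le> C * (n / (1 + (n * (x - y))\<^sup>2))"
proof -
  obtain C where C: "0 \<le> C" "\<And>n x y. n \<ge> 1 \<Longrightarrow> \<bar>kernel h n x y\<bar> \<le> C * (n / (1 + (n * (x - y))\<^sup>2))"
    using kernel_poisson_bound[OF h] by blast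
  have "\<bar>kernel h n x y\<bar> \<le> (C + 1) * (n / (1 + (n * (x - y))\<^sup>2))" if "n \<ge> 1" for n x y
  proof -
    have "C * (n / (1 + (n * (x - y))\<^sup>2)) \<le> (C + 1) * (n / (1 + (n * (x - y))\<^sup>2))"
      using that by (intro mult_right_mono) auto
    then show ?thesis using C(2)[OF that, of x y] by linarith
  qed
  with C show ?thesis by (intro that[of "C + 1"]) auto
qed

text \<open>A bound not uniform in \<open>n\<close> and \<open>x\<close>; it serves to make the
  product of the kernel with a weighted function integrable.\<close>

lemma kernel_decay_fixed:
  assumes "0 < n" shows "\<exists>K\<ge>0. \<forall>y. \<bar>kernel h n x y\<bar> \<le> K / (1 + y\<^sup>2)"
proof -
  define K where "K = (\<Sum>j<cutoff n. \<bar>coef h n j * hermite_fun j x\<bar> * (32 * real (Suc j) ^ 3))"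
  have "\<bar>kernel h n x y\<bar> \<le> K / (1 + y\<^sup>2)" for y
  proof -
    have "\<bar>kernel h n x y\<bar> \<le> (\<Sum>j<cutoff n. \<bar>coef h n j * hermite_fun j x\<bar> * \<bar>hermite_fun j y\<bar>)"
      unfolding kernel_eq_sum[OF h assms] by (rule order_trans[OF sum_abs]) (simp add: abs_mult)
    also have "\<dots> \<le> (\<Sum>j<cutoff n. \<bar>coef h n j * hermite_fun j x\<bar> * (32 * real (Suc j) ^ 3 / (1 + y\<^sup>2)))"
      by (intro sum_mono mult_left_mono hermite_decay) auto
    finally show ?thesis by (simp add: K_def sum_divide_distrib)
  qed
  moreover have "0 \<le> K" unfolding K_def by (intro sum_nonneg) auto
  ultimately show ?thesis by blast
qed

lemma sigma_abs_le:
  assumes f: "f \<in> borel_measurable borel" "weighted f" and n: "n \<ge> 1"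
    and C: "\<And>y. \<bar>kernel h n x y\<bar> \<le> C * (n / (1 + (n * (x - y))\<^sup>2))"
  shows "ennreal \<bar>sigma_op h n f x\<bar> \<le> (\<integral>\<^sup>+y. ennreal (C * (n / (1 + (n * (x - y))\<^sup>2))) * ennreal \<bar>f y\<bar> \<partial>lborel)"
proof -
  have n0: "0 < n" using n by simp
  obtain K where "0 \<le> K" "\<And>y. \<bar>kernel h n x y\<bar> \<le> K / (1 + y\<^sup>2)" using kernel_decay_fixed[OF n0] by blast
  then have "integrable lebesgue (\<lambda>y. f y * kernel h n x y)"
    by (intro weighted_mult_decay(1)[OF f(2) kernel_measurable[OF n0]]) auto
  then have int: "integrable lebesgue (\<lambda>y. kernel h n x y * f y)" by (simp add: mult.commute)
  have [measurable]: "kernel h n x \<in> borel_measurable borel" "f \<in> borel_measurable borel"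
    using kernel_measurable[OF n0] f by auto
  have "ennreal \<bar>sigma_op h n f x\<bar> \<le> (\<integral>\<^sup>+y. ennreal \<bar>kernel h n x y * f y\<bar> \<partial>lebesgue)"
    unfolding sigma_op_def using integral_norm_bound_ennreal[OF int] by simp
  also have "\<dots> = (\<integral>\<^sup>+y. ennreal \<bar>kernel h n x y * f y\<bar> \<partial>lborel)"
    by (rule nn_integral_completion)
  also have "\<dots> \<le> (\<integral>\<^sup>+y. ennreal (C * (n / (1 + (n * (x - y))\<^sup>2))) * ennreal \<bar>f y\<bar> \<partial>lborel)"
  proof (rule nn_integral_mono)
    fix y
    have "\<bar>kernel h n x y * f y\<bar> \<le> C * (n / (1 + (n * (x - y))\<^sup>2)) * \<bar>f y\<bar>"
      unfolding abs_mult using C by (intro mult_right_mono) auto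
    moreover have "0 \<le> C * (n / (1 + (n * (x - y))\<^sup>2))" using order_trans[OF abs_ge_zero C] .
    ultimately show "ennreal \<bar>kernel h n x y * f y\<bar> \<le> ennreal (C * (n / (1 + (n * (x - y))\<^sup>2))) * ennreal \<bar>f y\<bar>"
      by (simp add: ennreal_mult'[symmetric] ennreal_leI)
  qed
  finally show ?thesis .
qed

text \<open>The Poisson majorant has integral \<open>C * pi\<close> in each variable, so the Schur
  test gives one constant for all \<open>n\<close> and \<open>p\<close>.\<close>

lemma sigma_Lp_bounded:
  "\<exists>C>0. \<forall>n\<ge>1. \<forall>p f. 1 \<le> p \<longrightarrow> f \<in> borel_measurable lebesgue \<longrightarrow> Lp_norm p UNIV f < \<infinity> \<longrightarrow>
    Lp_norm p UNIV (sigma_op h n f) \<le> ennreal C * Lp_norm p UNIV f"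
proof -
  obtain C where C: "0 < C" "\<And>n x y. n \<ge> 1 \<Longrightarrow> \<bar>kernel h n x y\<bar> \<le> C * (n / (1 + (n * (x - y))\<^sup>2))"
    using poisson_bound by blast
  have "Lp_norm p UNIV (sigma_op h n f) \<le> ennreal (C * pi) * Lp_norm p UNIV f"
    if n: "n \<ge> 1" and p: "1 \<le> p" and f: "f \<in> borel_measurable lebesgue" and fin: "Lp_norm p UNIV f < \<infinity>" for n p f
  proof -
    have n0: "0 < n" using n by simp
    have wf: "weighted f" using weighted_Lp[OF f p fin] .
    obtain g where g: "g \<in> borel_measurable borel" "AE x in lebesgue. f x = g x"
      using borel_version[OF f] by blast
    have wg: "weighted g" using weighted_cong_AE[OF wf g] by blast
    have P: "(\<integral>\<^sup>+y. ennreal (C * (n / (1 + (n * (x - y))\<^sup>2))) \<partial>lborel) \<le> ennreal (C * pi)"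
      "(\<integral>\<^sup>+y. ennreal (C * (n / (1 + (n * (y - x))\<^sup>2))) \<partial>lborel) \<le> ennreal (C * pi)" for x
      using C(1) n0 by (simp_all add: ennreal_mult' nn_integral_cmult nn_integral_poisson nn_integral_poisson'
          del: times_divide_eq_right)
    have "Lp_norm p UNIV (sigma_op h n g) \<le> ennreal (C * pi) * Lp_norm p UNIV g"
      by (rule Schur_test_borel[of "\<lambda>x y. C * (n / (1 + (n * (x - y))\<^sup>2))"])
         (use P C n n0 g wg p in \<open>auto intro!: sigma_measurable sigma_abs_le simp del: times_divide_eq_right\<close>)
    also have "sigma_op h n g = sigma_op h n f"
      using sigma_cong_AE[OF g(2) wf wg n0] by simp
    also have "Lp_norm p UNIV g = Lp_norm p UNIV f"
      using g f p lebesgue_measurable_borel[OF g(1)] by (intro Lp_norm_cong_AE[symmetric]) auto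
    finally show ?thesis .
  qed
  then show ?thesis using C by (intro exI[of _ "C * pi"]) simp
qed

text \<open>For \<open>x\<close> in the half ball and \<open>y\<close> outside the ball, the
  distance is at least \<open>\<delta> / 2\<close> and its square dominates \<open>1 + y^2\<close>
  up to a constant. A high power of the distance in the kernel bound therefore yields both the
  weight and the power of \<open>n\<close>.\<close>

lemma sigma_localized:
  assumes "0 < \<delta>"
  shows "\<exists>C\<ge>0. \<forall>n\<ge>1. \<forall>f. weighted f \<longrightarrow> (\<forall>y\<in>cball x0 \<delta>. f y = 0) \<longrightarrow>
    (\<forall>x\<in>cball x0 (\<delta> / 2). \<bar>sigma_op h n f x\<bar> \<le> C * n powr (- real S) * wnorm f)"
proof -
  \<comment> \<open>Two powers of the distance pay for the weight \<open>1 + y^2\<close>, and the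
    other \<open>S + 1\<close> are bounded below by \<open>e ^ (S + 1)\<close>. The exponent
    \<open>1 - k\<close> of \<open>n\<close> is then below \<open>- S\<close>.\<close>
  define k where "k = S + 3"
  obtain C where C: "C \<ge> 0" "\<And>n x y. n \<ge> 1 \<Longrightarrow> \<bar>x - y\<bar> ^ k * \<bar>kernel h n x y\<bar> \<le> C * n powr (1 - real k)"
    using kernel_decay[OF h] by blast
  define e where "e = \<delta> / 2"
  have e: "0 < e" using assms by (simp add: e_def)
  define R where "R = \<bar>x0\<bar> + \<delta>"
  define L where "L = (1 + 2 * R\<^sup>2) / e\<^sup>2 + 2"
  have L: "0 \<le> L" by (simp add: L_def)
  define D where "D = C * L / e ^ (S + 1)"
  have D: "0 \<le> D" using C L e by (simp add: D_def)
  have "\<bar>sigma_op h n f x\<bar> \<le> D * n powr (- real S) * wnorm f"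
    if n: "n \<ge> 1" and f: "weighted f" "\<And>y. y \<in> cball x0 \<delta> \<Longrightarrow> f y = 0" and x: "x \<in> cball x0 (\<delta> / 2)" for n f x
  proof -
    have n0: "0 < n" using n by simp
    have "\<bar>kernel h n x y\<bar> \<le> (D * n powr (- real S)) / (1 + y\<^sup>2)" if "f y \<noteq> 0" for y
    proof -
      define d where "d = \<bar>x - y\<bar>"
      have "y \<notin> cball x0 \<delta>" using f(2) that by blast
      then have "\<delta> < \<bar>x0 - y\<bar>" "\<bar>x0 - x\<bar> \<le> \<delta> / 2" using x by (auto simp: dist_real_def)
      then have d: "e \<le> d" unfolding d_def e_def by linarith
      have d0: "0 < d" using d e by linarith
      have "\<bar>x0 - x\<bar> \<le> \<delta> / 2" using x by (auto simp: dist_real_def)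
      then have "\<bar>x\<bar> \<le> R" using assms unfolding R_def by linarith
      then have "x\<^sup>2 \<le> R\<^sup>2" by (metis abs_ge_zero power2_abs power_mono)
      have "y\<^sup>2 \<le> 2 * x\<^sup>2 + 2 * d\<^sup>2"
      proof -
        have "0 \<le> (x + (x - y))\<^sup>2" by simp
        then show ?thesis by (simp add: d_def power2_eq_square algebra_simps)
      qed
      then have "1 + y\<^sup>2 \<le> (1 + 2 * R\<^sup>2) + 2 * d\<^sup>2" using \<open>x\<^sup>2 \<le> R\<^sup>2\<close> by linarith
      also have "1 + 2 * R\<^sup>2 \<le> (1 + 2 * R\<^sup>2) / e\<^sup>2 * d\<^sup>2"
      proof -
        have "(1 + 2 * R\<^sup>2) * e\<^sup>2 \<le> (1 + 2 * R\<^sup>2) * d\<^sup>2" using d e by (intro mult_left_mono power_mono) auto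
        then show ?thesis using e by (simp add: field_simps)
      qed
      finally have 1: "1 + y\<^sup>2 \<le> L * d\<^sup>2" by (simp add: L_def algebra_simps)
      have 2: "e ^ (S + 1) * d\<^sup>2 \<le> d ^ k"
      proof -
        have "e ^ (S + 1) * d\<^sup>2 \<le> d ^ (S + 1) * d\<^sup>2" using d e by (intro mult_right_mono power_mono) auto
        also have "\<dots> = d ^ k" by (simp add: k_def power_add power2_eq_square power3_eq_cube)
        finally show ?thesis .
      qed
      have "n powr (1 - real k) \<le> n powr (- real S)" using n by (intro powr_mono) (auto simp: k_def)
      then have "C * n powr (1 - real k) \<le> C * n powr (- real S)" using C by (intro mult_left_mono) auto
      then have 3: "d ^ k * \<bar>kernel h n x y\<bar> \<le> C * n powr (- real S)"
        using C(2)[OF n, of x y] by (simp add: d_def)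
      have "(1 + y\<^sup>2) * \<bar>kernel h n x y\<bar> * e ^ (S + 1) \<le> L * d\<^sup>2 * \<bar>kernel h n x y\<bar> * e ^ (S + 1)"
        using 1 e by (intro mult_right_mono) auto
      also have "\<dots> = L * ((e ^ (S + 1) * d\<^sup>2) * \<bar>kernel h n x y\<bar>)" by (simp add: mult_ac)
      also have "\<dots> \<le> L * (d ^ k * \<bar>kernel h n x y\<bar>)"
        using L 2 by (intro mult_left_mono mult_right_mono) auto
      also have "\<dots> \<le> L * (C * n powr (- real S))" using L 3 by (intro mult_left_mono) auto
      finally have "(1 + y\<^sup>2) * \<bar>kernel h n x y\<bar> \<le> D * n powr (- real S)"
        using e by (simp add: D_def pos_le_divide_eq mult_ac)
      then show ?thesis by (simp add: pos_le_divide_eq mult.commute)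
    qed
    then have "\<bar>LINT y|lebesgue. f y * kernel h n x y\<bar> \<le> D * n powr (- real S) * wnorm f"
      using D by (intro weighted_mult_decay(2)[OF f(1) kernel_measurable[OF n0]]) auto
    then show ?thesis by (simp add: sigma_op_def mult.commute)
  qed
  then show ?thesis using D by blast
qed

end

section \<open>Convergence\<close>

lemma he_0_pos: "0 < he 0 x"
  by (simp add: he.simps)

text \<open>The order \<open>1 / 2\<close> makes this function reproduced already by
  \<open>sigma_op h 1\<close>, hence by every \<open>sigma_op h (2 ^ m)\<close>.\<close>

lemma hermite_0_in_span: "hermite_fun 0 \<in> hermite_span (1 / 2)"
proof -
  have "{j. sqrt (real j) < 1 / 2} = {0}"
  proof -
    have "\<not> sqrt (real (Suc j)) < 1 / 2" for j
      using real_sqrt_ge_1_iff[of "real (Suc j)"] by linarith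
    then show ?thesis by (auto simp del: of_nat_Suc) (metis not0_implies_Suc)
  qed
  then have "hermite_fun 0 = (\<lambda>x. \<Sum>j | sqrt (real j) < 1 / 2. 1 * hermite_fun j x)" by simp
  then show ?thesis unfolding hermite_span_def mem_Collect_eq by (rule exI[of _ "\<lambda>j. 1"])
qed

lemma nn_integral_dominated_convergence_0:
  assumes [measurable]: "\<And>i. u i \<in> borel_measurable M" "w \<in> borel_measurable M"
    and "\<And>i. AE x in M. u i x \<le> w x" "(\<integral>\<^sup>+x. w x \<partial>M) < \<infinity>" "AE x in M. (\<lambda>i. u i x) \<longlonglongrightarrow> 0"
  shows "(\<lambda>i. \<integral>\<^sup>+x. u i x \<partial>M) \<longlonglongrightarrow> 0"
  using nn_integral_dominated_convergence[of u M "\<lambda>x. 0" w] assms by simp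

lemma Lp_norm_Fatou:
  assumes [measurable]: "B \<in> sets lebesgue" "\<And>k. u k \<in> borel_measurable lebesgue" "g \<in> borel_measurable lebesgue"
    and p: "1 \<le> p" and lim: "AE x in lebesgue. x \<in> B \<longrightarrow> (\<lambda>k. u k x) \<longlonglongrightarrow> g x"
    and s: "0 \<le> s" "\<And>k::nat. Lp_norm p B (u k) \<le> ennreal s"
  shows "Lp_norm p B g \<le> ennreal s"
proof (cases "p = top")
  case True
  have "AE x in lebesgue. x \<in> B \<longrightarrow> ennreal \<bar>u k x\<bar> \<le> ennreal s" for k
    using s(2)[of k] True Lp_norm_top_le_iff[of B "u k" "ennreal s"] by simp
  then have "AE x in lebesgue. \<forall>k. x \<in> B \<longrightarrow> ennreal \<bar>u k x\<bar> \<le> ennreal s"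
    by (subst AE_all_countable) blast
  with lim have "AE x in lebesgue. x \<in> B \<longrightarrow> ennreal \<bar>g x\<bar> \<le> ennreal s"
  proof eventually_elim
    case (elim x)
    show ?case
    proof
      assume "x \<in> B"
      with elim have "(\<lambda>k. \<bar>u k x\<bar>) \<longlonglongrightarrow> \<bar>g x\<bar>" "\<And>k. \<bar>u k x\<bar> \<le> s"
        using s(1) by (auto intro: tendsto_rabs)
      then have "\<bar>g x\<bar> \<le> s" by (intro LIMSEQ_le_const2) auto
      then show "ennreal \<bar>g x\<bar> \<le> ennreal s" by (rule ennreal_leI)
    qed
  qed
  then show ?thesis using True by (simp add: Lp_norm_top_le_iff)
next
  case False
  define q where "q = enn2real p"
  have q: "1 \<le> q" using one_le_enn2real[OF p False] by (simp add: q_def)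
  let ?v = "\<lambda>k x. ennreal (\<bar>u k x\<bar> powr q) * indicator B x"
  have "(\<integral>\<^sup>+x. ennreal (\<bar>g x\<bar> powr q) * indicator B x \<partial>lebesgue) = (\<integral>\<^sup>+x. liminf (\<lambda>k. ?v k x) \<partial>lebesgue)"
  proof (rule nn_integral_cong_AE, use lim in eventually_elim)
    case (elim x)
    have "(\<lambda>k. ?v k x) \<longlonglongrightarrow> ennreal (\<bar>g x\<bar> powr q) * indicator B x"
    proof (cases "x \<in> B")
      case True
      have "(\<lambda>k. \<bar>u k x\<bar> powr q) \<longlonglongrightarrow> \<bar>g x\<bar> powr q"
        using elim True q by (intro tendsto_powr' tendsto_rabs tendsto_const) auto
      then show ?thesis using True by (simp add: tendsto_ennrealI)
    qed simp
    then show ?case using lim_imp_Liminf[OF sequentially_bot] by metis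
  qed
  also have "\<dots> \<le> liminf (\<lambda>k. \<integral>\<^sup>+x. ?v k x \<partial>lebesgue)"
    by (rule nn_integral_liminf) measurable
  also have "\<dots> \<le> liminf (\<lambda>k::nat. ennreal (s powr q))"
    using s p False by (intro Liminf_mono always_eventually allI) (simp add: Lp_norm_le_iff q_def)
  also have "\<dots> = ennreal (s powr q)" by (simp add: Liminf_const)
  finally show ?thesis using p s False by (subst Lp_norm_le_iff) (auto simp: q_def)
qed

section \<open>Convergence in \<open>L^1\<close> on bounded intervals\<close>

definition loc_err :: "(real \<Rightarrow> real) \<Rightarrow> real \<Rightarrow> nat \<Rightarrow> (real \<Rightarrow> real) \<Rightarrow> ennreal" where
  "loc_err h R m f = (\<integral>\<^sup>+x. ennreal \<bar>sigma_op h (2 ^ m) f x - f x\<bar> * indicator {-R..R} x \<partial>lborel)"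

definition wnn :: "(real \<Rightarrow> real) \<Rightarrow> ennreal" where
  "wnn f = (\<integral>\<^sup>+x. ennreal (\<bar>f x\<bar> / (1 + x\<^sup>2)) \<partial>lborel)"

lemma weighted_borel_iff:
  assumes "f \<in> borel_measurable borel"
  shows "weighted f \<longleftrightarrow> wnn f < \<infinity>"
proof -
  have "weighted f \<longleftrightarrow> integrable lborel (\<lambda>x. f x / (1 + x\<^sup>2))"
    using assms lebesgue_measurable_borel[OF assms] by (simp add: weighted_def integrable_completion)
  also have "\<dots> \<longleftrightarrow> wnn f < \<infinity>"
    using assms by (simp add: integrable_iff_bounded wnn_def abs_divide)
  finally show ?thesis .
qed

text \<open>Here the distance \<open>d\<close> is at least half of \<open>|y|\<close>, and the
  kernel is at most \<open>1 / (n * d^2)\<close>, so for \<open>n \<ge> 1\<close> a bound free of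
  \<open>n\<close> results.\<close>

lemma poisson_far_bound:
  assumes n: "1 \<le> (n::real)" and x: "\<bar>x\<bar> \<le> R" and y: "2 * R + 1 < \<bar>y\<bar>"
  shows "n / (1 + (n * (x - y))\<^sup>2) \<le> 8 / (1 + y\<^sup>2)"
proof -
  define d where "d = \<bar>x - y\<bar>"
  have R: "0 \<le> R" using x by linarith
  have d: "\<bar>y\<bar> / 2 \<le> d" unfolding d_def using x y by linarith
  have y1: "1 \<le> y\<^sup>2"
  proof -
    have "1 \<le> \<bar>y\<bar>" using y R by linarith
    then have "1 \<le> \<bar>y\<bar>\<^sup>2" by (rule one_le_power)
    then show ?thesis by simp
  qed
  have "(\<bar>y\<bar> / 2)\<^sup>2 \<le> d\<^sup>2" using d by (intro power_mono) auto
  then have y2: "y\<^sup>2 \<le> 4 * d\<^sup>2" by (simp add: power_divide)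
  have "n * (1 + y\<^sup>2) \<le> n * (2 * y\<^sup>2)" using y1 n by (intro mult_left_mono) auto
  also have "\<dots> \<le> n * (8 * d\<^sup>2)" using y2 n by (intro mult_left_mono) auto
  also have "\<dots> \<le> (n * n) * (8 * d\<^sup>2)" using n by (intro mult_right_mono) auto
  also have "\<dots> \<le> 8 * (1 + (n * (x - y))\<^sup>2)" by (simp add: d_def power_mult_distrib power2_eq_square[of n])
  finally show ?thesis by (simp add: divide_simps mult_ac add_pos_nonneg)
qed

context
  fixes h :: "real \<Rightarrow> real"
  assumes h: "low_pass_filter h"
begin

lemma sigma_cmult: "sigma_op h n (\<lambda>x. c * f x) x = c * sigma_op h n f x"
proof -
  have "(\<lambda>y. kernel h n x y * (c * f y)) = (\<lambda>y. c * (kernel h n x y * f y))" by (simp add: fun_eq_iff)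
  then show ?thesis unfolding sigma_op_def by (simp only: integral_mult_right_zero)
qed

text \<open>The kernel reproduces \<open>hermite_fun 0\<close>, which has no zeros; subtracting a multiple of it reduces
  the convergence at \<open>x\<close> to functions vanishing at \<open>x\<close>.\<close>

lemma sigma_tendsto:
  assumes f: "f \<in> borel_measurable borel" "\<And>y. \<bar>f y\<bar> \<le> M" and x: "isCont f x"
  shows "(\<lambda>m. sigma_op h (2 ^ m) f x) \<longlonglongrightarrow> f x"
proof -
  obtain C where C: "0 < C" "\<And>n x y. n \<ge> 1 \<Longrightarrow> \<bar>kernel h n x y\<bar> \<le> C * (n / (1 + (n * (x - y))\<^sup>2))"
    using poisson_bound[OF h] by blast
  let ?p = "hermite_fun 0"
  have p0: "?p x \<noteq> 0" using he_0_pos[of x] by (simp add: hermite_fun_eq)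
  define a where "a = f x / ?p x"
  define r where "r y = f y - a * ?p y" for y
  have r_meas [measurable]: "r \<in> borel_measurable borel" unfolding r_def[abs_def] using f by measurable
  define B where "B = M + \<bar>a\<bar> * 2"
  have rB: "\<bar>r y\<bar> \<le> B" for y
  proof -
    have "\<bar>r y\<bar> \<le> \<bar>f y\<bar> + \<bar>a\<bar> * \<bar>?p y\<bar>" unfolding r_def by (rule order_trans[OF abs_triangle_ineq4]) (simp add: abs_mult)
    also have "\<dots> \<le> M + \<bar>a\<bar> * 2" using f hermite_le[of 0 y] by (intro add_mono mult_left_mono) auto
    finally show ?thesis by (simp add: B_def)
  qed
  have B0: "0 \<le> B" using order_trans[OF abs_ge_zero rB] .
  have wr: "weighted r" using weighted_bounded[OF r_meas rB] .
  have wf: "weighted f" using weighted_bounded f by blast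
  have wp: "weighted ?p" using weighted_span[OF hermite_0_in_span] .
  have wap: "weighted (\<lambda>y. a * ?p y)" using weighted_mult_bounded[OF wp, of "\<lambda>_. a" "\<bar>a\<bar>"] by simp
  have rx: "r x = 0" using p0 by (simp add: r_def a_def)
  have rc: "isCont r x" unfolding r_def[abs_def] by (intro continuous_intros x)
  have eq: "sigma_op h (2 ^ m) r x = sigma_op h (2 ^ m) f x - f x" for m
  proof -
    have "sigma_op h (2 ^ m) r x = sigma_op h (2 ^ m) f x - sigma_op h (2 ^ m) (\<lambda>y. a * ?p y) x"
      unfolding r_def[abs_def] by (rule sigma_diff[OF h wf wap]) simp
    also have "sigma_op h (2 ^ m) (\<lambda>y. a * ?p y) x = a * ?p x"
      unfolding sigma_cmult using sigma_reproduces[OF h hermite_0_in_span, of "2 ^ m"] by simp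
    finally show ?thesis using p0 by (simp add: a_def)
  qed
  \<comment> \<open>The substitution \<open>y = x + u / 2^m\<close> turns the Poisson kernel into a
    fixed integrable density. The dependence on \<open>m\<close> moves into the argument of
    \<open>r\<close>, which tends to the zero \<open>x\<close> of \<open>r\<close>.\<close>
  have le: "ennreal \<bar>sigma_op h (2 ^ m) r x\<bar> \<le> (\<integral>\<^sup>+u. ennreal (C / (1 + u\<^sup>2)) * ennreal \<bar>r (x + 1 / 2 ^ m * u)\<bar> \<partial>lborel)" for m
  proof -
    let ?n = "2 ^ m :: real"
    have "ennreal \<bar>sigma_op h ?n r x\<bar> \<le> (\<integral>\<^sup>+y. ennreal (C * (?n / (1 + (?n * (x - y))\<^sup>2))) * ennreal \<bar>r y\<bar> \<partial>lborel)"
      by (rule sigma_abs_le[OF h r_meas wr _ C(2)]) auto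
    also have "\<dots> = ennreal \<bar>1 / ?n\<bar> * (\<integral>\<^sup>+u. ennreal (C * (?n / (1 + (?n * (x - (x + 1 / ?n * u)))\<^sup>2))) * ennreal \<bar>r (x + 1 / ?n * u)\<bar> \<partial>lborel)"
      by (rule nn_integral_real_affine) auto
    also have "\<dots> = (\<integral>\<^sup>+u. ennreal \<bar>1 / ?n\<bar> * (ennreal (C * (?n / (1 + (?n * (x - (x + 1 / ?n * u)))\<^sup>2))) * ennreal \<bar>r (x + 1 / ?n * u)\<bar>) \<partial>lborel)"
      by (rule nn_integral_cmult[symmetric]) measurable
    also have "\<dots> = (\<integral>\<^sup>+u. ennreal (C / (1 + u\<^sup>2)) * ennreal \<bar>r (x + 1 / ?n * u)\<bar> \<partial>lborel)"
    proof (rule nn_integral_cong)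
      fix u
      have "(?n * (x - (x + 1 / ?n * u)))\<^sup>2 = u\<^sup>2" by (simp add: power2_eq_square)
      then have "\<bar>1 / ?n\<bar> * (C * (?n / (1 + (?n * (x - (x + 1 / ?n * u)))\<^sup>2))) = C / (1 + u\<^sup>2)" by simp
      then show "ennreal \<bar>1 / ?n\<bar> * (ennreal (C * (?n / (1 + (?n * (x - (x + 1 / ?n * u)))\<^sup>2))) * ennreal \<bar>r (x + 1 / ?n * u)\<bar>) =
          ennreal (C / (1 + u\<^sup>2)) * ennreal \<bar>r (x + 1 / ?n * u)\<bar>"
        by (metis abs_ge_zero ennreal_mult' mult.assoc)
    qed
    finally show ?thesis .
  qed
  have lim: "(\<lambda>m. \<integral>\<^sup>+u. ennreal (C / (1 + u\<^sup>2)) * ennreal \<bar>r (x + 1 / 2 ^ m * u)\<bar> \<partial>lborel) \<longlonglongrightarrow> 0"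
  proof (rule nn_integral_dominated_convergence_0[where w = "\<lambda>u. ennreal (C * B / (1 + u\<^sup>2))"])
    show "(\<integral>\<^sup>+u. ennreal (C * B / (1 + u\<^sup>2)) \<partial>lborel) < \<infinity>"
      using C B0 by (subst nn_integral_cauchy_density) auto
    show "AE u in lborel. ennreal (C / (1 + u\<^sup>2)) * ennreal \<bar>r (x + 1 / 2 ^ m * u)\<bar> \<le> ennreal (C * B / (1 + u\<^sup>2))" for m
    proof (rule AE_I2)
      fix u
      have "C / (1 + u\<^sup>2) * \<bar>r (x + 1 / 2 ^ m * u)\<bar> \<le> C / (1 + u\<^sup>2) * B"
        using C rB by (intro mult_left_mono) auto
      then show "ennreal (C / (1 + u\<^sup>2)) * ennreal \<bar>r (x + 1 / 2 ^ m * u)\<bar> \<le> ennreal (C * B / (1 + u\<^sup>2))"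
        using C by (simp add: ennreal_mult'[symmetric] ennreal_leI)
    qed
    show "AE u in lborel. (\<lambda>m. ennreal (C / (1 + u\<^sup>2)) * ennreal \<bar>r (x + 1 / 2 ^ m * u)\<bar>) \<longlonglongrightarrow> 0"
    proof (rule AE_I2)
      fix u :: real
      have "(\<lambda>m. x + 1 / 2 ^ m * u) \<longlonglongrightarrow> x + 0 * u"
        by (intro tendsto_intros) real_asymp
      then have "(\<lambda>m. x + 1 / 2 ^ m * u) \<longlonglongrightarrow> x" by simp
      from isCont_tendsto_compose[OF rc this] have "(\<lambda>m. r (x + 1 / 2 ^ m * u)) \<longlonglongrightarrow> 0" by (simp add: rx)
      then have "(\<lambda>m. C / (1 + u\<^sup>2) * \<bar>r (x + 1 / 2 ^ m * u)\<bar>) \<longlonglongrightarrow> 0"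
        by (intro tendsto_mult_right_zero tendsto_rabs_zero)
      then have "(\<lambda>m. ennreal (C / (1 + u\<^sup>2) * \<bar>r (x + 1 / 2 ^ m * u)\<bar>)) \<longlonglongrightarrow> ennreal 0"
        by (rule tendsto_ennrealI)
      then show "(\<lambda>m. ennreal (C / (1 + u\<^sup>2)) * ennreal \<bar>r (x + 1 / 2 ^ m * u)\<bar>) \<longlonglongrightarrow> 0"
        using C by (simp add: ennreal_mult'[symmetric])
    qed
  qed measurable
  have "(\<lambda>m. ennreal \<bar>sigma_op h (2 ^ m) r x\<bar>) \<longlonglongrightarrow> 0"
    by (rule tendsto_sandwich[OF _ _ tendsto_const lim]) (use le in auto)
  then have "(\<lambda>m. ennreal \<bar>sigma_op h (2 ^ m) r x\<bar>) \<longlonglongrightarrow> ennreal 0" by simp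
  then have "(\<lambda>m. \<bar>sigma_op h (2 ^ m) r x\<bar>) \<longlonglongrightarrow> 0"
    by (subst (asm) tendsto_ennreal_iff) auto
  then have "(\<lambda>m. sigma_op h (2 ^ m) f x - f x) \<longlonglongrightarrow> 0" unfolding eq by (rule tendsto_rabs_zero_cancel)
  then show ?thesis by (simp add: LIM_zero_iff)
qed

lemma sigma_abs_bounded:
  assumes C: "0 < C" "\<And>n x y. n \<ge> 1 \<Longrightarrow> \<bar>kernel h n x y\<bar> \<le> C * (n / (1 + (n * (x - y))\<^sup>2))"
    and f: "f \<in> borel_measurable borel" "\<And>y. \<bar>f y\<bar> \<le> M" and n: "n \<ge> 1"
  shows "\<bar>sigma_op h n f x\<bar> \<le> C * pi * M"
proof -
  have M: "0 \<le> M" using order_trans[OF abs_ge_zero f(2)] .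
  have "ennreal \<bar>sigma_op h n f x\<bar> \<le> (\<integral>\<^sup>+y. ennreal (C * (n / (1 + (n * (x - y))\<^sup>2))) * ennreal \<bar>f y\<bar> \<partial>lborel)"
    by (rule sigma_abs_le[OF h f(1) weighted_bounded[OF f] n C(2)[OF n]])
  also have "\<dots> \<le> (\<integral>\<^sup>+y. ennreal (C * M) * ennreal (n / (1 + (n * (x - y))\<^sup>2)) \<partial>lborel)"
  proof (rule nn_integral_mono)
    fix y
    have "C * (n / (1 + (n * (x - y))\<^sup>2)) * \<bar>f y\<bar> \<le> C * (n / (1 + (n * (x - y))\<^sup>2)) * M"
      using C n f by (intro mult_left_mono) auto
    then show "ennreal (C * (n / (1 + (n * (x - y))\<^sup>2))) * ennreal \<bar>f y\<bar> \<le> ennreal (C * M) * ennreal (n / (1 + (n * (x - y))\<^sup>2))"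
      using C n M by (simp add: ennreal_mult'[symmetric] ennreal_leI mult_ac)
  qed
  also have "\<dots> = ennreal (C * M * pi)"
    using n C M by (subst nn_integral_cmult) (auto simp: nn_integral_poisson ennreal_mult'[symmetric])
  finally show ?thesis using C M by (subst (asm) ennreal_le_iff) (auto simp: mult_ac)
qed

text \<open>By Fubini this reduces to the integral of the Poisson majorant over \<open>x\<close> in
  \<open>{-R..R}\<close>. For \<open>y\<close> near the interval the full integral
  \<open>C * pi\<close> is used, for \<open>y\<close> beyond \<open>2 * R + 1\<close> the bound
  \<open>poisson_far_bound\<close>.\<close>

lemma loc_sigma_le:
  assumes R: "0 \<le> R"
  obtains D where "0 \<le> D" "\<And>n f. n \<ge> 1 \<Longrightarrow> f \<in> borel_measurable borel \<Longrightarrow> weighted f \<Longrightarrow>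
    (\<integral>\<^sup>+x. ennreal \<bar>sigma_op h n f x\<bar> * indicator {-R..R} x \<partial>lborel) \<le> ennreal D * wnn f"
proof -
  obtain C where C: "0 < C" "\<And>n x y. n \<ge> 1 \<Longrightarrow> \<bar>kernel h n x y\<bar> \<le> C * (n / (1 + (n * (x - y))\<^sup>2))"
    using poisson_bound[OF h] by blast
  define T where "T = 2 * R + 1"
  define D where "D = C * pi * (1 + T\<^sup>2) + 16 * C * R"
  have D: "0 \<le> D" using C R by (simp add: D_def)
  have K: "(\<integral>\<^sup>+x. ennreal (C * (n / (1 + (n * (x - y))\<^sup>2))) * indicator {-R..R} x \<partial>lborel) \<le> ennreal (D / (1 + y\<^sup>2))"
    if n: "n \<ge> 1" for n y
  proof (cases "\<bar>y\<bar> \<le> T")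
    case True
    have "(\<integral>\<^sup>+x. ennreal (C * (n / (1 + (n * (x - y))\<^sup>2))) * indicator {-R..R} x \<partial>lborel) \<le>
        (\<integral>\<^sup>+x. ennreal C * ennreal (n / (1 + (n * (x - y))\<^sup>2)) \<partial>lborel)"
      using C n by (intro nn_integral_mono) (auto simp: indicator_def ennreal_mult'[symmetric])
    also have "\<dots> = ennreal (C * pi)"
      using n C by (subst nn_integral_cmult) (auto simp: nn_integral_poisson' ennreal_mult'[symmetric])
    also have "\<dots> \<le> ennreal (D / (1 + y\<^sup>2))"
    proof (rule ennreal_leI)
      have "y\<^sup>2 \<le> T\<^sup>2" using True by (metis abs_ge_zero power2_abs power_mono)
      then have "C * pi * (1 + y\<^sup>2) \<le> C * pi * (1 + T\<^sup>2)" using C by (intro mult_left_mono) auto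
      also have "\<dots> \<le> D" using C R by (simp add: D_def)
      finally show "C * pi \<le> D / (1 + y\<^sup>2)" by (simp add: pos_le_divide_eq)
    qed
    finally show ?thesis .
  next
    case False
    have "(\<integral>\<^sup>+x. ennreal (C * (n / (1 + (n * (x - y))\<^sup>2))) * indicator {-R..R} x \<partial>lborel) \<le>
        (\<integral>\<^sup>+x. ennreal (C * (8 / (1 + y\<^sup>2))) * indicator {-R..R} x \<partial>lborel)"
    proof (rule nn_integral_mono)
      fix x
      have "C * (n / (1 + (n * (x - y))\<^sup>2)) \<le> C * (8 / (1 + y\<^sup>2))" if "x \<in> {-R..R}"
        using C n that False by (intro mult_left_mono poisson_far_bound) (auto simp: T_def)
      then show "ennreal (C * (n / (1 + (n * (x - y))\<^sup>2))) * indicator {-R..R} x \<le> ennreal (C * (8 / (1 + y\<^sup>2))) * indicator {-R..R} x"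
        by (auto simp: indicator_def intro!: ennreal_leI simp del: times_divide_eq_right)
    qed
    also have "\<dots> = ennreal (C * (8 / (1 + y\<^sup>2)) * (2 * R))"
      using R C by (subst nn_integral_cmult_indicator) (auto simp: ennreal_mult'[symmetric])
    also have "\<dots> \<le> ennreal (D / (1 + y\<^sup>2))"
    proof (rule ennreal_leI)
      have "C * (8 / (1 + y\<^sup>2)) * (2 * R) = 16 * C * R / (1 + y\<^sup>2)" by simp
      also have "\<dots> \<le> D / (1 + y\<^sup>2)" using C by (intro divide_right_mono) (auto simp: D_def)
      finally show "C * (8 / (1 + y\<^sup>2)) * (2 * R) \<le> D / (1 + y\<^sup>2)" .
    qed
    finally show ?thesis .
  qed
  have "(\<integral>\<^sup>+x. ennreal \<bar>sigma_op h n f x\<bar> * indicator {-R..R} x \<partial>lborel) \<le> ennreal D * wnn f"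
    if n: "n \<ge> 1" and [measurable]: "f \<in> borel_measurable borel" and wf: "weighted f" for n f
  proof -
    let ?P = "\<lambda>x y. ennreal (C * (n / (1 + (n * (x - y))\<^sup>2)))"
    have "(\<integral>\<^sup>+x. ennreal \<bar>sigma_op h n f x\<bar> * indicator {-R..R} x \<partial>lborel) \<le>
        (\<integral>\<^sup>+x. (\<integral>\<^sup>+y. ?P x y * ennreal \<bar>f y\<bar> \<partial>lborel) * indicator {-R..R} x \<partial>lborel)"
      by (intro nn_integral_mono mult_right_mono sigma_abs_le[OF h _ wf n C(2)[OF n]]) auto
    also have "\<dots> = (\<integral>\<^sup>+x. (\<integral>\<^sup>+y. ?P x y * ennreal \<bar>f y\<bar> * indicator {-R..R} x \<partial>lborel) \<partial>lborel)"
      by (intro nn_integral_cong nn_integral_multc[symmetric]) measurable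
    also have "\<dots> = (\<integral>\<^sup>+y. (\<integral>\<^sup>+x. ?P x y * ennreal \<bar>f y\<bar> * indicator {-R..R} x \<partial>lborel) \<partial>lborel)"
    proof (rule lborel_pair.Fubini'[symmetric])
      have "(\<lambda>z. ?P (fst z) (snd z) * ennreal \<bar>f (snd z)\<bar> * indicator {-R..R} (fst z)) \<in> borel_measurable (borel \<Otimes>\<^sub>M borel)"
        by measurable
      then show "(\<lambda>(x, y). ?P x y * ennreal \<bar>f y\<bar> * indicator {-R..R} x) \<in> borel_measurable (lborel \<Otimes>\<^sub>M lborel)"
        by (simp add: split_beta' cong: measurable_cong_sets sets_pair_measure_cong)
    qed
    also have "\<dots> = (\<integral>\<^sup>+y. (\<integral>\<^sup>+x. ?P x y * indicator {-R..R} x * ennreal \<bar>f y\<bar> \<partial>lborel) \<partial>lborel)"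
      by (simp add: mult_ac)
    also have "\<dots> = (\<integral>\<^sup>+y. (\<integral>\<^sup>+x. ?P x y * indicator {-R..R} x \<partial>lborel) * ennreal \<bar>f y\<bar> \<partial>lborel)"
      by (intro nn_integral_cong nn_integral_multc) measurable
    also have "\<dots> \<le> (\<integral>\<^sup>+y. ennreal (D / (1 + y\<^sup>2)) * ennreal \<bar>f y\<bar> \<partial>lborel)"
      by (intro nn_integral_mono mult_right_mono K n) auto
    also have "\<dots> = (\<integral>\<^sup>+y. ennreal D * ennreal (\<bar>f y\<bar> / (1 + y\<^sup>2)) \<partial>lborel)"
      using D by (intro nn_integral_cong) (simp add: ennreal_mult'[symmetric])
    also have "\<dots> = ennreal D * wnn f"
      unfolding wnn_def by (rule nn_integral_cmult) measurable
    finally show ?thesis .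
  qed
  then show ?thesis using that D by blast
qed

end

lemma wnn_abs_le: "f \<in> borel_measurable borel \<Longrightarrow> 0 \<le> R \<Longrightarrow>
  (\<integral>\<^sup>+x. ennreal \<bar>f x\<bar> * indicator {-R..R} x \<partial>lborel) \<le> ennreal (1 + R\<^sup>2) * wnn f"
proof -
  assume [measurable]: "f \<in> borel_measurable borel" and R: "0 \<le> R"
  have "(\<integral>\<^sup>+x. ennreal \<bar>f x\<bar> * indicator {-R..R} x \<partial>lborel) \<le> (\<integral>\<^sup>+x. ennreal (1 + R\<^sup>2) * ennreal (\<bar>f x\<bar> / (1 + x\<^sup>2)) \<partial>lborel)"
  proof (rule nn_integral_mono)
    fix x
    have "\<bar>f x\<bar> \<le> (1 + R\<^sup>2) * (\<bar>f x\<bar> / (1 + x\<^sup>2))" if "x \<in> {-R..R}"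
    proof -
      have "x\<^sup>2 \<le> R\<^sup>2" using that by (intro abs_le_square_iff[THEN iffD1]) auto
      then have "\<bar>f x\<bar> * (1 + x\<^sup>2) \<le> \<bar>f x\<bar> * (1 + R\<^sup>2)" by (intro mult_left_mono) auto
      then show ?thesis by (simp add: pos_le_divide_eq mult.commute)
    qed
    then show "ennreal \<bar>f x\<bar> * indicator {-R..R} x \<le> ennreal (1 + R\<^sup>2) * ennreal (\<bar>f x\<bar> / (1 + x\<^sup>2))"
      by (auto simp: indicator_def ennreal_mult'[symmetric] intro!: ennreal_leI simp del: ennreal_plus)
  qed
  also have "\<dots> = ennreal (1 + R\<^sup>2) * wnn f" unfolding wnn_def by (rule nn_integral_cmult) measurable
  finally show ?thesis .
qed

definition loc_conv :: "(real \<Rightarrow> real) \<Rightarrow> real \<Rightarrow> (real \<Rightarrow> real) \<Rightarrow> bool" where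
  "loc_conv h R f \<longleftrightarrow> f \<in> borel_measurable borel \<and> weighted f \<and> (\<lambda>m. loc_err h R m f) \<longlonglongrightarrow> 0"

context
  fixes h :: "real \<Rightarrow> real"
  assumes h: "low_pass_filter h"
begin

lemma loc_err_measurable:
  assumes "f \<in> borel_measurable borel" "weighted f"
  shows "(\<lambda>x. ennreal \<bar>sigma_op h (2 ^ m) f x - f x\<bar> * indicator {-R..R} x) \<in> borel_measurable borel"
proof -
  have [measurable]: "sigma_op h (2 ^ m) f \<in> borel_measurable borel" by (rule sigma_measurable[OF h assms(2)]) simp
  show ?thesis using assms(1) by measurable
qed

lemma loc_err_diff:
  assumes f: "f \<in> borel_measurable borel" "weighted f" and g: "g \<in> borel_measurable borel" "weighted g"
  shows "loc_err h R m (\<lambda>x. f x - g x) \<le> loc_err h R m f + loc_err h R m g"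
proof -
  have "loc_err h R m (\<lambda>x. f x - g x) \<le> (\<integral>\<^sup>+x. ennreal \<bar>sigma_op h (2 ^ m) f x - f x\<bar> * indicator {-R..R} x +
      ennreal \<bar>sigma_op h (2 ^ m) g x - g x\<bar> * indicator {-R..R} x \<partial>lborel)"
    unfolding loc_err_def
  proof (rule nn_integral_mono)
    fix x
    have "\<bar>sigma_op h (2 ^ m) (\<lambda>x. f x - g x) x - (f x - g x)\<bar> \<le>
        \<bar>sigma_op h (2 ^ m) f x - f x\<bar> + \<bar>sigma_op h (2 ^ m) g x - g x\<bar>"
      by (subst sigma_diff[OF h f(2) g(2)]) auto
    then show "ennreal \<bar>sigma_op h (2 ^ m) (\<lambda>x. f x - g x) x - (f x - g x)\<bar> * indicator {-R..R} x \<le>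
      ennreal \<bar>sigma_op h (2 ^ m) f x - f x\<bar> * indicator {-R..R} x + ennreal \<bar>sigma_op h (2 ^ m) g x - g x\<bar> * indicator {-R..R} x"
      by (auto simp: indicator_def ennreal_plus[symmetric] intro!: ennreal_leI simp del: ennreal_plus)
  qed
  also have "\<dots> = loc_err h R m f + loc_err h R m g"
    unfolding loc_err_def using loc_err_measurable[OF f] loc_err_measurable[OF g] by (intro nn_integral_add) auto
  finally show ?thesis .
qed

lemma loc_conv_diff: "loc_conv h R f \<Longrightarrow> loc_conv h R g \<Longrightarrow> loc_conv h R (\<lambda>x. f x - g x)"
proof -
  assume f: "loc_conv h R f" and g: "loc_conv h R g"
  have "(\<lambda>m. loc_err h R m f + loc_err h R m g) \<longlonglongrightarrow> 0 + 0"
    using f g unfolding loc_conv_def by (intro tendsto_add) auto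
  then have lim: "(\<lambda>m. loc_err h R m f + loc_err h R m g) \<longlonglongrightarrow> 0" by simp
  have "(\<lambda>m. loc_err h R m (\<lambda>x. f x - g x)) \<longlonglongrightarrow> 0"
    by (rule tendsto_sandwich[OF _ _ tendsto_const lim]) (use f g in \<open>auto simp: loc_conv_def intro!: always_eventually loc_err_diff\<close>)
  then show ?thesis using f g by (auto simp: loc_conv_def weighted_diff)
qed

lemma loc_conv_cmult: assumes f: "loc_conv h R f" shows "loc_conv h R (\<lambda>x. c * f x)"
proof -
  have "loc_err h R m (\<lambda>x. c * f x) = ennreal \<bar>c\<bar> * loc_err h R m f" for m
  proof -
    have "loc_err h R m (\<lambda>x. c * f x) = (\<integral>\<^sup>+x. ennreal \<bar>c\<bar> * (ennreal \<bar>sigma_op h (2 ^ m) f x - f x\<bar> * indicator {-R..R} x) \<partial>lborel)"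
      unfolding loc_err_def sigma_cmult[OF h]
      by (intro nn_integral_cong) (auto simp: indicator_def abs_mult ennreal_mult'[symmetric] simp flip: right_diff_distrib)
    also have "\<dots> = ennreal \<bar>c\<bar> * loc_err h R m f"
      unfolding loc_err_def using f by (intro nn_integral_cmult) (auto simp: loc_conv_def intro: loc_err_measurable)
    finally show ?thesis .
  qed
  moreover have "(\<lambda>m. ennreal \<bar>c\<bar> * loc_err h R m f) \<longlonglongrightarrow> ennreal \<bar>c\<bar> * 0"
    using f by (intro tendsto_mult_ennreal tendsto_const) (auto simp: loc_conv_def)
  ultimately have "(\<lambda>m. loc_err h R m (\<lambda>x. c * f x)) \<longlonglongrightarrow> 0" by simp
  then show ?thesis
    using f weighted_mult_bounded[of f "\<lambda>x. c" "\<bar>c\<bar>"] by (auto simp: loc_conv_def)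
qed

lemma loc_conv_add: "loc_conv h R f \<Longrightarrow> loc_conv h R g \<Longrightarrow> loc_conv h R (\<lambda>x. f x + g x)"
  using loc_conv_diff[of R f "\<lambda>x. - 1 * g x"] loc_conv_cmult[of R g "- 1"] by simp

text \<open>The operators are uniformly bounded from the weighted space to \<open>L^1\<close> of the
  interval, so convergence passes to limits in the weighted norm. The hypotheses on \<open>s\<close>
  are those that \<open>integrable_induct\<close> supplies.\<close>

lemma loc_conv_limit:
  assumes R: "0 \<le> R" and s: "\<And>i. loc_conv h R (s i)" and f: "f \<in> borel_measurable borel" "weighted f"
    and lim: "\<And>x. (\<lambda>i. s i x) \<longlonglongrightarrow> f x" and le: "\<And>i x. \<bar>s i x\<bar> \<le> 2 * \<bar>f x\<bar>"
  shows "loc_conv h R f"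
proof -
  note [measurable] = f(1)
  have [measurable]: "s i \<in> borel_measurable borel" for i using s by (auto simp: loc_conv_def)
  have ws: "weighted (s i)" for i using s by (auto simp: loc_conv_def)
  obtain D where D: "0 \<le> D" "\<And>n f. n \<ge> 1 \<Longrightarrow> f \<in> borel_measurable borel \<Longrightarrow> weighted f \<Longrightarrow>
    (\<integral>\<^sup>+x. ennreal \<bar>sigma_op h n f x\<bar> * indicator {-R..R} x \<partial>lborel) \<le> ennreal D * wnn f"
    using loc_sigma_le[OF h R] by blast
  define K where "K = D + (1 + R\<^sup>2)"
  have K: "loc_err h R m g \<le> ennreal K * wnn g" if g: "g \<in> borel_measurable borel" "weighted g" for g m
  proof -
    have [measurable]: "sigma_op h (2 ^ m) g \<in> borel_measurable borel" by (rule sigma_measurable[OF h g(2)]) simp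
    note [measurable] = g(1)
    have "loc_err h R m g \<le> (\<integral>\<^sup>+x. ennreal \<bar>sigma_op h (2 ^ m) g x\<bar> * indicator {-R..R} x + ennreal \<bar>g x\<bar> * indicator {-R..R} x \<partial>lborel)"
      unfolding loc_err_def
      by (intro nn_integral_mono)
         (auto simp: indicator_def ennreal_plus[symmetric] intro!: ennreal_leI simp del: ennreal_plus)
    also have "\<dots> = (\<integral>\<^sup>+x. ennreal \<bar>sigma_op h (2 ^ m) g x\<bar> * indicator {-R..R} x \<partial>lborel) + (\<integral>\<^sup>+x. ennreal \<bar>g x\<bar> * indicator {-R..R} x \<partial>lborel)"
      by (rule nn_integral_add) measurable
    also have "\<dots> \<le> ennreal D * wnn g + ennreal (1 + R\<^sup>2) * wnn g"
      by (intro add_mono D(2) wnn_abs_le g R) auto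
    also have "\<dots> = ennreal K * wnn g" using D(1) by (simp add: K_def distrib_right)
    finally show ?thesis .
  qed
  have wd: "(\<lambda>i. wnn (\<lambda>x. f x - s i x)) \<longlonglongrightarrow> 0"
    unfolding wnn_def
  proof (rule nn_integral_dominated_convergence_0[where w = "\<lambda>x. ennreal 3 * ennreal (\<bar>f x\<bar> / (1 + x\<^sup>2))"])
    have "(\<integral>\<^sup>+x. ennreal 3 * ennreal (\<bar>f x\<bar> / (1 + x\<^sup>2)) \<partial>lborel) = ennreal 3 * wnn f"
      unfolding wnn_def by (rule nn_integral_cmult) measurable
    also have "\<dots> < \<infinity>" using f weighted_borel_iff[OF f(1)] by (simp add: ennreal_mult_less_top)
    finally show "(\<integral>\<^sup>+x. ennreal 3 * ennreal (\<bar>f x\<bar> / (1 + x\<^sup>2)) \<partial>lborel) < \<infinity>" .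
    show "AE x in lborel. ennreal (\<bar>f x - s i x\<bar> / (1 + x\<^sup>2)) \<le> ennreal 3 * ennreal (\<bar>f x\<bar> / (1 + x\<^sup>2))" for i
    proof (rule AE_I2)
      fix x
      have "\<bar>f x - s i x\<bar> \<le> 3 * \<bar>f x\<bar>" using le[of i x] by linarith
      then have "\<bar>f x - s i x\<bar> / (1 + x\<^sup>2) \<le> 3 * \<bar>f x\<bar> / (1 + x\<^sup>2)" by (intro divide_right_mono) auto
      then show "ennreal (\<bar>f x - s i x\<bar> / (1 + x\<^sup>2)) \<le> ennreal 3 * ennreal (\<bar>f x\<bar> / (1 + x\<^sup>2))"
        by (subst ennreal_mult'[symmetric]) (auto intro!: ennreal_leI)
    qed
    show "AE x in lborel. (\<lambda>i. ennreal (\<bar>f x - s i x\<bar> / (1 + x\<^sup>2))) \<longlonglongrightarrow> 0"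
    proof (rule AE_I2)
      fix x
      have "(\<lambda>i. \<bar>f x - s i x\<bar> / (1 + x\<^sup>2)) \<longlonglongrightarrow> \<bar>f x - f x\<bar> / (1 + x\<^sup>2)"
        by (intro tendsto_intros lim) simp
      then have "(\<lambda>i. ennreal (\<bar>f x - s i x\<bar> / (1 + x\<^sup>2))) \<longlonglongrightarrow> ennreal (\<bar>f x - f x\<bar> / (1 + x\<^sup>2))"
        by (rule tendsto_ennrealI)
      then show "(\<lambda>i. ennreal (\<bar>f x - s i x\<bar> / (1 + x\<^sup>2))) \<longlonglongrightarrow> 0" by simp
    qed
  qed measurable
  then have wd': "(\<lambda>i. ennreal K * wnn (\<lambda>x. f x - s i x)) \<longlonglongrightarrow> ennreal K * 0"
    by (intro tendsto_mult_ennreal tendsto_const) auto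
  have le2: "loc_err h R m f \<le> loc_err h R m (s i) + ennreal K * wnn (\<lambda>x. f x - s i x)" for m i
  proof -
    have d: "(\<lambda>x. f x - s i x) \<in> borel_measurable borel" "weighted (\<lambda>x. f x - s i x)"
      using f ws by (auto intro: weighted_diff)
    have n: "(\<lambda>x. s i x - f x) \<in> borel_measurable borel" "weighted (\<lambda>x. s i x - f x)"
      using f ws by (auto intro: weighted_diff)
    have "loc_err h R m f = loc_err h R m (\<lambda>x. s i x - (s i x - f x))" by simp
    also have "\<dots> \<le> loc_err h R m (s i) + loc_err h R m (\<lambda>x. s i x - f x)"
      by (rule loc_err_diff[OF _ ws n]) measurable
    also have "\<dots> \<le> loc_err h R m (s i) + ennreal K * wnn (\<lambda>x. s i x - f x)"
      by (intro add_left_mono K n)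
    also have "wnn (\<lambda>x. s i x - f x) = wnn (\<lambda>x. f x - s i x)" by (simp add: wnn_def abs_minus_commute)
    finally show ?thesis .
  qed
  have "(\<lambda>m. loc_err h R m f) \<longlonglongrightarrow> 0"
  proof (rule order_tendstoI)
    fix a :: ennreal assume "0 < a"
    then obtain b where b: "0 < b" "b < a" using dense by blast
    obtain c where c: "0 < c" "c + c \<le> b"
    proof (cases "b = top")
      case True
      with that[of 1] show ?thesis by simp
    next
      case False
      then obtain t where "b = ennreal t" "0 \<le> t" by (cases b) auto
      with b show ?thesis using that[of "ennreal (t / 2)"] by (simp flip: ennreal_plus)
    qed
    from order_tendstoD(2)[OF wd', of c] c obtain i where i: "ennreal K * wnn (\<lambda>x. f x - s i x) < c"
      by (auto simp: eventually_sequentially)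
    have "eventually (\<lambda>m. loc_err h R m (s i) < c) sequentially"
      using s[of i] c by (intro order_tendstoD(2)) (auto simp: loc_conv_def)
    then show "eventually (\<lambda>m. loc_err h R m f < a) sequentially"
    proof eventually_elim
      case (elim m)
      have "loc_err h R m f \<le> loc_err h R m (s i) + ennreal K * wnn (\<lambda>x. f x - s i x)" by (rule le2)
      also have "\<dots> \<le> c + c" using elim i by (intro add_mono) auto
      also have "\<dots> \<le> b" by (rule c)
      also have "\<dots> < a" by (rule b)
      finally show ?case .
    qed
  qed simp
  then show ?thesis using f by (simp add: loc_conv_def)
qed

lemma loc_conv_bounded:
  assumes R: "0 \<le> R" and f: "f \<in> borel_measurable borel" "\<And>x. \<bar>f x\<bar> \<le> M" "\<And>x. x \<noteq> a \<Longrightarrow> isCont f x"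
  shows "loc_conv h R f"
proof -
  have wf: "weighted f" using weighted_bounded[OF f(1,2)] .
  obtain C where C: "0 < C" "\<And>n x y. n \<ge> 1 \<Longrightarrow> \<bar>kernel h n x y\<bar> \<le> C * (n / (1 + (n * (x - y))\<^sup>2))"
    using poisson_bound[OF h] by blast
  have M: "0 \<le> M" using order_trans[OF abs_ge_zero f(2)] .
  have "(\<lambda>m. loc_err h R m f) \<longlonglongrightarrow> 0"
    unfolding loc_err_def
  proof (rule nn_integral_dominated_convergence_0[where w = "\<lambda>x. ennreal (C * pi * M + M) * indicator {-R..R} x"])
    show "(\<lambda>x. ennreal \<bar>sigma_op h (2 ^ m) f x - f x\<bar> * indicator {-R..R} x) \<in> borel_measurable lborel" for m
      using loc_err_measurable[OF f(1) wf] by simp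
    show "AE x in lborel. ennreal \<bar>sigma_op h (2 ^ m) f x - f x\<bar> * indicator {-R..R} x \<le> ennreal (C * pi * M + M) * indicator {-R..R} x" for m
    proof (rule AE_I2)
      fix x
      have "\<bar>sigma_op h (2 ^ m) f x\<bar> \<le> C * pi * M" by (rule sigma_abs_bounded[OF h C f(1,2)]) auto
      then have "\<bar>sigma_op h (2 ^ m) f x - f x\<bar> \<le> C * pi * M + M" using f(2)[of x] by linarith
      then show "ennreal \<bar>sigma_op h (2 ^ m) f x - f x\<bar> * indicator {-R..R} x \<le> ennreal (C * pi * M + M) * indicator {-R..R} x"
        by (intro mult_right_mono ennreal_leI) auto
    qed
    show "(\<integral>\<^sup>+x. ennreal (C * pi * M + M) * indicator {-R..R} x \<partial>lborel) < \<infinity>"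
      using R by (subst nn_integral_cmult_indicator) (auto simp: ennreal_mult_less_top simp del: ennreal_plus)
    have "AE x in lborel. x \<noteq> a" by (rule AE_lborel_singleton)
    then show "AE x in lborel. (\<lambda>m. ennreal \<bar>sigma_op h (2 ^ m) f x - f x\<bar> * indicator {-R..R} x) \<longlonglongrightarrow> 0"
    proof eventually_elim
      case (elim x)
      have "(\<lambda>m. sigma_op h (2 ^ m) f x - f x) \<longlonglongrightarrow> 0"
        using sigma_tendsto[OF h f(1,2) f(3)[OF elim]] by (rule LIM_zero)
      then have "(\<lambda>m. ennreal \<bar>sigma_op h (2 ^ m) f x - f x\<bar>) \<longlonglongrightarrow> ennreal 0"
        by (intro tendsto_ennrealI tendsto_rabs_zero)
      then show ?case by (cases "x \<in> {-R..R}") auto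
    qed
  qed measurable
  then show ?thesis using f wf by (simp add: loc_conv_def)
qed

text \<open>Half-lines generate the Borel sets and are stable under intersection; complements follow
  by linearity, disjoint unions by \<open>loc_conv_limit\<close> from finite ones.\<close>

lemma loc_conv_indicator:
  assumes R: "0 \<le> R" and A: "A \<in> sets borel" shows "loc_conv h R (indicator A)"
proof -
  have one: "loc_conv h R (\<lambda>x. 1)" by (rule loc_conv_bounded[OF R, of _ 1]) auto
  have "sets borel = sigma_sets UNIV (range (\<lambda>a::real. {..a}))"
    by (simp add: borel_eq_atMost)
  with A have A: "A \<in> sigma_sets UNIV (range (\<lambda>a::real. {..a}))" by simp
  have I: "Int_stable (range (\<lambda>a::real. {..a}))" by (auto simp: Int_stable_def)
  have P: "range (\<lambda>a::real. {..a}) \<subseteq> Pow UNIV" by simp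
  from I P A show ?thesis
  proof (induction rule: sigma_sets_induct_disjoint)
    case (basic A)
    then obtain a where a: "A = {..a}" by auto
    show ?case
    proof (rule loc_conv_bounded[OF R, of _ 1 a])
      fix x assume "x \<noteq> a"
      then consider "x < a" | "a < x" by linarith
      then show "isCont (indicator A :: real \<Rightarrow> real) x"
      proof cases
        case 1
        then have "eventually (\<lambda>y. indicator A y = (1::real)) (nhds x)"
          using eventually_nhds_in_open[of "{..<a}" x] by (auto elim!: eventually_mono simp: a)
        then show ?thesis using isCont_cong by force
      next
        case 2
        then have "eventually (\<lambda>y. indicator A y = (0::real)) (nhds x)"
          using eventually_nhds_in_open[of "{a<..}" x] by (auto elim!: eventually_mono simp: a)
        then show ?thesis using isCont_cong by force
      qed
    qed (auto simp: a indicator_def)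
  next
    case empty
    have "loc_conv h R (\<lambda>x. 0 * 1)" by (rule loc_conv_cmult[OF one])
    then show ?case by (simp add: indicator_def[abs_def])
  next
    case (compl A)
    have "loc_conv h R (\<lambda>x. 1 - indicator A x)" by (rule loc_conv_diff[OF one compl(2)])
    moreover have "(\<lambda>x. 1 - indicator A x) = (indicator (UNIV - A) :: real \<Rightarrow> real)" by (auto simp: indicator_def fun_eq_iff)
    ultimately show ?case by simp
  next
    case (union A)
    let ?s = "\<lambda>i. indicator (\<Union>k<i. A k) :: real \<Rightarrow> real"
    have meas: "A k \<in> sets borel" for k using union(2) by (auto simp: borel_eq_atMost)
    have s: "loc_conv h R (?s i)" for i
    proof (induction i)
      case 0
      have "loc_conv h R (\<lambda>x. 0 * 1)" by (rule loc_conv_cmult[OF one])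
      then show ?case by (simp add: indicator_def[abs_def])
    next
      case (Suc i)
      have "A i \<inter> A k = {}" if "k < i" for k
        using union(1) that by (simp add: disjoint_family_on_def)
      then have "A i \<inter> (\<Union>k<i. A k) = {}" by blast
      then have "?s (Suc i) = (\<lambda>x. ?s i x + indicator (A i) x)"
        by (simp add: fun_eq_iff lessThan_Suc add.commute indicator_disj_union)
      then show ?case using loc_conv_add[OF Suc union(3)[of i]] by simp
    qed
    show ?case
    proof (rule loc_conv_limit[OF R s])
      show "indicator (\<Union>(range A)) \<in> borel_measurable (borel :: real measure)" using meas by auto
      then show "weighted (indicator (\<Union>(range A)))" by (rule weighted_bounded[of _ 1]) (auto simp: indicator_def)
      show "(\<lambda>i. ?s i x) \<longlonglongrightarrow> indicator (\<Union>(range A)) x" for x by (rule LIMSEQ_indicator_UN)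
      show "\<bar>?s i x\<bar> \<le> 2 * \<bar>indicator (\<Union>(range A)) x\<bar>" for i x by (auto simp: indicator_def)
    qed
  qed
qed

lemma loc_conv_weighted:
  assumes R: "0 \<le> R" and f: "f \<in> borel_measurable borel" "weighted f"
  shows "loc_conv h R f"
proof -
  \<comment> \<open>Borel functions are weighted exactly if they are integrable for this measure, so
    the induction over integrable functions reaches all of them.\<close>
  define \<mu> where "\<mu> = density lborel (\<lambda>x. ennreal (1 / (1 + x\<^sup>2)))"
  have int: "integrable \<mu> g \<longleftrightarrow> g \<in> borel_measurable borel \<and> weighted g" for g :: "real \<Rightarrow> real"
  proof (cases "g \<in> borel_measurable borel")
    case [measurable]: True
    have "integrable \<mu> g \<longleftrightarrow> integrable lborel (\<lambda>x. (1 / (1 + x\<^sup>2)) *\<^sub>R g x)"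
      unfolding \<mu>_def by (rule integrable_density) (auto intro!: AE_I2)
    also have "\<dots> \<longleftrightarrow> weighted g"
      using lebesgue_measurable_borel[OF True] by (simp add: weighted_def integrable_completion)
    finally show ?thesis using True by simp
  next
    case False
    then show ?thesis using borel_measurable_integrable[of \<mu> g] by (auto simp: \<mu>_def)
  qed
  from f have "integrable \<mu> f" by (simp add: int)
  then show ?thesis
  proof (induction rule: integrable_induct)
    case (base A c)
    have "A \<in> sets borel" using base by (simp add: \<mu>_def)
    from loc_conv_cmult[OF loc_conv_indicator[OF R this], of c] show ?case by (simp add: mult.commute)
  next
    case (add f g)
    show ?case by (rule loc_conv_add[OF add(3,4)])
  next
    case (lim f s)
    show ?case
      by (rule loc_conv_limit[OF R lim(5)]) (use lim int in \<open>auto simp: \<mu>_def\<close>)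
  qed
qed

lemma sigma_AE_subseq:
  assumes f: "weighted f"
  obtains r where "strict_mono (r :: nat \<Rightarrow> nat)"
    "AE x in lebesgue. x \<in> {-R..R} \<longrightarrow> (\<lambda>k. sigma_op h (2 ^ r k) f x) \<longlonglongrightarrow> f x"
proof -
  define R' where "R' = max R 0"
  obtain g where g: "g \<in> borel_measurable borel" "AE x in lebesgue. f x = g x"
    using borel_version[OF weighted_measurable[OF f]] by blast
  have wg: "weighted g" using weighted_cong_AE[OF f g] by blast
  have sg: "sigma_op h (2 ^ m) g = sigma_op h (2 ^ m) f" for m
    using sigma_cong_AE[OF h g(2) f wg] by simp
  have lim: "(\<lambda>m. loc_err h R' m g) \<longlonglongrightarrow> 0"
    using loc_conv_weighted[OF _ g(1) wg, of R'] by (simp add: loc_conv_def R'_def)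
  then have "eventually (\<lambda>m. loc_err h R' m g < 1) sequentially" by (rule order_tendstoD) simp
  then obtain N where N: "\<And>m. m \<ge> N \<Longrightarrow> loc_err h R' m g < 1" by (auto simp: eventually_sequentially)
  \<comment> \<open>The shift by \<open>N\<close> discards the indices at which the error is not yet
    known to be finite, since every member of the sequence must be integrable.\<close>
  let ?u = "\<lambda>m x. (sigma_op h (2 ^ (m + N)) g x - g x) * indicator {-R'..R'} x"
  have [measurable]: "sigma_op h (2 ^ m) g \<in> borel_measurable borel" for m by (rule sigma_measurable[OF h wg]) simp
  note [measurable] = g(1)
  have nn: "(\<integral>\<^sup>+x. ennreal (norm (?u m x)) \<partial>lborel) = loc_err h R' (m + N) g" for m
    unfolding loc_err_def by (intro nn_integral_cong) (auto simp: indicator_def)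
  have int: "integrable lborel (?u m)" for m
  proof -
    have "loc_err h R' (m + N) g < top" using N[of "m + N"] by (simp add: less_trans[OF _ ennreal_one_less_top])
    then show ?thesis unfolding integrable_iff_bounded nn by simp
  qed
  have "(\<lambda>m. ennreal (\<integral>x. norm (?u m x) \<partial>lborel)) \<longlonglongrightarrow> ennreal 0"
  proof -
    have "ennreal (\<integral>x. norm (?u m x) \<partial>lborel) = loc_err h R' (m + N) g" for m
      using nn_integral_eq_integral[OF integrable_norm[OF int[of m]]] nn[of m] by simp
    then show ?thesis using LIMSEQ_ignore_initial_segment[OF lim, of N] by simp
  qed
  then have "(\<lambda>m. \<integral>x. norm (?u m x) \<partial>lborel) \<longlonglongrightarrow> 0"
    by (subst (asm) tendsto_ennreal_iff) auto
  from tendsto_L1_AE_subseq[OF int this]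
  obtain r where r: "strict_mono r" "AE x in lborel. (\<lambda>k. ?u (r k) x) \<longlonglongrightarrow> 0" by blast
  have "AE x in lebesgue. (\<lambda>k. ?u (r k) x) \<longlonglongrightarrow> 0" using r(2) by (rule AE_completion)
  with g(2) have "AE x in lebesgue. x \<in> {-R..R} \<longrightarrow> (\<lambda>k. sigma_op h (2 ^ (r k + N)) f x) \<longlonglongrightarrow> f x"
  proof eventually_elim
    case (elim x)
    show ?case
    proof
      assume "x \<in> {-R..R}"
      then have "x \<in> {-R'..R'}" by (auto simp: R'_def)
      with elim have "(\<lambda>k. sigma_op h (2 ^ (r k + N)) g x - g x) \<longlonglongrightarrow> 0" by simp
      then show "(\<lambda>k. sigma_op h (2 ^ (r k + N)) f x) \<longlonglongrightarrow> f x" using elim by (simp add: sg LIM_zero_iff)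
    qed
  qed
  moreover have "strict_mono (\<lambda>k. r k + N)" using r(1) by (simp add: strict_mono_def)
  ultimately show ?thesis using that by blast
qed

section \<open>The error as a tail of the series of \<open>tau_op\<close>\<close>

lemma tau_measurable: "weighted f \<Longrightarrow> tau_op h n f \<in> borel_measurable lebesgue"
proof (cases n)
  case 0
  assume "weighted f"
  from sigma_measurable[OF h this, of 1] have "sigma_op h 1 f \<in> borel_measurable lebesgue"
    by (auto intro!: lebesgue_measurable_borel)
  moreover have "tau_op h n f = sigma_op h 1 f" by (simp add: 0 fun_eq_iff)
  ultimately show ?thesis by simp
next
  case (Suc m)
  assume f: "weighted f"
  have "(\<lambda>x. sigma_op h (2 ^ Suc m) f x - sigma_op h (2 ^ m) f x) \<in> borel_measurable borel"
    by (intro borel_measurable_diff sigma_measurable[OF h f]) auto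
  moreover have "tau_op h n f = (\<lambda>x. sigma_op h (2 ^ Suc m) f x - sigma_op h (2 ^ m) f x)"
    by (simp add: Suc fun_eq_iff)
  ultimately show ?thesis by (auto intro: lebesgue_measurable_borel)
qed

lemma sigma_telescope:
  "sigma_op h (2 ^ (n + K)) f x - sigma_op h (2 ^ n) f x = (\<Sum>k<K. tau_op h (Suc (n + k)) f x)"
  by (induction K) auto

lemma sigma_error_le_tail:
  assumes f: "weighted f" and p: "1 \<le> p"
  shows "Lp_norm p (cball x0 \<delta>) (\<lambda>x. f x - sigma_op h (2 ^ n) f x) \<le>
    (\<Sum>k. Lp_norm p (cball x0 \<delta>) (tau_op h (Suc (n + k)) f))"
proof (cases "(\<Sum>k. Lp_norm p (cball x0 \<delta>) (tau_op h (Suc (n + k)) f)) = top")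
  case False
  let ?B = "cball x0 \<delta>"
  obtain s where s: "0 \<le> s" "(\<Sum>k. Lp_norm p ?B (tau_op h (Suc (n + k)) f)) = ennreal s"
    using False by (cases "\<Sum>k. Lp_norm p ?B (tau_op h (Suc (n + k)) f)") auto
  define R where "R = \<bar>x0\<bar> + \<bar>\<delta>\<bar>"
  have sub: "x \<in> {-R..R}" if "x \<in> ?B" for x using that by (auto simp: R_def dist_real_def)
  obtain r where r: "strict_mono (r :: nat \<Rightarrow> nat)"
    "AE x in lebesgue. x \<in> {-R..R} \<longrightarrow> (\<lambda>k. sigma_op h (2 ^ r k) f x) \<longlonglongrightarrow> f x"
    using sigma_AE_subseq[OF f] by blast
  have sm: "sigma_op h (2 ^ m) f \<in> borel_measurable lebesgue" for m
    by (intro lebesgue_measurable_borel sigma_measurable[OF h f]) auto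
  have "Lp_norm p ?B (\<lambda>x. f x - sigma_op h (2 ^ n) f x) \<le> ennreal s"
  proof (rule Lp_norm_Fatou[OF _ _ _ p _ s(1)])
    \<comment> \<open>Since \<open>r (n + k)\<close> is at least \<open>n\<close>, each difference
      is a finite sum of consecutive \<open>tau_op\<close> terms and its norm is at most the
      tail.\<close>
    let ?u = "\<lambda>k x. sigma_op h (2 ^ (r (n + k))) f x - sigma_op h (2 ^ n) f x"
    show "?u k \<in> borel_measurable lebesgue" for k using sm by simp
    show "(\<lambda>x. f x - sigma_op h (2 ^ n) f x) \<in> borel_measurable lebesgue" using sm weighted_measurable[OF f] by simp
    show "AE x in lebesgue. x \<in> ?B \<longrightarrow> (\<lambda>k. ?u k x) \<longlonglongrightarrow> f x - sigma_op h (2 ^ n) f x"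
      using r(2)
    proof eventually_elim
      case (elim x)
      show ?case
      proof
        assume "x \<in> ?B"
        with elim sub have "(\<lambda>k. sigma_op h (2 ^ r k) f x) \<longlonglongrightarrow> f x" by blast
        from LIMSEQ_ignore_initial_segment[OF this, of n]
        show "(\<lambda>k. ?u k x) \<longlonglongrightarrow> f x - sigma_op h (2 ^ n) f x"
          by (intro tendsto_diff tendsto_const) (simp add: add.commute)
      qed
    qed
    show "Lp_norm p ?B (?u k) \<le> ennreal s" for k
    proof -
      have "n \<le> r (n + k)" using seq_suble[OF r(1), of "n + k"] by simp
      then obtain K where K: "r (n + k) = n + K" using le_Suc_ex by blast
      have "Lp_norm p ?B (\<lambda>x. \<Sum>k<K. tau_op h (Suc (n + k)) f x) \<le> (\<Sum>k<K. Lp_norm p ?B (tau_op h (Suc (n + k)) f))"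
        by (rule Lp_norm_sum_le) (use tau_measurable[OF f] p in \<open>auto simp del: tau_op.simps\<close>)
      also have "\<dots> \<le> ennreal s" unfolding s(2)[symmetric] by (rule sum_le_suminf) auto
      finally show ?thesis unfolding K sigma_telescope .
    qed
  qed auto
  then show ?thesis using s by simp
qed simp

end

section \<open>Approximation of localized functions\<close>

context
  fixes h :: "real \<Rightarrow> real"
  assumes h: "low_pass_filter h"
begin

lemma hcoef_mult_sigma:
  assumes \<phi>: "test_fun R \<phi>" and f: "weighted f" and n: "0 < n"
  shows "hcoef (\<lambda>x. \<phi> x * sigma_op h n f x) j = (\<Sum>i<cutoff n. coef h n i * hcoef f i * mel \<phi> i j)"
proof -
  have [measurable]: "\<phi> \<in> borel_measurable borel" using \<phi> by (auto simp: test_fun_def intro: smooth_borel_measurable)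
  have [measurable]: "sigma_op h n f \<in> borel_measurable borel" by (rule sigma_measurable[OF h f n])
  have "hcoef (\<lambda>x. \<phi> x * sigma_op h n f x) j = (\<integral>x. \<phi> x * sigma_op h n f x * hermite_fun j x \<partial>lborel)"
    by (rule hcoef_borel) measurable
  also have "\<dots> = (\<integral>x. (\<Sum>i<cutoff n. coef h n i * hcoef f i * (\<phi> x * hermite_fun i x * hermite_fun j x)) \<partial>lborel)"
    by (intro Bochner_Integration.integral_cong refl)
       (simp add: sigma_eq_sum[OF h f n] sum_distrib_left sum_distrib_right mult_ac)
  also have "\<dots> = (\<Sum>i<cutoff n. coef h n i * hcoef f i * mel \<phi> i j)"
    unfolding mel_def
    by (subst Bochner_Integration.integral_sum) (auto intro!: integrable_mult_right mel_integrable[OF \<phi>])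
  finally show ?thesis .
qed

text \<open>For \<open>i < n\<^sup>2\<close> and \<open>j \<ge> 4 n\<^sup>2\<close> the ratio in the decay estimate is at most \<open>2 n / j\<close>, which is at
  most both \<open>1 / n\<close> and \<open>1 / sqrt j\<close>.\<close>

lemma mel_ratio_le:
  assumes n: "1 \<le> n" and i: "i < cutoff n" and j: "4 * n\<^sup>2 \<le> real j"
  shows "i < j" "(sqrt (real (2 * i + 1)) / (real (2 * j) - real (2 * i))) ^ (a + 12) \<le> (1 / n) ^ a * (1 / real j) ^ 6"
proof -
  have n2: "1 \<le> n\<^sup>2" using n by simp
  have i2: "real i < n\<^sup>2" using i unfolding cutoff_def by linarith
  have ij: "4 * real i < real j" using i2 j by linarith
  then show "i < j" by linarith
  have jp: "0 < real j" using j n2 by linarith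
  define r where "r = sqrt (real (2 * i + 1)) / (real (2 * j) - real (2 * i))"
  have r0: "0 \<le> r" using ij unfolding r_def by (intro divide_nonneg_nonneg) auto
  have "real (2 * i + 1) \<le> (2 * n)\<^sup>2" using i2 n2 by (simp add: power_mult_distrib)
  then have "sqrt (real (2 * i + 1)) \<le> 2 * n" using n by (intro real_le_lsqrt) auto
  then have "r \<le> 2 * n / real j"
    unfolding r_def using ij jp n by (intro frac_le) auto
  moreover have "2 * n / real j \<le> 1 / n"
  proof -
    have "2 * n * n \<le> real j" using j n2 by (simp add: power2_eq_square)
    then show ?thesis using n jp by (simp add: field_simps)
  qed
  moreover have "(2 * n / real j)\<^sup>2 \<le> 1 / real j"
  proof -
    have "(2 * n)\<^sup>2 * real j \<le> real j * real j" using j jp by (intro mult_right_mono) (auto simp: power_mult_distrib)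
    then show ?thesis using jp by (simp add: power_divide field_simps power2_eq_square)
  qed
  moreover have "r\<^sup>2 \<le> (2 * n / real j)\<^sup>2"
    using r0 \<open>r \<le> 2 * n / real j\<close> by (rule power_mono[rotated])
  ultimately have r1: "r \<le> 1 / n" and r2: "r\<^sup>2 \<le> 1 / real j"
    by linarith+
  have "r ^ (a + 12) = r ^ a * (r\<^sup>2) ^ 6" by (simp add: power_add power_mult[symmetric])
  also have "\<dots> \<le> (1 / n) ^ a * (1 / real j) ^ 6"
    using r0 r1 r2 n by (intro mult_mono power_mono) auto
  finally show "(sqrt (real (2 * i + 1)) / (real (2 * j) - real (2 * i))) ^ (a + 12) \<le> (1 / n) ^ a * (1 / real j) ^ 6"
    unfolding r_def .
qed

lemma hcoef_mult_sigma_decay: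
  assumes \<phi>: "test_fun R \<phi>" and R: "0 \<le> R"
  shows "\<exists>C\<ge>0. \<forall>n\<ge>1. \<forall>f j. weighted f \<longrightarrow> 4 * n\<^sup>2 \<le> real j \<longrightarrow>
    \<bar>hcoef (\<lambda>x. \<phi> x * sigma_op h n f x) j\<bar> \<le> C * n powr (- real S) * wnorm f * (1 / real j) ^ 5"
proof -
  \<comment> \<open>Ten powers of \<open>n\<close> are lost: two to the number of indices
    \<open>i\<close>, six to the bound for \<open>hcoef f i\<close>, two to \<open>Suc i\<close> in
    \<open>mel_decay\<close>. The further \<open>12\<close> factors give \<open>(1 / j) ^ 6\<close>,
    of which one power compensates \<open>Suc j\<close>.\<close>
  define a where "a = S + 10"
  obtain C where C: "C \<ge> 0" "\<And>i j. i < j \<Longrightarrow> \<bar>mel \<phi> i j\<bar> \<le> C * (real (Suc i) * real (Suc j)) *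
      (sqrt (real (2 * i + 1)) / (real (2 * j) - real (2 * i))) ^ (a + 12)"
    using mel_decay[OF \<phi> R, of "a + 12"] by blast
  have "\<bar>hcoef (\<lambda>x. \<phi> x * sigma_op h n f x) j\<bar> \<le> (2048 * C) * n powr (- real S) * wnorm f * (1 / real j) ^ 5"
    if n: "n \<ge> 1" and f: "weighted f" and j: "4 * n\<^sup>2 \<le> real j" for n f j
  proof -
    have n0: "0 < n" using n by simp
    have n2: "1 \<le> n\<^sup>2" using n by simp
    have j1: "1 \<le> real j" using j n2 by linarith
    let ?N = "2 * n\<^sup>2" and ?w = "wnorm f" and ?X = "(1 / n) ^ a * (1 / real j) ^ 6"
    have w: "0 \<le> ?w" by (rule wnorm_nonneg)
    have X: "0 \<le> ?X" using n by simp
    have "\<bar>hcoef (\<lambda>x. \<phi> x * sigma_op h n f x) j\<bar> \<le> (\<Sum>i<cutoff n. \<bar>coef h n i\<bar> * \<bar>hcoef f i\<bar> * \<bar>mel \<phi> i j\<bar>)"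
      unfolding hcoef_mult_sigma[OF \<phi> f n0] by (rule order_trans[OF sum_abs]) (simp add: abs_mult)
    also have "\<dots> \<le> (\<Sum>i<cutoff n. 1 * (32 * ?N ^ 3 * ?w) * (C * (?N * real (Suc j)) * ?X))"
    proof (intro sum_mono mult_mono)
      fix i assume i: "i \<in> {..<cutoff n}"
      have iN: "real (Suc i) \<le> ?N" using i cutoff_le[OF n] by simp
      show "\<bar>coef h n i\<bar> \<le> 1" by (rule coef_abs_le[OF h])
      have "\<bar>hcoef f i\<bar> \<le> 32 * real (Suc i) ^ 3 * ?w" by (rule hcoef_le[OF f])
      also have "\<dots> \<le> 32 * ?N ^ 3 * ?w" using iN w by (intro mult_right_mono mult_left_mono power_mono) auto
      finally show "\<bar>hcoef f i\<bar> \<le> 32 * ?N ^ 3 * ?w" .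
      have "i < j" using i by (intro mel_ratio_le(1)[OF n _ j]) auto
      then have r0: "0 \<le> (sqrt (real (2 * i + 1)) / (real (2 * j) - real (2 * i))) ^ (a + 12)"
        by (intro zero_le_power divide_nonneg_nonneg) auto
      have "\<bar>mel \<phi> i j\<bar> \<le> C * (real (Suc i) * real (Suc j)) * (sqrt (real (2 * i + 1)) / (real (2 * j) - real (2 * i))) ^ (a + 12)"
        using i by (intro C mel_ratio_le(1)[OF n _ j]) auto
      also have "\<dots> \<le> C * (?N * real (Suc j)) * ?X"
        by (intro mult_mono mult_left_mono mult_right_mono mel_ratio_le(2)[OF n _ j])
           (use i C(1) iN X r0 in auto)
      finally show "\<bar>mel \<phi> i j\<bar> \<le> C * (?N * real (Suc j)) * ?X" .
    qed (use w C X in auto)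
    also have "\<dots> = real (cutoff n) * ((32 * ?N ^ 3 * ?w) * (C * (?N * real (Suc j)) * ?X))" by simp
    also have "\<dots> \<le> ?N * ((32 * ?N ^ 3 * ?w) * (C * (?N * real (Suc j)) * ?X))"
      using cutoff_le[OF n] w C X by (intro mult_right_mono) auto
    also have "\<dots> \<le> ?N * ((32 * ?N ^ 3 * ?w) * (C * (?N * (2 * real j)) * ?X))"
      using j1 w C X by (intro mult_left_mono mult_right_mono) auto
    also have "\<dots> = (2048 * C) * (n ^ 10 * (1 / n) ^ a) * ?w * (real j * (1 / real j) ^ 6)"
      by (simp add: power_mult_distrib mult_ac power2_eq_square eval_nat_numeral)
    also have "n ^ 10 * (1 / n) ^ a = n powr (- real S)"
      using n by (simp add: a_def power_add power_divide powr_minus powr_realpow divide_simps)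
    also have "real j * (1 / real j) ^ 6 = (1 / real j) ^ 5"
      using j1 by (simp add: power_divide eval_nat_numeral)
    finally show ?thesis .
  qed
  then show ?thesis using C by (intro exI[of _ "2048 * C"]) auto
qed

text \<open>For \<open>M \<ge> 4 * n\<close> the operators of order \<open>M\<close> and
  \<open>4 * n\<close> both have coefficient \<open>1\<close> up to \<open>sqrt j = 2 * n\<close>;
  beyond that the Hermite coefficients of the product are tiny. Letting \<open>M\<close> run through
  powers of two gives the function itself.\<close>

lemma sigma_mult_approx:
  assumes \<phi>: "test_fun R \<phi>" and R: "0 \<le> R"
  shows "\<exists>C\<ge>0. \<forall>n\<ge>1. \<forall>f x. weighted f \<longrightarrow>
    \<bar>\<phi> x * sigma_op h n f x - sigma_op h (4 * n) (\<lambda>x. \<phi> x * sigma_op h n f x) x\<bar>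
      \<le> C * n powr (- real S) * wnorm f / (1 + x\<^sup>2)"
proof -
  obtain C where C: "C \<ge> 0" "\<And>n f j. n \<ge> 1 \<Longrightarrow> weighted f \<Longrightarrow> 4 * n\<^sup>2 \<le> real j \<Longrightarrow>
    \<bar>hcoef (\<lambda>x. \<phi> x * sigma_op h n f x) j\<bar> \<le> C * n powr (- real S) * wnorm f * (1 / real j) ^ 5"
    using hcoef_mult_sigma_decay[OF \<phi> R] by blast
  have sz: "summable (\<lambda>j. 1 / real j ^ 2)"
    using inverse_power_summable[of 2, where 'a = real] by (simp add: inverse_eq_divide)
  define Z where "Z = (\<Sum>j. 1 / real j ^ 2)"
  have Z0: "0 \<le> Z" unfolding Z_def by (intro suminf_nonneg sz) auto
  \<comment> \<open>\<open>32 * (2 * j) ^ 3 = 256 * j ^ 3\<close> bounds the Hermite function and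
    leaves \<open>1 / j ^ 2\<close> of the \<open>1 / j ^ 5\<close>; a further \<open>2\<close>
    bounds the difference of two filter coefficients.\<close>
  define D where "D = 512 * C * Z"
  have "\<bar>\<phi> x * sigma_op h n f x - sigma_op h (4 * n) (\<lambda>x. \<phi> x * sigma_op h n f x) x\<bar>
      \<le> D * n powr (- real S) * wnorm f / (1 + x\<^sup>2)" if n: "n \<ge> 1" and f: "weighted f" for n f x
  proof -
    have n0: "0 < n" "0 < 4 * n" using n by auto
    define g where "g x = \<phi> x * sigma_op h n f x" for x
    have cont: "isCont g x" for x
      unfolding g_def[abs_def] using \<phi> sigma_continuous[OF h f n0(1)]
      by (auto intro!: continuous_intros simp: test_fun_def smooth_isCont)
    have gz: "g x = 0" if "R < \<bar>x\<bar>" for x using \<phi> that by (simp add: g_def test_fun_def)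
    have g_meas: "g \<in> borel_measurable borel"
      by (intro borel_measurable_continuous_onI continuous_at_imp_continuous_on) (simp add: cont)
    have "bounded (g ` {-R..R})"
      by (intro compact_imp_bounded compact_continuous_image continuous_at_imp_continuous_on) (auto simp: cont)
    then obtain M where M: "\<forall>x\<in>{-R..R}. \<bar>g x\<bar> \<le> M" by (auto simp: bounded_iff)
    have gM: "\<bar>g x\<bar> \<le> max M 0" for x
    proof (cases "R < \<bar>x\<bar>")
      case False
      then have "x \<in> {-R..R}" by auto
      with M show ?thesis by (auto simp: le_max_iff_disj)
    qed (simp add: gz)
    have wg: "weighted g" by (rule weighted_bounded[OF g_meas gM])
    let ?Y = "C * n powr (- real S) * wnorm f"
    have Y: "0 \<le> ?Y" using C wnorm_nonneg[of f] by simp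
    have summand: "\<bar>hcoef g j * hermite_fun j x\<bar> \<le> 256 * ?Y / (1 + x\<^sup>2) * (1 / real j ^ 2)" if j: "4 * n\<^sup>2 \<le> real j" for j
    proof -
      have "1 \<le> n\<^sup>2" using n by simp
      then have j1: "1 \<le> real j" using j by linarith
      have "\<bar>hcoef g j\<bar> \<le> ?Y * (1 / real j) ^ 5" using C(2)[OF n f j] by (simp add: g_def[abs_def])
      moreover have "\<bar>hermite_fun j x\<bar> \<le> 32 * (2 * real j) ^ 3 / (1 + x\<^sup>2)"
      proof -
        have "32 * real (Suc j) ^ 3 \<le> 32 * (2 * real j) ^ 3" using j1 by (intro mult_left_mono power_mono) auto
        then have "32 * real (Suc j) ^ 3 / (1 + x\<^sup>2) \<le> 32 * (2 * real j) ^ 3 / (1 + x\<^sup>2)"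
          by (intro divide_right_mono) auto
        then show ?thesis using hermite_decay[of j x] by linarith
      qed
      ultimately have "\<bar>hcoef g j * hermite_fun j x\<bar> \<le> ?Y * (1 / real j) ^ 5 * (32 * (2 * real j) ^ 3 / (1 + x\<^sup>2))"
        unfolding abs_mult using Y by (intro mult_mono) auto
      also have "\<dots> = 256 * ?Y / (1 + x\<^sup>2) * (1 / real j ^ 2)"
        using j1 by (simp add: power_divide eval_nat_numeral mult_ac)
      finally show ?thesis .
    qed
    have le: "\<bar>sigma_op h M g x - sigma_op h (4 * n) g x\<bar> \<le> D * n powr (- real S) * wnorm f / (1 + x\<^sup>2)"
      if M: "4 * n \<le> M" for M
    proof -
      have M0: "0 < M" using M n0 by linarith
      define N where "N = max (cutoff M) (cutoff (4 * n))"
      have e: "sigma_op h m g x = (\<Sum>j<N. coef h m j * hcoef g j * hermite_fun j x)" if "m = M \<or> m = 4 * n" for m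
      proof -
        have m0: "0 < m" using that M0 n0 by auto
        have z: "coef h m j = 0" if "\<not> j < cutoff m" for j
          using coef_zero[OF h m0] that by (simp add: not_less)
        have "sigma_op h m g x = (\<Sum>j<cutoff m. coef h m j * hcoef g j * hermite_fun j x)"
          by (rule sigma_eq_sum[OF h wg m0])
        also have "\<dots> = (\<Sum>j<N. coef h m j * hcoef g j * hermite_fun j x)"
          by (rule sum.mono_neutral_left) (use that z in \<open>auto simp: N_def\<close>)
        finally show ?thesis .
      qed
      have "\<bar>sigma_op h M g x - sigma_op h (4 * n) g x\<bar> =
          \<bar>\<Sum>j<N. (coef h M j - coef h (4 * n) j) * (hcoef g j * hermite_fun j x)\<bar>"
        by (simp add: e sum_subtractf[symmetric] algebra_simps)
      also have "\<dots> \<le> (\<Sum>j<N. \<bar>coef h M j - coef h (4 * n) j\<bar> * \<bar>hcoef g j * hermite_fun j x\<bar>)"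
        by (rule order_trans[OF sum_abs]) (simp add: abs_mult)
      also have "\<dots> \<le> (\<Sum>j<N. 2 * (256 * ?Y / (1 + x\<^sup>2) * (1 / real j ^ 2)))"
      proof (intro sum_mono)
        fix j
        show "\<bar>coef h M j - coef h (4 * n) j\<bar> * \<bar>hcoef g j * hermite_fun j x\<bar> \<le> 2 * (256 * ?Y / (1 + x\<^sup>2) * (1 / real j ^ 2))"
        proof (cases "4 * n\<^sup>2 \<le> real j")
          case True
          have "\<bar>coef h M j - coef h (4 * n) j\<bar> \<le> 2"
            using coef_abs_le[OF h, of M j] coef_abs_le[OF h, of "4 * n" j] by linarith
          then show ?thesis using summand[OF True] by (intro mult_mono) auto
        next
          case False
          then have "real j \<le> (2 * n)\<^sup>2" by (simp add: power_mult_distrib)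
          then have "sqrt (real j) \<le> 2 * n" using n by (intro real_le_lsqrt) auto
          then have "coef h M j = 1" "coef h (4 * n) j = 1"
            using M M0 n0 by (auto intro!: coef_eq_1[OF h])
          then show ?thesis using Y by simp
        qed
      qed
      also have "\<dots> = 512 * ?Y / (1 + x\<^sup>2) * (\<Sum>j<N. 1 / real j ^ 2)"
        by (simp add: sum_distrib_left)
      also have "\<dots> \<le> 512 * ?Y / (1 + x\<^sup>2) * Z"
        unfolding Z_def using Y by (intro mult_left_mono sum_le_suminf sz) auto
      also have "\<dots> = D * n powr (- real S) * wnorm f / (1 + x\<^sup>2)" by (simp add: D_def)
      finally show ?thesis .
    qed
    have "(\<lambda>m. sigma_op h (2 ^ m) g x) \<longlonglongrightarrow> g x" by (rule sigma_tendsto[OF h g_meas gM cont])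
    then have "(\<lambda>m. \<bar>sigma_op h (2 ^ m) g x - sigma_op h (4 * n) g x\<bar>) \<longlonglongrightarrow> \<bar>g x - sigma_op h (4 * n) g x\<bar>"
      by (intro tendsto_intros)
    moreover obtain m0 where m0: "4 * n \<le> 2 ^ m0"
      using real_arch_pow[of 2 "4 * n"] by (auto intro: less_imp_le)
    have "\<bar>sigma_op h (2 ^ m) g x - sigma_op h (4 * n) g x\<bar> \<le> D * n powr (- real S) * wnorm f / (1 + x\<^sup>2)" if "m0 \<le> m" for m
      using le[of "2 ^ m"] m0 power_increasing[OF that, of "2 :: real"] by linarith
    ultimately have "\<bar>g x - sigma_op h (4 * n) g x\<bar> \<le> D * n powr (- real S) * wnorm f / (1 + x\<^sup>2)"
      by (intro LIMSEQ_le_const2) blast+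
    then show ?thesis by (simp add: g_def[abs_def])
  qed
  moreover have "0 \<le> D" using C Z0 by (simp add: D_def)
  ultimately show ?thesis by blast
qed

end

section \<open>Equivalence of the local conditions\<close>

lemma cball_lebesgue [simp]: "cball x \<delta> \<in> sets lebesgue" for x :: real
  by (intro sets_completionI_sets) simp

text \<open>On a ball a constant is at most a multiple of \<open>1 / (1 + x^2)\<close>, so
  \<open>Lp_norm_decay_le\<close> applies with its constant free of \<open>p\<close>.\<close>

lemma Lp_norm_local_decay_le:
  assumes f: "f \<in> borel_measurable lebesgue" and p: "1 \<le> p" and c: "0 \<le> c"
    and le: "\<And>x. x \<in> cball x0 \<delta> \<Longrightarrow> \<bar>f x\<bar> \<le> c"
  shows "Lp_norm p (cball x0 \<delta>) f \<le> ennreal (4 * (c * (1 + (\<bar>x0\<bar> + \<bar>\<delta>\<bar>)\<^sup>2)))"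
proof (rule Lp_norm_decay_le[OF _ f p])
  let ?R = "\<bar>x0\<bar> + \<bar>\<delta>\<bar>"
  fix x assume x: "x \<in> cball x0 \<delta>"
  then have "\<bar>x\<bar> \<le> ?R" by (auto simp: dist_real_def)
  then have "x\<^sup>2 \<le> ?R\<^sup>2" by (intro abs_le_square_iff[THEN iffD1]) auto
  then have "c * (1 + x\<^sup>2) \<le> c * (1 + ?R\<^sup>2)" using c by (intro mult_left_mono) auto
  then have "c \<le> c * (1 + ?R\<^sup>2) / (1 + x\<^sup>2)" by (simp add: pos_le_divide_eq)
  then show "\<bar>f x\<bar> \<le> c * (1 + ?R\<^sup>2) / (1 + x\<^sup>2)" using le[OF x] by linarith
qed (use c in auto)

lemma Xspace_test_fun_mult:
  assumes \<phi>: "test_fun R \<phi>" and f: "f \<in> Xspace p" and p: "1 \<le> p"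
  shows "(\<lambda>x. \<phi> x * f x) \<in> Xspace p"
proof -
  obtain M where M: "0 \<le> M" "\<And>x. \<bar>\<phi> x\<bar> \<le> M"
    using smooth_compact_bounded[of \<phi> R] \<phi> by (auto simp: test_fun_def)
  have meas: "(\<lambda>x. \<phi> x * f x) \<in> borel_measurable lebesgue"
    using \<phi> Xspace_measurable[OF f] lebesgue_measurable_borel[OF smooth_borel_measurable[of \<phi>]]
    by (simp add: test_fun_def)
  show ?thesis
  proof (cases "p = top")
    case True
    have "continuous_on UNIV f" using f True by (auto simp: Xspace_def)
    moreover have "continuous_on UNIV \<phi>"
      using \<phi> by (intro continuous_at_imp_continuous_on) (auto simp: test_fun_def smooth_isCont)
    ultimately have "continuous_on UNIV (\<lambda>x. \<phi> x * f x)" by (intro continuous_on_mult)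
    moreover have "eventually (\<lambda>x. \<phi> x * f x = 0) at_infinity"
      unfolding eventually_at_infinity using \<phi> by (intro exI[of _ "\<bar>R\<bar> + 1"]) (auto simp: test_fun_def)
    then have "((\<lambda>x. \<phi> x * f x) \<longlongrightarrow> 0) at_infinity" by (rule tendsto_eventually)
    ultimately show ?thesis using True by (simp add: Xspace_def)
  next
    case False
    have "Lp_norm p UNIV (\<lambda>x. \<phi> x * f x) \<le> ennreal M * Lp_norm p UNIV f"
      by (rule Lp_norm_mono_mult[OF _ _ meas Xspace_measurable[OF f] p M(1)])
         (use M in \<open>auto simp: abs_mult intro!: mult_right_mono AE_I2\<close>)
    also have "\<dots> < \<infinity>" using Xspace_norm_finite[OF f] by (simp add: ennreal_mult_less_top)
    finally show ?thesis using False meas by (simp add: Xspace_def)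
  qed
qed

lemma zero_in_hermite_span: "(\<lambda>x. 0) \<in> hermite_span t"
  unfolding hermite_span_def by (auto intro: exI[of _ "\<lambda>j. 0"])

lemma best_approx_le: "Q \<in> hermite_span t \<Longrightarrow> best_approx t p f \<le> Lp_norm p UNIV (\<lambda>x. f x - Q x)"
  unfolding best_approx_def by (rule INF_lower)

lemma best_approx_finite: "f \<in> Xspace p \<Longrightarrow> best_approx t p f < \<infinity>"
  using best_approx_le[OF zero_in_hermite_span, of t p f] Xspace_norm_finite[of f p] by (simp add: order_le_less_trans)

context
  fixes h :: "real \<Rightarrow> real"
  assumes h: "low_pass_filter h"
begin

lemma sigma_lebesgue: "weighted f \<Longrightarrow> sigma_op h (2 ^ n) f \<in> borel_measurable lebesgue"
  by (intro lebesgue_measurable_borel sigma_measurable[OF h]) auto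

lemma sigma_norm_finite:
  assumes f: "f \<in> Xspace p" and p: "1 \<le> p" shows "Lp_norm p UNIV (sigma_op h (2 ^ n) f) < \<infinity>"
proof -
  obtain C where "0 < C" and C: "\<And>n p f. n \<ge> 1 \<Longrightarrow> 1 \<le> p \<Longrightarrow> f \<in> borel_measurable lebesgue \<Longrightarrow> Lp_norm p UNIV f < \<infinity> \<Longrightarrow>
    Lp_norm p UNIV (sigma_op h n f) \<le> ennreal C * Lp_norm p UNIV f"
    using sigma_Lp_bounded[OF h] by blast
  have "Lp_norm p UNIV (sigma_op h (2 ^ n) f) \<le> ennreal C * Lp_norm p UNIV f"
    by (rule C[OF _ p Xspace_measurable[OF f] Xspace_norm_finite[OF f]]) simp
  also have "\<dots> < \<infinity>" using Xspace_norm_finite[OF f] by (simp add: ennreal_mult_less_top)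
  finally show ?thesis .
qed

text \<open>A reproduced \<open>Q\<close> may be subtracted: the error of \<open>g\<close> is that
  of \<open>g - Q\<close>, hence at most \<open>1 + C\<close> times the norm of
  \<open>g - Q\<close>. Reproduction reaches half the order, whence \<open>Suc n\<close> against
  \<open>n\<close>.\<close>

lemma sigma_error_le_best_approx:
  "\<exists>K\<ge>0. \<forall>p g n. 1 \<le> p \<longrightarrow> g \<in> Xspace p \<longrightarrow>
    Lp_norm p UNIV (\<lambda>x. g x - sigma_op h (2 ^ Suc n) g x) \<le> ennreal K * best_approx (2 ^ n) p g"
proof -
  obtain C where C: "0 < C" "\<And>n p f. n \<ge> 1 \<Longrightarrow> 1 \<le> p \<Longrightarrow> f \<in> borel_measurable lebesgue \<Longrightarrow> Lp_norm p UNIV f < \<infinity> \<Longrightarrow>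
    Lp_norm p UNIV (sigma_op h n f) \<le> ennreal C * Lp_norm p UNIV f"
    using sigma_Lp_bounded[OF h] by blast
  define K where "K = 1 + C"
  have K: "0 < K" using C by (simp add: K_def)
  have "Lp_norm p UNIV (\<lambda>x. g x - sigma_op h (2 ^ Suc n) g x) \<le> ennreal K * best_approx (2 ^ n) p g"
    if p: "1 \<le> p" and g: "g \<in> Xspace p" for p g n
  proof -
    let ?N = "2 ^ Suc n :: real" and ?e = "Lp_norm p UNIV (\<lambda>x. g x - sigma_op h (2 ^ Suc n) g x)"
    have wg: "weighted g" using weighted_Xspace[OF g p] .
    have gm: "g \<in> borel_measurable lebesgue" using Xspace_measurable[OF g] .
    have "?e \<le> ennreal K * Lp_norm p UNIV (\<lambda>x. g x - Q x)" if Q: "Q \<in> hermite_span (2 ^ n)" for Q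
    proof (cases "Lp_norm p UNIV (\<lambda>x. g x - Q x) < \<infinity>")
      case True
      have wQ: "weighted Q" using weighted_span[OF Q] .
      let ?d = "\<lambda>x. g x - Q x"
      have dm: "?d \<in> borel_measurable lebesgue" using gm weighted_measurable[OF wQ] by simp
      have wd: "weighted ?d" using weighted_diff[OF wg wQ] .
      have "sigma_op h ?N Q = Q" by (rule sigma_reproduces[OF h Q]) auto
      then have "(\<lambda>x. g x - sigma_op h ?N g x) = (\<lambda>x. ?d x - sigma_op h ?N ?d x)"
        using sigma_diff[OF h wg wQ, of ?N] by (simp add: fun_eq_iff)
      then have "?e = Lp_norm p UNIV (\<lambda>x. ?d x - sigma_op h ?N ?d x)" by simp
      also have "\<dots> \<le> Lp_norm p UNIV ?d + Lp_norm p UNIV (sigma_op h ?N ?d)"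
        by (rule Lp_norm_triangle_diff[OF _ dm sigma_lebesgue[OF wd] p]) simp
      also have "\<dots> \<le> Lp_norm p UNIV ?d + ennreal C * Lp_norm p UNIV ?d"
        by (intro add_left_mono C(2)[OF _ p dm True] one_le_power) simp
      also have "\<dots> = ennreal K * Lp_norm p UNIV ?d" using C by (simp add: K_def distrib_right)
      finally show ?thesis .
    qed (use K in \<open>auto simp: not_less top_unique ennreal_mult_top\<close>)
    \<comment> \<open>Dividing by \<open>K\<close> beforehand lets the infimum over \<open>Q\<close>
      be taken directly.\<close>
    then have "ennreal (1 / K) * ?e \<le> Lp_norm p UNIV (\<lambda>x. g x - Q x)" if "Q \<in> hermite_span (2 ^ n)" for Q
    proof -
      have "ennreal (1 / K) * ?e \<le> ennreal (1 / K) * (ennreal K * Lp_norm p UNIV (\<lambda>x. g x - Q x))"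
        using \<open>\<And>Q. Q \<in> hermite_span (2 ^ n) \<Longrightarrow> ?e \<le> _\<close>[OF that] by (intro mult_left_mono) auto
      also have "\<dots> = Lp_norm p UNIV (\<lambda>x. g x - Q x)"
        using K by (simp add: mult.assoc[symmetric] ennreal_mult'[symmetric])
      finally show ?thesis .
    qed
    then have "ennreal (1 / K) * ?e \<le> best_approx (2 ^ n) p g"
      unfolding best_approx_def by (rule INF_greatest)
    then have "ennreal K * (ennreal (1 / K) * ?e) \<le> ennreal K * best_approx (2 ^ n) p g"
      by (intro mult_left_mono) auto
    then show ?thesis using K by (simp add: mult.assoc[symmetric] ennreal_mult'[symmetric])
  qed
  then show ?thesis using K by (intro exI[of _ K]) simp
qed

context
  fixes f :: "real \<Rightarrow> real" and p \<rho> :: ennreal and \<gamma> x0 :: real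
  assumes p: "1 \<le> p" and f: "f \<in> Xspace p" and \<rho>: "0 < \<rho>" and \<gamma>: "0 < \<gamma>"
begin

lemma weighted_f: "weighted f"
  using weighted_Xspace[OF f p] .

lemma tau_if_sigma:
  assumes a: "(\<lambda>n. Lp_norm p (cball x0 \<delta>) (\<lambda>x. f x - sigma_op h (2 ^ n) f x)) \<in> seq_space \<rho> \<gamma>"
  shows "(\<lambda>n. Lp_norm p (cball x0 \<delta>) (tau_op h n f)) \<in> seq_space \<rho> \<gamma>"
proof -
  let ?B = "cball x0 \<delta>" and ?a = "\<lambda>n. Lp_norm p (cball x0 \<delta>) (\<lambda>x. f x - sigma_op h (2 ^ n) f x)"
  have m: "(\<lambda>x. f x - sigma_op h (2 ^ n) f x) \<in> borel_measurable lebesgue" for n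
    using Xspace_measurable[OF f] sigma_lebesgue[OF weighted_f] by simp
  have le: "Lp_norm p ?B (tau_op h (Suc n) f) \<le> ennreal 1 * (?a n + ?a (Suc n))" for n
  proof -
    have "tau_op h (Suc n) f = (\<lambda>x. (f x - sigma_op h (2 ^ n) f x) - (f x - sigma_op h (2 ^ Suc n) f x))"
      by (simp add: fun_eq_iff)
    then show ?thesis
      using Lp_norm_triangle_diff[OF cball_lebesgue m[of n] m[of "Suc n"] p, of x0 \<delta>]
      by (simp only: ennreal_1 mult_1_left)
  qed
  have "(\<lambda>n. ?a n + ?a (Suc n)) \<in> seq_space \<rho> \<gamma>"
    by (rule seq_space_add[OF \<rho> a seq_space_Suc_iff[where a = ?a, OF \<rho> seq_space_finite[OF \<rho> a], THEN iffD2, OF a]])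
  then have "(\<lambda>n. Lp_norm p ?B (tau_op h (Suc n) f)) \<in> seq_space \<rho> \<gamma>"
    by (rule seq_space_mono[OF \<rho> _ zero_le_one le])
  \<comment> \<open>\<open>tau_op h 0\<close> is not a difference of two errors; as a single entry
    it only has to be finite.\<close>
  moreover have "Lp_norm p ?B (tau_op h 0 f) < \<infinity>"
  proof -
    have "tau_op h 0 f = sigma_op h (2 ^ 0) f" by (simp add: fun_eq_iff)
    then have "Lp_norm p ?B (tau_op h 0 f) \<le> Lp_norm p UNIV (sigma_op h (2 ^ 0) f)"
      using sigma_lebesgue[OF weighted_f, of 0] p by (simp only:) (intro Lp_norm_mono, auto)
    then show ?thesis using sigma_norm_finite[OF f p, of 0] by (simp add: order_le_less_trans)
  qed
  ultimately show ?thesis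
    using seq_space_Suc_iff[where a = "\<lambda>n. Lp_norm p ?B (tau_op h n f)", OF \<rho>, THEN iffD1] by simp
qed

lemma sigma_if_tau:
  assumes t: "(\<lambda>n. Lp_norm p (cball x0 \<delta>) (tau_op h n f)) \<in> seq_space \<rho> \<gamma>"
  shows "(\<lambda>n. Lp_norm p (cball x0 \<delta>) (\<lambda>x. f x - sigma_op h (2 ^ n) f x)) \<in> seq_space \<rho> \<gamma>"
proof -
  let ?t = "\<lambda>n. Lp_norm p (cball x0 \<delta>) (tau_op h n f)"
  have "(\<lambda>n. ?t (Suc n)) \<in> seq_space \<rho> \<gamma>"
    by (rule seq_space_Suc_iff[where a = ?t, OF \<rho> seq_space_finite[OF \<rho> t], THEN iffD2, OF t])
  from seq_space_tail[OF \<rho> \<gamma> this] show ?thesis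
    by (rule seq_space_mono[OF \<rho> _ zero_le_one]) (use sigma_error_le_tail[OF h weighted_f p] in simp)
qed

text \<open>With \<open>P\<close> the operator of order \<open>4 * 2^m\<close> applied to
  \<open>\<phi> * \<sigma> f\<close>, the error \<open>\<phi> * f - P\<close> splits into
  \<open>\<phi> * (f - \<sigma> f)\<close> and \<open>\<phi> * \<sigma> f - P\<close>. The first is
  controlled by the local error since \<open>\<phi>\<close> lives in the ball; the second decays
  faster than \<open>2 powr (- \<gamma> * m)\<close>.\<close>

lemma local_besov_if_sigma:
  assumes \<delta>: "0 < \<delta>"
    and a: "(\<lambda>n. Lp_norm p (cball x0 \<delta>) (\<lambda>x. f x - sigma_op h (2 ^ n) f x)) \<in> seq_space \<rho> \<gamma>"
  shows "f \<in> local_besov p \<rho> \<gamma> x0"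
proof -
  let ?B = "cball x0 \<delta>" and ?a = "\<lambda>n. Lp_norm p (cball x0 \<delta>) (\<lambda>x. f x - sigma_op h (2 ^ n) f x)"
  have "(\<lambda>x. \<phi> x * f x) \<in> besov p \<rho> \<gamma>" if "smooth \<phi>" and supp: "closure {x. \<phi> x \<noteq> 0} \<subseteq> ?B" for \<phi>
  proof -
    define R where "R = \<bar>x0\<bar> + \<delta>"
    have z: "\<phi> x = 0" if "x \<notin> ?B" for x using supp closure_subset[of "{x. \<phi> x \<noteq> 0}"] that by auto
    have \<phi>: "test_fun R \<phi>"
      unfolding test_fun_def
    proof (intro conjI allI impI \<open>smooth \<phi>\<close> z)
      fix x assume "R < \<bar>x\<bar>"
      then show "x \<notin> ?B" by (auto simp: R_def dist_real_def)
    qed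
    have R: "0 \<le> R" using \<delta> by (simp add: R_def)
    have X: "(\<lambda>x. \<phi> x * f x) \<in> Xspace p" by (rule Xspace_test_fun_mult[OF \<phi> f p])
    obtain M where M: "0 \<le> M" "\<And>x. \<bar>\<phi> x\<bar> \<le> M"
      using smooth_compact_bounded[of \<phi> R] \<phi> by (auto simp: test_fun_def)
    obtain S :: nat where S: "\<gamma> < real S" using reals_Archimedean2 by blast
    obtain C where C: "0 \<le> C" "\<And>n f x. n \<ge> 1 \<Longrightarrow> weighted f \<Longrightarrow>
      \<bar>\<phi> x * sigma_op h n f x - sigma_op h (4 * n) (\<lambda>x. \<phi> x * sigma_op h n f x) x\<bar>
        \<le> C * n powr (- real S) * wnorm f / (1 + x\<^sup>2)"
      using sigma_mult_approx[OF h \<phi> R] by blast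
    let ?E = "\<lambda>n. best_approx (2 ^ n) p (\<lambda>x. \<phi> x * f x)"
    let ?b = "\<lambda>m. ennreal (4 * C * wnorm f * 2 powr (- real S * real m))"
    have phim: "\<phi> \<in> borel_measurable borel" using \<open>smooth \<phi>\<close> by (rule smooth_borel_measurable)
    \<comment> \<open>The order \<open>4 * 2 ^ m\<close> is \<open>2 ^ (m + 2)\<close>; the two
      entries this omits are finite and are restored at the end.\<close>
    have le: "?E (Suc (Suc m)) \<le> ennreal M * ?a m + ?b m" for m
    proof -
      define g where "g x = \<phi> x * sigma_op h (2 ^ m) f x" for x
      define P where "P = sigma_op h (4 * 2 ^ m) g"
      have sm: "sigma_op h (2 ^ m) f \<in> borel_measurable borel" by (rule sigma_measurable[OF h weighted_f]) simp
      have gm: "g \<in> borel_measurable borel" unfolding g_def[abs_def] using phim sm by measurable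
      have wg: "weighted g"
        unfolding g_def[abs_def] by (rule weighted_mult_bounded[OF weighted_span[OF sigma_in_span[OF h weighted_f]] phim M(2)]) simp
      have Pm: "P \<in> borel_measurable borel" unfolding P_def by (rule sigma_measurable[OF h wg]) simp
      have "P \<in> hermite_span (4 * 2 ^ m)" unfolding P_def by (rule sigma_in_span[OF h wg]) simp
      then have "?E (Suc (Suc m)) \<le> Lp_norm p UNIV (\<lambda>x. \<phi> x * f x - P x)"
        by (intro best_approx_le) simp
      also have "(\<lambda>x. \<phi> x * f x - P x) = (\<lambda>x. \<phi> x * (f x - sigma_op h (2 ^ m) f x) + (g x - P x))"
        by (simp add: fun_eq_iff g_def algebra_simps)
      also have "Lp_norm p UNIV \<dots> \<le> Lp_norm p UNIV (\<lambda>x. \<phi> x * (f x - sigma_op h (2 ^ m) f x)) + Lp_norm p UNIV (\<lambda>x. g x - P x)"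
        by (rule Lp_norm_triangle[OF _ _ _ p])
           (use lebesgue_measurable_borel[OF phim] lebesgue_measurable_borel[OF sm] lebesgue_measurable_borel[OF gm]
              lebesgue_measurable_borel[OF Pm] Xspace_measurable[OF f] in auto)
      also have "\<dots> \<le> ennreal M * ?a m + ?b m"
      proof (rule add_mono)
        show "Lp_norm p UNIV (\<lambda>x. \<phi> x * (f x - sigma_op h (2 ^ m) f x)) \<le> ennreal M * ?a m"
        proof (rule Lp_norm_mono_mult[OF _ _ _ _ p M(1)])
          show "AE x in lebesgue. x \<in> UNIV \<longrightarrow> \<bar>\<phi> x * (f x - sigma_op h (2 ^ m) f x)\<bar> \<le>
              (if x \<in> ?B then M * \<bar>f x - sigma_op h (2 ^ m) f x\<bar> else 0)"
            using M z by (auto simp: abs_mult intro!: mult_right_mono AE_I2)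
        qed (use lebesgue_measurable_borel[OF phim] lebesgue_measurable_borel[OF sm] Xspace_measurable[OF f] in auto)
        have "Lp_norm p UNIV (\<lambda>x. g x - P x) \<le> ennreal (4 * (C * (2 ^ m) powr (- real S) * wnorm f))"
        proof (rule Lp_norm_decay_le[OF _ _ p])
          show "\<bar>g x - P x\<bar> \<le> C * (2 ^ m) powr (- real S) * wnorm f / (1 + x\<^sup>2)" for x
            using C(2)[OF _ weighted_f, of "2 ^ m" x] by (simp add: g_def[abs_def] P_def)
        qed (use lebesgue_measurable_borel[OF gm] lebesgue_measurable_borel[OF Pm] C wnorm_nonneg[of f] in auto)
        also have "(2 ^ m :: real) powr (- real S) = 2 powr (- real S * real m)"
          by (simp add: powr_realpow[symmetric] powr_powr mult.commute)
        finally show "Lp_norm p UNIV (\<lambda>x. g x - P x) \<le> ?b m" by (simp add: mult_ac)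
      qed
      finally show ?thesis .
    qed
    have "(\<lambda>m. ennreal M * ?a m) \<in> seq_space \<rho> \<gamma>" by (rule seq_space_mono[OF \<rho> a M(1)]) simp
    moreover have "?b \<in> seq_space \<rho> \<gamma>"
      by (rule seq_space_fast_decay[OF \<rho> S, of "4 * C * wnorm f"]) (use C wnorm_nonneg[of f] in auto)
    ultimately have "(\<lambda>m. ennreal M * ?a m + ?b m) \<in> seq_space \<rho> \<gamma>" by (rule seq_space_add[OF \<rho>])
    then have "(\<lambda>m. ?E (Suc (Suc m))) \<in> seq_space \<rho> \<gamma>"
      by (rule seq_space_mono[OF \<rho> _ zero_le_one]) (use le in simp)
    then have "(\<lambda>m. ?E (Suc m)) \<in> seq_space \<rho> \<gamma>"
      by (rule seq_space_Suc_iff[where a = "\<lambda>m. ?E (Suc m)", OF \<rho> best_approx_finite[OF X], THEN iffD1])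
    then have "?E \<in> seq_space \<rho> \<gamma>"
      by (rule seq_space_Suc_iff[where a = ?E, OF \<rho> best_approx_finite[OF X], THEN iffD1])
    then show ?thesis using X by (simp add: besov_def)
  qed
  then show ?thesis using f \<delta> unfolding local_besov_def by blast
qed

text \<open>\<open>f\<close> is split into a cut-off part \<open>g\<close>, which has globally good
  approximation, and a remainder \<open>r\<close> that vanishes near \<open>x0\<close>. On a smaller
  ball the error of \<open>f\<close> is that of \<open>g\<close> minus the image of
  \<open>r\<close>, which is small by localization.\<close>

lemma sigma_if_local_besov:
  assumes "f \<in> local_besov p \<rho> \<gamma> x0"
  shows "\<exists>\<delta>>0. (\<lambda>n. Lp_norm p (cball x0 \<delta>) (\<lambda>x. f x - sigma_op h (2 ^ n) f x)) \<in> seq_space \<rho> \<gamma>"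
proof -
  obtain \<delta> where \<delta>: "0 < \<delta>" and B: "\<And>\<phi>. smooth \<phi> \<Longrightarrow> closure {x. \<phi> x \<noteq> 0} \<subseteq> cball x0 \<delta> \<Longrightarrow>
      (\<lambda>x. \<phi> x * f x) \<in> besov p \<rho> \<gamma>"
    using assms unfolding local_besov_def by blast
  \<comment> \<open>the filter itself serves as the cutoff function\<close>
  define \<phi> where "\<phi> x = h (1 / \<delta> * x + - x0 / \<delta>)" for x
  have arg: "1 / \<delta> * x + - x0 / \<delta> = (x - x0) / \<delta>" for x by (simp add: diff_divide_distrib)
  have sphi: "smooth \<phi>" unfolding \<phi>_def[abs_def] using h by (intro smooth_affine) (simp add: low_pass_filter_def)
  have phim: "\<phi> \<in> borel_measurable borel" using sphi by (rule smooth_borel_measurable)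
  have "{x. \<phi> x \<noteq> 0} \<subseteq> cball x0 \<delta>"
  proof
    fix x assume "x \<in> {x. \<phi> x \<noteq> 0}"
    then have "\<not> 1 \<le> \<bar>(x - x0) / \<delta>\<bar>" using h unfolding \<phi>_def arg low_pass_filter_def by blast
    then show "x \<in> cball x0 \<delta>" using \<delta> by (simp add: abs_divide dist_real_def abs_minus_commute)
  qed
  then have supp: "closure {x. \<phi> x \<noteq> 0} \<subseteq> cball x0 \<delta>" by (rule closure_minimal) simp
  have one: "\<phi> x = 1" if "x \<in> cball x0 (\<delta> / 2)" for x
  proof -
    have "\<bar>(x - x0) / \<delta>\<bar> \<le> 1 / 2" using that \<delta> by (simp add: abs_divide dist_real_def abs_minus_commute divide_le_eq)
    then show ?thesis using h unfolding \<phi>_def arg low_pass_filter_def by blast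
  qed
  have phi1: "\<bar>\<phi> x\<bar> \<le> 1" for x using h by (auto simp: \<phi>_def low_pass_filter_def)
  define g where "g x = \<phi> x * f x" for x
  define r where "r x = f x - g x" for x
  have gB: "g \<in> Xspace p" "(\<lambda>n. best_approx (2 ^ n) p g) \<in> seq_space \<rho> \<gamma>"
    using B[OF sphi supp] unfolding besov_def g_def[abs_def] by auto
  have wg: "weighted g" using weighted_Xspace[OF gB(1) p] .
  have wr: "weighted r" unfolding r_def[abs_def] using weighted_diff[OF weighted_f wg] .
  have rz: "r y = 0" if "y \<in> cball x0 (\<delta> / 2)" for y using one[OF that] by (simp add: r_def g_def)
  obtain S :: nat where S: "\<gamma> < real S" using reals_Archimedean2 by blast
  have d2: "0 < \<delta> / 2" using \<delta> by simp
  obtain C where C: "0 \<le> C" "\<And>n f x. n \<ge> 1 \<Longrightarrow> weighted f \<Longrightarrow> (\<And>y. y \<in> cball x0 (\<delta> / 2) \<Longrightarrow> f y = 0) \<Longrightarrow>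
      x \<in> cball x0 (\<delta> / 2 / 2) \<Longrightarrow> \<bar>sigma_op h n f x\<bar> \<le> C * n powr (- real S) * wnorm f"
    using sigma_localized[OF h d2, of x0 S] by blast
  obtain K where K: "0 \<le> K" "\<And>p g n. 1 \<le> p \<Longrightarrow> g \<in> Xspace p \<Longrightarrow>
    Lp_norm p UNIV (\<lambda>x. g x - sigma_op h (2 ^ Suc n) g x) \<le> ennreal K * best_approx (2 ^ n) p g"
    using sigma_error_le_best_approx by blast
  \<comment> \<open>\<open>r\<close> vanishes on the ball of radius \<open>\<delta> / 2\<close>, and
    \<open>sigma_localized\<close> halves the radius once more.\<close>
  let ?B = "cball x0 (\<delta> / 4)"
  let ?e = "\<lambda>n. Lp_norm p UNIV (\<lambda>x. g x - sigma_op h (2 ^ n) g x)"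
  define W where "W = 4 * (C * wnorm r * (1 + (\<bar>x0\<bar> + \<bar>\<delta> / 4\<bar>)\<^sup>2))"
  let ?b = "\<lambda>n. ennreal (W * 2 powr (- real S * real n))"
  have W: "0 \<le> W" using C wnorm_nonneg[of r] by (simp add: W_def)
  have sub: "x \<in> cball x0 (\<delta> / 2)" if "x \<in> ?B" for x using that \<delta> by auto
  have gm: "g \<in> borel_measurable lebesgue" using weighted_measurable[OF wg] .
  have fm: "f \<in> borel_measurable lebesgue" using weighted_measurable[OF weighted_f] .
  have le: "Lp_norm p ?B (\<lambda>x. f x - sigma_op h (2 ^ n) f x) \<le> ?e n + ?b n" for n
  proof -
    have sr: "sigma_op h (2 ^ n) r x = sigma_op h (2 ^ n) f x - sigma_op h (2 ^ n) g x" for x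
      unfolding r_def[abs_def] by (rule sigma_diff[OF h weighted_f wg]) simp
    have "Lp_norm p ?B (\<lambda>x. f x - sigma_op h (2 ^ n) f x) \<le>
        Lp_norm p ?B (\<lambda>x. (g x - sigma_op h (2 ^ n) g x) - sigma_op h (2 ^ n) r x)"
    proof (rule Lp_norm_mono[OF _ _ _ _ p])
      fix x assume "x \<in> ?B"
      then have "g x = f x" using one[OF sub] by (simp add: g_def)
      then show "x \<in> ?B \<and> \<bar>f x - sigma_op h (2 ^ n) f x\<bar> \<le> \<bar>(g x - sigma_op h (2 ^ n) g x) - sigma_op h (2 ^ n) r x\<bar>"
        using \<open>x \<in> ?B\<close> by (simp add: sr)
    qed (use gm fm sigma_lebesgue[OF weighted_f] sigma_lebesgue[OF wg] sigma_lebesgue[OF wr] in auto)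
    also have "\<dots> \<le> Lp_norm p ?B (\<lambda>x. g x - sigma_op h (2 ^ n) g x) + Lp_norm p ?B (sigma_op h (2 ^ n) r)"
      by (rule Lp_norm_triangle_diff[OF _ _ _ p]) (use gm sigma_lebesgue[OF wg] sigma_lebesgue[OF wr] in auto)
    also have "\<dots> \<le> ?e n + ?b n"
    proof (rule add_mono)
      show "Lp_norm p ?B (\<lambda>x. g x - sigma_op h (2 ^ n) g x) \<le> ?e n"
        by (rule Lp_norm_mono[OF _ _ _ _ p]) (use gm sigma_lebesgue[OF wg] in auto)
      have "Lp_norm p ?B (sigma_op h (2 ^ n) r) \<le> ennreal (4 * (C * (2 ^ n) powr (- real S) * wnorm r * (1 + (\<bar>x0\<bar> + \<bar>\<delta> / 4\<bar>)\<^sup>2)))"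
      proof (rule Lp_norm_local_decay_le[OF sigma_lebesgue[OF wr] p])
        fix x assume "x \<in> ?B"
        then show "\<bar>sigma_op h (2 ^ n) r x\<bar> \<le> C * (2 ^ n) powr (- real S) * wnorm r"
          using rz by (intro C(2) wr) auto
      qed (use C wnorm_nonneg[of r] in auto)
      also have "(2 ^ n :: real) powr (- real S) = 2 powr (- real S * real n)"
        by (simp add: powr_realpow[symmetric] powr_powr mult.commute)
      also have "4 * (C * 2 powr (- real S * real n) * wnorm r * (1 + (\<bar>x0\<bar> + \<bar>\<delta> / 4\<bar>)\<^sup>2)) = W * 2 powr (- real S * real n)"
        unfolding W_def by (simp only: mult_ac)
      finally show "Lp_norm p ?B (sigma_op h (2 ^ n) r) \<le> ?b n" .
    qed
    finally show ?thesis .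
  qed
  have e: "(\<lambda>n. ?e (Suc n)) \<in> seq_space \<rho> \<gamma>"
    by (rule seq_space_mono[OF \<rho> gB(2) K(1)]) (rule K(2)[OF p gB(1)])
  \<comment> \<open>The bound by the best approximation covers the indices from \<open>1\<close> on,
    so the entry at \<open>0\<close> is treated separately.\<close>
  have e0: "?e 0 < \<infinity>"
  proof -
    have "?e 0 \<le> Lp_norm p UNIV g + Lp_norm p UNIV (sigma_op h (2 ^ 0) g)"
      by (rule Lp_norm_triangle_diff[OF _ gm sigma_lebesgue[OF wg] p]) simp
    also have "\<dots> < \<infinity>"
      using Xspace_norm_finite[OF gB(1)] sigma_norm_finite[OF gB(1) p, of 0] by (simp add: ennreal_add_less_top)
    finally show ?thesis .
  qed
  have "?e \<in> seq_space \<rho> \<gamma>" by (rule seq_space_Suc_iff[where a = ?e, OF \<rho> e0, THEN iffD1, OF e])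
  moreover have "?b \<in> seq_space \<rho> \<gamma>"
    by (rule seq_space_fast_decay[OF \<rho> S W]) simp
  ultimately have "(\<lambda>n. ?e n + ?b n) \<in> seq_space \<rho> \<gamma>" by (rule seq_space_add[OF \<rho>])
  then have "(\<lambda>n. Lp_norm p ?B (\<lambda>x. f x - sigma_op h (2 ^ n) f x)) \<in> seq_space \<rho> \<gamma>"
    by (rule seq_space_mono[OF \<rho> _ zero_le_one]) (use le in simp)
  then show ?thesis using \<delta> by (intro exI[of _ "\<delta> / 4"]) auto
qed

end

end

theorem theorem10:
  fixes h f :: "real \<Rightarrow> real" and x0 \<gamma> :: real and p \<rho> :: ennreal
  assumes "low_pass_filter h"
    and "1 \<le> p" and "f \<in> Xspace p" and "0 < \<rho>" and "0 < \<gamma>"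
  shows "(f \<in> local_besov p \<rho> \<gamma> x0 \<longleftrightarrow>
           (\<exists>\<delta>>0. (\<lambda>n. Lp_norm p (cball x0 \<delta>) (\<lambda>x. f x - sigma_op h (2 ^ n) f x))
                    \<in> seq_space \<rho> \<gamma>))
       \<and> (f \<in> local_besov p \<rho> \<gamma> x0 \<longleftrightarrow>
           (\<exists>\<delta>>0. (\<lambda>n. Lp_norm p (cball x0 \<delta>) (tau_op h n f)) \<in> seq_space \<rho> \<gamma>))"
proof (intro conjI iffI)
  assume "f \<in> local_besov p \<rho> \<gamma> x0"
  then obtain \<delta> where \<delta>: "\<delta> > 0" "(\<lambda>n. Lp_norm p (cball x0 \<delta>) (\<lambda>x. f x - sigma_op h (2 ^ n) f x)) \<in> seq_space \<rho> \<gamma>"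
    using sigma_if_local_besov[OF assms] by blast
  then show "\<exists>\<delta>>0. (\<lambda>n. Lp_norm p (cball x0 \<delta>) (\<lambda>x. f x - sigma_op h (2 ^ n) f x)) \<in> seq_space \<rho> \<gamma>"
    by blast
  show "\<exists>\<delta>>0. (\<lambda>n. Lp_norm p (cball x0 \<delta>) (tau_op h n f)) \<in> seq_space \<rho> \<gamma>"
    using \<delta>(1) tau_if_sigma[OF assms \<delta>(2)] by blast
next
  assume "\<exists>\<delta>>0. (\<lambda>n. Lp_norm p (cball x0 \<delta>) (\<lambda>x. f x - sigma_op h (2 ^ n) f x)) \<in> seq_space \<rho> \<gamma>"
  then show "f \<in> local_besov p \<rho> \<gamma> x0"
    using local_besov_if_sigma[OF assms] by blast
next
  assume "\<exists>\<delta>>0. (\<lambda>n. Lp_norm p (cball x0 \<delta>) (tau_op h n f)) \<in> seq_space \<rho> \<gamma>"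
  then obtain \<delta> where \<delta>: "\<delta> > 0" "(\<lambda>n. Lp_norm p (cball x0 \<delta>) (tau_op h n f)) \<in> seq_space \<rho> \<gamma>"
    by blast
  then show "f \<in> local_besov p \<rho> \<gamma> x0"
    using local_besov_if_sigma[OF assms \<delta>(1) sigma_if_tau[OF assms \<delta>(2)]] by blast
qed

end
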